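(* Let $\mathcal{B}=\{b_j : j\in I\}\subset L_2(\mu)$ be a bounded orthonormal system with $B:=\sup_{j\in I}\|b_j\|_{L_\infty}<\infty$. There exist universal constants $\alpha,\tau>0$ and a constant $C_B>0$ depending only on $B$ such that for all $n\in\mathbb{N}$, all $\gamma\in(0,1)$ and all finite $J\subset I$ with $n<|J|$ the following holds. If $$m\ \ge\ \alpha B^2 n\Bigl(\log^2(B^2n)\,\log|J|+\log\bigl(\gamma^{-1}\log(B^2n)\bigr)\Bigr)$$ and $\mathbf{X}=\{x^1,\dots,x^m\}$ consists of $m$ points drawn independently and identically distributed according to $\mu$, then with probability at least $1-\gamma$ we have $$\|f-H_{\mathbf{X}}(f)\|_{L_q}\ \le\ C_B\, n^{\frac12-\frac1q}\Bigl(n^{-\frac12}\sigma_n(f;\mathcal{B})_{\mathcal{A}_1}+\|f-P_Jf\|_{L_\infty}\Bigr)$$ for any $2\le q\le\infty$ and $f\in\mathcal{A}_1$. Here $H_{\mathbf{X}}$ is either the rLasso decoder $R_{\mathbf{X}}^{\lambda}$ with $\lambda=3\tau n^{1/2}$, or the OMP decoder $P_{\mathbf{X}}^{24n}$.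
   Context: $\Omega$ is a topological space with a probability measure $\mu$; $L_q=L_q(\Omega,\mu)$ are the complex Lebesgue spaces. $\mathcal{B}=\{b_j\in C(\Omega): j\in I\}$ is countable, consists of continuous complex-valued functions, and is orthonormal in $L_2(\mu)$; it is a bounded orthonormal system (BOS) if $\sup_{j}\|b_j\|_{L_\infty}<\infty$. $\log$ is the natural logarithm. Coefficients: $[f]_j=\langle f,b_j\rangle$, $[f]=([f]_j)_{j\in I}$. The Wiener space $\mathcal{A}_1=\mathcal{A}_1(\mathcal{B})$ consists of all $f=\sum_{j\in I}[f]_jb_j$ with $\|f\|_{\mathcal{A}_1}:=\|[f]\|_{\ell_1}=\sum_j|[f]_j|<\infty$ (for a BOS the series converges absolutely and uniformly). The best $n$-term approximation error is $$\sigma_n(f;\mathcal{B})_{\mathcal{A}_1}=\inf_{K\subset I,\,|K|\le n}\ \inf_{c_j\in\mathbb{C},\,j\in K}\Bigl\|f-\sum_{j\in K}c_jb_j\Bigr\|_{\mathcal{A}_1}.$$ For finite $J\subset I$ let $V_J=\mathrm{span}_{\mathbb{C}}\{b_j: j\in J\}$ and $P_Jf=\sum_{j\in J}\langle f,b_j\rangle b_j$. Given $\mathbf{X}$ and $J$, put $\mathbf{A}=m^{-1/2}(b_j(x^l))_{1\le l\le m,\,j\in J}\in\mathbb{C}^{m\times|J|}$ and $\mathbf{y}=m^{-1/2}(f(x^l))_{l=1}^m\in\mathbb{C}^m$. rLasso decoder: for $\lambda>0$, $R_{\mathbf{X}}^\lambda(f)=\sum_{j\in J}r_j(\mathbf{y})b_j$,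 where $\mathbf{r}(\mathbf{y})$ is a minimizer (chosen by a fixed deterministic rule if not unique) of $\min_{\mathbf{z}\in\mathbb{C}^{|J|}}\|\mathbf{z}\|_{\ell_1}+\lambda\|\mathbf{A}\mathbf{z}-\mathbf{y}\|_{\ell_2}$. OMP decoder: for $k_0\in\mathbb{N}$, $P_{\mathbf{X}}^{k_0}(f)=\sum_{j\in J}p_j^{k_0}(\mathbf{y})b_j$, where $S^0=\emptyset$, $\mathbf{p}^0=\mathbf{0}$, and recursively $S^{k+1}=S^k\cup\{j^*\}$ with $j^*$ an index maximizing $|(\mathbf{A}^*(\mathbf{y}-\mathbf{A}\mathbf{p}^k))_j|$ over $j$ (the smallest such index in a fixed enumeration of $J$ if not unique), and $\mathbf{p}^{k+1}=\mathrm{argmin}\{\|\mathbf{y}-\mathbf{A}\mathbf{p}\|_{\ell_2}:\mathrm{supp}(\mathbf{p})\subset S^{k+1}\}$.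
   Formalization: For n=1 the factor log(B²n) is replaced by max(1, log(B²n)), since for B near 1 the stated sample condition is undefined or admits too few points and the claim fails; n starts at 1, and the constants are uniform over spaces on a common, arbitrary carrier set. *)

theory Defs
  imports "HOL-Probability.Probability"
begin

section \<open>Function spaces\<close>

text \<open>The norm takes values in \<^typ>\<open>ennreal\<close>, so that it is infinite, and not a junk value,
  for functions outside the space.\<close>

definition Lq_norm :: "'a measure \<Rightarrow> ennreal \<Rightarrow> ('a \<Rightarrow> complex) \<Rightarrow> ennreal" where
  "Lq_norm M q f =
     (if q = \<infinity> then esssup M (\<lambda>x. ennreal (cmod (f x)))
      else let N = (\<integral>\<^sup>+ x. ennreal (cmod (f x) powr enn2real q) \<partial>M)
           in if N = \<infinity> then \<infinity> else ennreal (enn2real N powr (1 / enn2real q)))"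

definition L2_inner :: "'a measure \<Rightarrow> ('a \<Rightarrow> complex) \<Rightarrow> ('a \<Rightarrow> complex) \<Rightarrow> complex" where
  "L2_inner M f g = (LINT x|M. f x * cnj (g x))"

text \<open>The topology is a value of type \<^typ>\<open>'a topology\<close> and not a type class instance, so that a
  statement can quantify over all spaces carried by subsets of \<^typ>\<open>'a\<close>. The sigma-algebra may be
  larger than the Borel sigma-algebra, e.g. a completion of it.\<close>

definition topological_prob_space :: "'a topology \<Rightarrow> 'a measure \<Rightarrow> bool" where
  "topological_prob_space T M \<longleftrightarrow>
     prob_space M \<and> space M = topspace T \<and> (\<forall>U. openin T U \<longrightarrow> U \<in> sets M)"

definition continuous_orthonormal_system ::
    "'a topology \<Rightarrow> 'a measure \<Rightarrow> 'i set \<Rightarrow> ('i \<Rightarrow> 'a \<Rightarrow> complex) \<Rightarrow> bool" where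
  "continuous_orthonormal_system T M I b \<longleftrightarrow>
     countable I \<and>
     (\<forall>j\<in>I. continuous_map T euclidean (b j)) \<and>
     (\<forall>j\<in>I. integrable M (\<lambda>x. (cmod (b j x))\<^sup>2)) \<and>
     (\<forall>i\<in>I. \<forall>j\<in>I. L2_inner M (b i) (b j) = (if i = j then 1 else 0))"

definition system_bound :: "'a measure \<Rightarrow> 'i set \<Rightarrow> ('i \<Rightarrow> 'a \<Rightarrow> complex) \<Rightarrow> ennreal" where
  "system_bound M I b = (SUP j\<in>I. Lq_norm M \<infinity> (b j))"

definition bounded_orthonormal_system ::
    "'a topology \<Rightarrow> 'a measure \<Rightarrow> 'i set \<Rightarrow> ('i \<Rightarrow> 'a \<Rightarrow> complex) \<Rightarrow> bool" where
  "bounded_orthonormal_system T M I b \<longleftrightarrow>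
     continuous_orthonormal_system T M I b \<and> system_bound M I b < \<infinity>"

definition wiener_norm ::
    "'a measure \<Rightarrow> 'i set \<Rightarrow> ('i \<Rightarrow> 'a \<Rightarrow> complex) \<Rightarrow> ('a \<Rightarrow> complex) \<Rightarrow> ennreal" where
  "wiener_norm M I b f = (\<Sum>\<^sub>\<infinity>j\<in>I. ennreal (cmod (L2_inner M f (b j))))"

text \<open>Functions are sampled at points, so the expansion is an identity of functions and not of
  almost-everywhere classes. For a bounded system and summable coefficients the series converges
  absolutely at every \<^term>\<open>x\<close> with \<open>\<bar>b j x\<bar> \<le> B\<close> for all \<open>j\<close>, hence off a fixed null set; where it
  does not converge, \<^const>\<open>infsum\<close> is zero by convention.\<close>

definition wiener_space ::
    "'a measure \<Rightarrow> 'i set \<Rightarrow> ('i \<Rightarrow> 'a \<Rightarrow> complex) \<Rightarrow> ('a \<Rightarrow> complex) set" where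
  "wiener_space M I b =
     {f. (\<forall>x\<in>space M. f x = (\<Sum>\<^sub>\<infinity>j\<in>I. L2_inner M f (b j) * b j x)) \<and>
         wiener_norm M I b f < \<infinity>}"

definition best_approx ::
    "'a measure \<Rightarrow> 'i set \<Rightarrow> ('i \<Rightarrow> 'a \<Rightarrow> complex) \<Rightarrow> nat \<Rightarrow> ('a \<Rightarrow> complex) \<Rightarrow> ennreal" where
  "best_approx M I b n f =
     (INF K \<in> {K. K \<subseteq> I \<and> finite K \<and> card K \<le> n}. INF c :: 'i \<Rightarrow> complex.
        wiener_norm M I b (\<lambda>x. f x - (\<Sum>j\<in>K. c j * b j x)))"

definition proj ::
    "'a measure \<Rightarrow> ('i \<Rightarrow> 'a \<Rightarrow> complex) \<Rightarrow> 'i set \<Rightarrow> ('a \<Rightarrow> complex) \<Rightarrow> 'a \<Rightarrow> complex" where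
  "proj M b J f = (\<lambda>x. \<Sum>j\<in>J. L2_inner M f (b j) * b j x)"


section \<open>Decoders\<close>

text \<open>A matrix with rows indexed by \<open>l < m\<close> and columns indexed by \<open>J\<close> is a function
  \<^typ>\<open>nat \<Rightarrow> 'i \<Rightarrow> complex\<close>; sample points are numbered from 0.
  Coefficient vectors supported in \<open>S\<close> are functions that vanish off \<open>S\<close>.\<close>

definition sample_matrix ::
    "nat \<Rightarrow> ('i \<Rightarrow> 'a \<Rightarrow> complex) \<Rightarrow> (nat \<Rightarrow> 'a) \<Rightarrow> nat \<Rightarrow> 'i \<Rightarrow> complex" where
  "sample_matrix m b X = (\<lambda>l j. b j (X l) / complex_of_real (sqrt (real m)))"

definition sample_vector :: "nat \<Rightarrow> (nat \<Rightarrow> 'a) \<Rightarrow> ('a \<Rightarrow> complex) \<Rightarrow> nat \<Rightarrow> complex" where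
  "sample_vector m X f = (\<lambda>l. f (X l) / complex_of_real (sqrt (real m)))"

definition coeff_vectors :: "'i set \<Rightarrow> ('i \<Rightarrow> complex) set" where
  "coeff_vectors S = {z. \<forall>j. j \<notin> S \<longrightarrow> z j = 0}"

definition residual ::
    "'i set \<Rightarrow> (nat \<Rightarrow> 'i \<Rightarrow> complex) \<Rightarrow> (nat \<Rightarrow> complex) \<Rightarrow> ('i \<Rightarrow> complex) \<Rightarrow> nat \<Rightarrow> complex" where
  "residual J A y z = (\<lambda>l. y l - (\<Sum>j\<in>J. A l j * z j))"

definition residual_norm ::
    "'i set \<Rightarrow> nat \<Rightarrow> (nat \<Rightarrow> 'i \<Rightarrow> complex) \<Rightarrow> (nat \<Rightarrow> complex) \<Rightarrow> ('i \<Rightarrow> complex) \<Rightarrow> real" where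
  "residual_norm J m A y z = L2_set (\<lambda>l. cmod (residual J A y z l)) {..<m}"

definition rlasso_objective ::
    "'i set \<Rightarrow> nat \<Rightarrow> real \<Rightarrow> (nat \<Rightarrow> 'i \<Rightarrow> complex) \<Rightarrow> (nat \<Rightarrow> complex) \<Rightarrow> ('i \<Rightarrow> complex) \<Rightarrow> real" where
  "rlasso_objective J m lam A y z = (\<Sum>j\<in>J. cmod (z j)) + lam * residual_norm J m A y z"

text \<open>A deterministic rule which picks a minimizer for all data \<open>A\<close> and \<open>y\<close>.\<close>

definition rlasso_rule ::
    "'i set \<Rightarrow> nat \<Rightarrow> real \<Rightarrow> ((nat \<Rightarrow> 'i \<Rightarrow> complex) \<Rightarrow> (nat \<Rightarrow> complex) \<Rightarrow> 'i \<Rightarrow> complex) \<Rightarrow> bool" where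
  "rlasso_rule J m lam r \<longleftrightarrow>
     (\<forall>A y. is_arg_min (rlasso_objective J m lam A y) (\<lambda>z. z \<in> coeff_vectors J) (r A y))"

definition rlasso_decoder ::
    "((nat \<Rightarrow> 'i \<Rightarrow> complex) \<Rightarrow> (nat \<Rightarrow> complex) \<Rightarrow> 'i \<Rightarrow> complex) \<Rightarrow> ('i \<Rightarrow> 'a \<Rightarrow> complex) \<Rightarrow>
     'i set \<Rightarrow> nat \<Rightarrow> (nat \<Rightarrow> 'a) \<Rightarrow> ('a \<Rightarrow> complex) \<Rightarrow> 'a \<Rightarrow> complex" where
  "rlasso_decoder r b J m X f =
     (\<lambda>x. \<Sum>j\<in>J. r (sample_matrix m b X) (sample_vector m X f) j * b j x)"

definition correlation ::
    "'i set \<Rightarrow> nat \<Rightarrow> (nat \<Rightarrow> 'i \<Rightarrow> complex) \<Rightarrow> (nat \<Rightarrow> complex) \<Rightarrow> ('i \<Rightarrow> complex) \<Rightarrow> 'i \<Rightarrow> real" where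
  "correlation J m A y p j = cmod (\<Sum>l<m. cnj (A l j) * residual J A y p l)"

text \<open>Here \<open>e\<close> enumerates \<open>J\<close>, that is, \<open>bij_betw e {..<card J} J\<close>.\<close>

definition omp_index ::
    "(nat \<Rightarrow> 'i) \<Rightarrow> 'i set \<Rightarrow> nat \<Rightarrow> (nat \<Rightarrow> 'i \<Rightarrow> complex) \<Rightarrow> (nat \<Rightarrow> complex) \<Rightarrow> ('i \<Rightarrow> complex) \<Rightarrow> 'i" where
  "omp_index e J m A y p =
     e (LEAST k. k < card J \<and>
          (\<forall>j\<in>J. correlation J m A y p j \<le> correlation J m A y p (e k)))"

text \<open>The state after \<open>k\<close> steps is the pair of the index set and the coefficient vector. If the
  least squares solution is not unique, \<^const>\<open>arg_min\<close> is some fixed solution.\<close>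

primrec omp ::
    "(nat \<Rightarrow> 'i) \<Rightarrow> 'i set \<Rightarrow> nat \<Rightarrow> (nat \<Rightarrow> 'i \<Rightarrow> complex) \<Rightarrow> (nat \<Rightarrow> complex) \<Rightarrow> nat \<Rightarrow>
     'i set \<times> ('i \<Rightarrow> complex)" where
  "omp e J m A y 0 = ({}, \<lambda>_. 0)"
| "omp e J m A y (Suc k) =
     (let (S, p) = omp e J m A y k; S' = insert (omp_index e J m A y p) S
      in (S', arg_min (residual_norm J m A y) (\<lambda>z. z \<in> coeff_vectors S')))"

definition omp_decoder ::
    "(nat \<Rightarrow> 'i) \<Rightarrow> nat \<Rightarrow> ('i \<Rightarrow> 'a \<Rightarrow> complex) \<Rightarrow>
     'i set \<Rightarrow> nat \<Rightarrow> (nat \<Rightarrow> 'a) \<Rightarrow> ('a \<Rightarrow> complex) \<Rightarrow> 'a \<Rightarrow> complex" where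
  "omp_decoder e k b J m X f =
     (\<lambda>x. \<Sum>j\<in>J. snd (omp e J m (sample_matrix m b X) (sample_vector m X f) k) j * b j x)"


section \<open>Sample size\<close>

text \<open>This is \<open>log (B\<^sup>2 n)\<close>, except for \<open>n = 1\<close>. There it is truncated from below at 1: for
  \<open>n = 1\<close> and \<open>B\<close> close to 1 the term \<open>log (\<gamma>\<^sup>-\<^sup>1 log (B\<^sup>2 n))\<close> may be negative or undefined, and the
  sample size condition would admit \<open>m = 0\<close>.\<close>

definition log_factor :: "real \<Rightarrow> nat \<Rightarrow> real" where
  "log_factor B n = (if n = 1 then max 1 (ln (B\<^sup>2 * real n)) else ln (B\<^sup>2 * real n))"

end

theory Submission
  imports Defs
begin

text \<open>
  With the required probability the normalized sample matrix satisfies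
  \<open>\<bar>\<parallel>A z\<parallel>\<^sup>2 - \<parallel>z\<parallel>\<^sup>2\<bar> \<le> (\<parallel>z\<parallel>\<^sub>2\<^sup>2 + \<parallel>z\<parallel>\<^sub>1\<^sup>2 / s) / 20\<close> for all coefficient vectors \<open>z\<close>, where \<open>s = 26 n\<close>.
  For \<open>\<parallel>z\<parallel>\<^sub>1 \<le> \<surd>s\<close> the function \<open>g = \<Sum>j. z\<^sub>j b\<^sub>j\<close> is bounded by \<open>K = 2 B \<surd>s\<close>. Its square is
  decomposed into about \<open>log K\<^sup>2\<close> level pieces, the \<open>t\<close>-th of which has height \<open>K\<^sup>2 / 2\<^sup>t\<close>. On the \<open>t\<close>-th
  piece \<open>g\<close> may be replaced by the average of about \<open>2\<^sup>t log K\<^sup>2\<close> multiples of basis functions, up to an exceptional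
  set of small true and empirical measure (Maurey's method). There are few such averages, so a
  Chernoff bound and a union bound control all of them; the small height compensates for the larger net.

  Both decoders are stable under this near isometry. For the square-root Lasso it implies the robust null
  space property. For orthogonal matching pursuit one follows the residual along dyadic blocks of the
  missing coefficients in decreasing order, until the next block is negligible. The resulting
  \<open>\<ell>\<^sub>1\<close> and \<open>\<ell>\<^sub>2\<close> bounds for the coefficients give \<open>L\<^sub>\<infinity>\<close> and \<open>L\<^sub>2\<close> bounds, and the
  case of general \<open>q\<close> follows by interpolation.
\<close>

section \<open>Concentration inequalities\<close>

text \<open>The near isometry carries an l1 term so that it speaks of every vector. It thus serves
  the Lasso, whose error need not be sparse, and for vectors with at most \<open>s\<close> nonzero
  entries it becomes a restricted isometry with constant 1/10. On level \<open>t\<close> the height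
  is K^2 / 2^t and the logarithm of the net size is about 2^t \<Lambda> log |J|. The product K^2
  \<Lambda> log |J| is independent of \<open>t\<close>, so \<open>r\<close> levels cost r \<Lambda>
  K^2 log |J|. Both \<open>r\<close> and \<Lambda> are of order log (B^2 n), which is the origin of
  the squared logarithm. The union bound over the levels adds log (r / \<gamma>), the second term of
  the sample size. The number 26 n is the size of the largest support in use: 24 n selected indices
  and 2 n target indices. In turn, 24 n is 12 steps for each target index. A separate obstacle is
  that the sup norm ignores null sets while samples see points, for uncountably many
  \<open>f\<close> at once. All differences \<open>f - P_J f\<close> are approximated uniformly, off
  one null set, from a countable family.\<close>

lemma (in prob_space) iid_exp_markov:
  fixes W :: "'a \<Rightarrow> real" and m :: nat
  assumes [measurable]: "W \<in> borel_measurable M" and W: "\<And>x. x \<in> space M \<Longrightarrow> \<bar>W x\<bar> \<le> K"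
  defines "P \<equiv> \<Pi>\<^sub>M l\<in>{..<m}. M"
  shows "measure P {X \<in> space P. w \<le> (\<Sum>l<m. W (X l))} \<le> expectation (\<lambda>x. exp (W x)) ^ m * exp (- w)"
proof -
  interpret PS: product_prob_space "\<lambda>_::nat. M" "{..<m}" by unfold_locales
  have int: "integrable M (\<lambda>x. exp (W x))"
    using W by (intro integrable_const_bound[where B = "exp K"]) (auto intro!: AE_I2 simp: abs_le_iff)
  have intP: "integrable P (\<lambda>X. \<Prod>l<m. exp (W (X l)))"
    unfolding P_def by (rule PS.product_integrable_prod) (use int in auto)
  have "{X \<in> space P. w \<le> (\<Sum>l<m. W (X l))} = {X \<in> space P. exp w \<le> (\<Prod>l<m. exp (W (X l)))}"
    by (simp flip: exp_sum)
  also have "measure P \<dots> \<le> (LINT X|P. (\<Prod>l<m. exp (W (X l)))) / exp w"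
    by (rule integral_Markov_inequality_measure[OF intP, of "{}"]) (auto intro!: AE_I2 prod_nonneg)
  also have "(LINT X|P. (\<Prod>l<m. exp (W (X l)))) = expectation (\<lambda>x. exp (W x)) ^ m"
    unfolding P_def by (subst PS.product_integral_prod) (use int in auto)
  finally show ?thesis by (simp add: exp_minus divide_inverse)
qed

lemma exp_le_chord:
  fixes c t :: real
  assumes "0 \<le> t" "t \<le> 1"
  shows "exp (c * t) \<le> 1 + t * (exp c - 1)"
  using convex_onD[OF exp_convex, of t 0 c] assms by (simp add: algebra_simps)

text \<open>The chord of the exponential over [0, 1] leads to a bound in terms of the mean of
  \<open>Y\<close> and not of the square of its range. This is what allows an error relative to the
  mean.\<close>

lemma (in prob_space) expectation_exp_le:
  fixes Y :: "'a \<Rightarrow> real"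
  assumes [measurable]: "Y \<in> borel_measurable M"
    and Y: "\<And>x. x \<in> space M \<Longrightarrow> 0 \<le> Y x" "\<And>x. x \<in> space M \<Longrightarrow> Y x \<le> V" and V: "0 < V"
  shows "expectation (\<lambda>x. exp (c * Y x / V)) \<le> exp (expectation Y / V * (exp c - 1))"
proof -
  have intY: "integrable M Y"
    by (intro integrable_const_bound[where B = V]) (auto intro!: AE_I2 simp: Y)
  have "\<bar>c * Y x / V\<bar> \<le> \<bar>c\<bar>" if "x \<in> space M" for x
  proof -
    have "\<bar>c\<bar> * (Y x / V) \<le> \<bar>c\<bar> * 1" using Y[OF that] V by (intro mult_left_mono) auto
    then show ?thesis using Y[OF that] V by (simp add: abs_mult)
  qed
  then have int: "integrable M (\<lambda>x. exp (c * Y x / V))"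
    by (intro integrable_const_bound[where B = "exp \<bar>c\<bar>"]) (auto intro!: AE_I2 simp del: abs_mult abs_divide simp: abs_le_iff)
  have "expectation (\<lambda>x. exp (c * Y x / V)) \<le> expectation (\<lambda>x. 1 + Y x / V * (exp c - 1))"
    using exp_le_chord[of "Y _ / V" c] Y V
    by (intro integral_mono int Bochner_Integration.integrable_add integrable_mult_left integrable_divide intY) auto
  also have "\<dots> = 1 + expectation Y / V * (exp c - 1)"
    using intY by (simp add: prob_space)
  also have "\<dots> \<le> exp (expectation Y / V * (exp c - 1))"
    by (rule exp_ge_add_one_self)
  finally show ?thesis .
qed

text \<open>The relative slack \<open>c * expectation Y\<close> absorbs the second-order part of the
  exponential moment, so the additive slack \<open>d\<close> alone pays for the probability. The
  rate is proportional to 1 / V, and this factor is later balanced against the size of the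
  net.\<close>

lemma (in prob_space) chernoff_iid:
  fixes Y :: "'a \<Rightarrow> real" and m :: nat and c d :: real
  assumes [measurable]: "Y \<in> borel_measurable M"
    and Y: "\<And>x. x \<in> space M \<Longrightarrow> 0 \<le> Y x" "\<And>x. x \<in> space M \<Longrightarrow> Y x \<le> V" and V: "0 < V"
    and c: "0 < c" "c \<le> 1"
  defines "P \<equiv> \<Pi>\<^sub>M l\<in>{..<m}. M"
  shows "measure P {X \<in> space P. \<not> \<bar>(\<Sum>l<m. Y (X l)) - m * expectation Y\<bar> \<le> m * (c * expectation Y + d)}
    \<le> 2 * exp (- (m * c * d / V))"
proof -
  interpret PS: product_prob_space "\<lambda>_::nat. M" "{..<m}" by unfold_locales
  interpret P: prob_space P unfolding P_def by (rule prob_space_PiM) (rule prob_space_axioms)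
  define N where "N = expectation Y"
  have N0: "0 \<le> N" unfolding N_def using Y by (intro integral_nonneg_AE) auto
  \<comment> \<open>Both bounds say that exp (s c) - 1 is at most s c + c^2, for s = 1 and for s =
    -1.\<close>
  have quad: "exp c - 1 \<le> c * (1 + c)" "exp (- c) - 1 \<le> - c * (1 - c)"
  proof -
    show "exp c - 1 \<le> c * (1 + c)"
      using exp_bound[of c] c by (simp add: algebra_simps power2_eq_square)
    have "exp (- c) \<le> inverse (1 + c)"
      using exp_ge_add_one_self[of c] c by (simp add: exp_minus le_imp_inverse_le)
    also have "\<dots> \<le> 1 - c * (1 - c)"
    proof -
      have "(1 + c) * (1 - c * (1 - c)) = 1 + c * c * c" by (simp add: algebra_simps)
      then have "1 \<le> (1 + c) * (1 - c * (1 - c))" using c by simp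
      then show ?thesis using c by (simp add: inverse_eq_divide divide_le_eq mult.commute)
    qed
    finally show "exp (- c) - 1 \<le> - c * (1 - c)" by simp
  qed
  \<comment> \<open>The sign \<open>s\<close> of the deviation lets one computation yield both
    tails.\<close>
  have tail: "measure P {X \<in> space P. s * (m * N) + m * (c * N + d) \<le> s * (\<Sum>l<m. Y (X l))}
      \<le> exp (- (m * c * d / V))" if s: "s = 1 \<or> s = - 1" for s :: real
  proof -
    have bd: "\<bar>s * c * Y x / V\<bar> \<le> 1" if "x \<in> space M" for x
    proof -
      have "c * Y x \<le> 1 * V" using Y[OF that] c by (intro mult_mono) auto
      then show ?thesis using Y[OF that] V c s by (auto simp: abs_mult)
    qed
    have "{X \<in> space P. s * (m * N) + m * (c * N + d) \<le> s * (\<Sum>l<m. Y (X l))}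
        = {X \<in> space P. c / V * (s * (m * N) + m * (c * N + d)) \<le> (\<Sum>l<m. s * c * Y (X l) / V)}"
    proof -
      have "(u \<le> s * (\<Sum>l<m. Y (X l))) \<longleftrightarrow> c / V * u \<le> (\<Sum>l<m. s * c * Y (X l) / V)" for u X
      proof -
        have "(\<Sum>l<m. s * c * Y (X l) / V) = c / V * (s * (\<Sum>l<m. Y (X l)))"
          by (simp add: sum_distrib_left sum_divide_distrib algebra_simps)
        then show ?thesis using c V by (simp add: mult_le_cancel_left_pos field_simps)
      qed
      then show ?thesis by simp
    qed
    also have "measure P \<dots> \<le> expectation (\<lambda>x. exp (s * c * Y x / V)) ^ m
        * exp (- (c / V * (s * (m * N) + m * (c * N + d))))"
      unfolding P_def by (rule iid_exp_markov[where K = 1]) (use bd in auto)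
    also have "\<dots> \<le> exp (N / V * (exp (s * c) - 1)) ^ m
        * exp (- (c / V * (s * (m * N) + m * (c * N + d))))"
      unfolding N_def using Y V
      by (intro mult_right_mono power_mono expectation_exp_le) (auto intro!: integral_nonneg_AE)
    also have "\<dots> \<le> exp (N / V * (s * c * (1 + s * c))) ^ m
        * exp (- (c / V * (s * (m * N) + m * (c * N + d))))"
      using quad s N0 V c by (intro mult_right_mono power_mono) (auto intro!: mult_left_mono divide_right_mono)
    also have "\<dots> = exp (- (m * c * d / V))"
    proof -
      \<comment> \<open>As s^2 = 1, the term c^2 N / V of the moment bound is exactly cancelled by
        the slack c * N, and only \<open>d\<close> survives.\<close>
      have "s * s = 1" using s by auto
      then have "real m * (N / V * (s * c * (1 + s * c))) - c / V * (s * (m * N) + m * (c * N + d)) = - (m * c * d / V)"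
        by (simp add: divide_inverse) algebra
      then show ?thesis by (simp add: exp_of_nat_mult[symmetric] exp_add[symmetric])
    qed
    finally show ?thesis .
  qed
  have [measurable]: "(\<lambda>X. \<Sum>l<m. Y (X l)) \<in> borel_measurable P" unfolding P_def by measurable
  have "{X \<in> space P. \<not> \<bar>(\<Sum>l<m. Y (X l)) - m * N\<bar> \<le> m * (c * N + d)}
     \<subseteq> {X \<in> space P. 1 * (m * N) + m * (c * N + d) \<le> 1 * (\<Sum>l<m. Y (X l))} \<union>
       {X \<in> space P. -1 * (m * N) + m * (c * N + d) \<le> -1 * (\<Sum>l<m. Y (X l))}" (is "_ \<subseteq> ?U \<union> ?W")
    by auto
  then have "measure P {X \<in> space P. \<not> \<bar>(\<Sum>l<m. Y (X l)) - m * N\<bar> \<le> m * (c * N + d)} \<le> measure P (?U \<union> ?W)"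
    by (rule P.finite_measure_mono) measurable
  also have "\<dots> \<le> measure P ?U + measure P ?W"
    by (rule measure_Un_le) measurable
  finally show ?thesis using tail[of 1] tail[of "-1"] unfolding N_def by linarith
qed

text \<open>Hoeffding's lemma for the finitely supported law with weights \<open>p\<close>. The
  range is an interval of length 2 K, whence (2 K)^2 / 8 in the exponent.\<close>

lemma finite_hoeffding:
  fixes p \<xi> :: "'c \<Rightarrow> real"
  assumes At: "finite At" and p: "\<And>a. a \<in> At \<Longrightarrow> 0 \<le> p a" "sum p At = 1"
    and \<xi>: "\<And>a. a \<in> At \<Longrightarrow> \<bar>\<xi> a\<bar> \<le> K" and l: "0 < l"
  shows "(\<Sum>a\<in>At. p a * exp (l * (\<xi> a - (\<Sum>a\<in>At. p a * \<xi> a)))) \<le> exp (l\<^sup>2 * K\<^sup>2 / 2)"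
proof -
  define N where "N = point_measure At p"
  have sp: "space N = At" by (simp add: N_def space_point_measure)
  interpret prob_space N
    unfolding N_def by (rule prob_space_point_measure) (use At p in auto)
  interpret interval_bounded_random_variable N \<xi> "- K" K
    by unfold_locales (use \<xi> sp in \<open>auto simp: N_def abs_le_iff intro!: AE_I2\<close>, fastforce)
  have E: "expectation f = (\<Sum>a\<in>At. p a * f a)" for f :: "'c \<Rightarrow> real"
    unfolding N_def by (subst lebesgue_integral_point_measure_finite) (use At p in auto)
  have "ennreal (\<Sum>a\<in>At. p a * exp (l * (\<xi> a - expectation \<xi>))) = nn_integral N (\<lambda>x. exp (l * (\<xi> x - expectation \<xi>)))"
    unfolding N_def by (subst nn_integral_point_measure_finite)
      (use At p in \<open>auto simp: sum_ennreal ennreal_mult' mult_ac simp flip: sum_ennreal\<close>)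
  also have "\<dots> \<le> ennreal (exp (l\<^sup>2 * (K - (- K))\<^sup>2 / 8))"
    by (rule Hoeffdings_lemma_nn_integral[OF l])
  finally show ?thesis by (simp add: E power2_eq_square field_simps)
qed

section \<open>Empirical approximation by averages of atoms\<close>

text \<open>The products of weights on \<open>{..<q} \<rightarrow>\<^sub>E At\<close> are the law of
  \<open>q\<close> independent indices. The exponential of the sum factorizes, and each factor is
  the one-variable bound at l / q.\<close>

lemma finite_hoeffding_iid:
  fixes p \<xi> :: "'c \<Rightarrow> real" and q :: nat
  assumes At: "finite At" and p: "\<And>a. a \<in> At \<Longrightarrow> 0 \<le> p a" "sum p At = 1"
    and \<xi>: "\<And>a. a \<in> At \<Longrightarrow> \<bar>\<xi> a\<bar> \<le> K" and l: "0 < l" and q: "0 < q"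
  shows "(\<Sum>s\<in>{..<q} \<rightarrow>\<^sub>E At. (\<Prod>i<q. p (s i)) * exp (l * ((\<Sum>i<q. \<xi> (s i)) / q - (\<Sum>a\<in>At. p a * \<xi> a))))
    \<le> exp (l\<^sup>2 * K\<^sup>2 / (2 * q))"
proof -
  define \<mu> where "\<mu> = (\<Sum>a\<in>At. p a * \<xi> a)"
  have "(\<Prod>i<q. p (s i)) * exp (l * ((\<Sum>i<q. \<xi> (s i)) / q - \<mu>))
      = (\<Prod>i<q. p (s i) * exp (l / q * (\<xi> (s i) - \<mu>)))" for s
  proof -
    have "l * ((\<Sum>i<q. \<xi> (s i)) / q - \<mu>) = (\<Sum>i<q. l / q * (\<xi> (s i) - \<mu>))"
    proof -
      have "(\<Sum>i<q. l / q * (\<xi> (s i) - \<mu>)) = l / q * (\<Sum>i<q. \<xi> (s i)) - l / q * (q * \<mu>)"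
        by (simp add: sum_subtractf right_diff_distrib sum_distrib_left)
      then show ?thesis using q by (simp add: right_diff_distrib)
    qed
    then show ?thesis by (simp add: prod.distrib exp_sum)
  qed
  then have "(\<Sum>s\<in>{..<q} \<rightarrow>\<^sub>E At. (\<Prod>i<q. p (s i)) * exp (l * ((\<Sum>i<q. \<xi> (s i)) / q - \<mu>)))
      = (\<Prod>i<q. \<Sum>a\<in>At. p a * exp (l / q * (\<xi> a - \<mu>)))"
    using At by (subst prod_sum_PiE) auto
  also have "\<dots> \<le> (\<Prod>i<q. exp ((l / q)\<^sup>2 * K\<^sup>2 / 2))"
    unfolding \<mu>_def using At p \<xi> l q
    by (intro prod_mono conjI sum_nonneg finite_hoeffding) auto
  also have "\<dots> = exp (l\<^sup>2 * K\<^sup>2 / (2 * q))"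
    using q by (simp add: exp_of_nat_mult[symmetric] field_simps power2_eq_square)
  finally show ?thesis unfolding \<mu>_def .
qed

lemma finite_hoeffding_complex_tail:
  fixes p :: "'c \<Rightarrow> real" and \<zeta> :: "'c \<Rightarrow> complex" and q :: nat and th :: real
  assumes At: "finite At" and p: "\<And>a. a \<in> At \<Longrightarrow> 0 \<le> p a" "sum p At = 1"
    and \<zeta>: "\<And>a. a \<in> At \<Longrightarrow> cmod (\<zeta> a) \<le> K" and q: "0 < q" and th: "0 < th" and K: "0 < K"
  shows "(\<Sum>s\<in>{..<q} \<rightarrow>\<^sub>E At. (\<Prod>i<q. p (s i)) *
      of_bool (th < cmod ((\<Sum>i<q. \<zeta> (s i)) / q - (\<Sum>a\<in>At. p a * \<zeta> a)))) \<le> 4 * exp (- (q * th\<^sup>2 / (8 * K\<^sup>2)))"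
proof -
  \<comment> \<open>The minimizer of l^2 K^2 / (2 q) - l th / 2.\<close>
  define l where "l = q * th / (2 * K\<^sup>2)"
  have l: "0 < l" using q th K by (simp add: l_def)
  define \<phi> :: "nat \<Rightarrow> complex \<Rightarrow> real" where
    "\<phi> k w = (if k = 0 then Re w else if k = 1 then - Re w else if k = 2 then Im w else - Im w)" for k w
  have lin: "\<phi> k ((\<Sum>i<q. \<zeta> (s i)) / q - (\<Sum>a\<in>At. p a * \<zeta> a))
      = (\<Sum>i<q. \<phi> k (\<zeta> (s i))) / q - (\<Sum>a\<in>At. p a * \<phi> k (\<zeta> a))" for k s
    by (auto simp: \<phi>_def Re_divide_of_nat Im_divide_of_nat sum_negf)
  \<comment> \<open>If the modulus exceeds \<open>th\<close>, the real or the imaginary part is at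
    least th / 2 in absolute value. One of the four signed functionals \<open>\<phi> k\<close> then
    reaches th / 2, and its exponential dominates the indicator.\<close>
  have ind: "of_bool (th < cmod w) \<le> exp (- (l * th / 2)) * (\<Sum>k<4. exp (l * \<phi> k w))" for w
  proof (cases "th < cmod w")
    case True
    have "cmod w \<le> \<bar>Re w\<bar> + \<bar>Im w\<bar>" by (rule cmod_le)
    then have "th / 2 \<le> \<bar>Re w\<bar> \<or> th / 2 \<le> \<bar>Im w\<bar>" using True by linarith
    then obtain k where k: "k < 4" "th / 2 \<le> \<phi> k w"
    proof -
      have "th / 2 \<le> \<phi> 0 w \<or> th / 2 \<le> \<phi> 1 w \<or> th / 2 \<le> \<phi> 2 w \<or> th / 2 \<le> \<phi> 3 w"
        using \<open>th / 2 \<le> \<bar>Re w\<bar> \<or> th / 2 \<le> \<bar>Im w\<bar>\<close> by (auto simp: \<phi>_def abs_if split: if_splits)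
      then show ?thesis using that[of 0] that[of 1] that[of 2] that[of 3] by fastforce
    qed
    have "l * (th / 2) \<le> l * \<phi> k w" using k l by (intro mult_left_mono) auto
    then have "1 \<le> exp (- (l * th / 2)) * exp (l * \<phi> k w)" by (simp flip: exp_add)
    also have "\<dots> \<le> exp (- (l * th / 2)) * (\<Sum>k<4. exp (l * \<phi> k w))"
      using k by (intro mult_left_mono member_le_sum) auto
    finally show ?thesis using True by simp
  qed (auto intro!: mult_nonneg_nonneg sum_nonneg)
  let ?w = "\<lambda>s. (\<Sum>i<q. \<zeta> (s i)) / q - (\<Sum>a\<in>At. p a * \<zeta> a)"
  have "(\<Sum>s\<in>{..<q} \<rightarrow>\<^sub>E At. (\<Prod>i<q. p (s i)) * of_bool (th < cmod (?w s)))
     \<le> (\<Sum>s\<in>{..<q} \<rightarrow>\<^sub>E At. (\<Prod>i<q. p (s i)) * (exp (- (l * th / 2)) * (\<Sum>k<4. exp (l * \<phi> k (?w s)))))"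
    using p by (intro sum_mono mult_left_mono ind prod_nonneg) (auto dest!: PiE_mem)
  also have "\<dots> = exp (- (l * th / 2)) * (\<Sum>k<4. \<Sum>s\<in>{..<q} \<rightarrow>\<^sub>E At. (\<Prod>i<q. p (s i)) * exp (l * \<phi> k (?w s)))"
    by (subst sum.swap) (simp add: sum_distrib_left algebra_simps)
  also have "\<dots> \<le> exp (- (l * th / 2)) * (\<Sum>k<4::nat. exp (l\<^sup>2 * K\<^sup>2 / (2 * q)))"
  proof -
    have "\<bar>\<phi> k (\<zeta> a)\<bar> \<le> K" if "a \<in> At" for k a
      using \<zeta>[OF that] abs_Re_le_cmod[of "\<zeta> a"] abs_Im_le_cmod[of "\<zeta> a"] by (auto simp: \<phi>_def)
    then show ?thesis unfolding lin
      using At p l q by (intro mult_left_mono sum_mono finite_hoeffding_iid) auto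
  qed
  also have "\<dots> = 4 * exp (- (q * th\<^sup>2 / (8 * K\<^sup>2)))"
  proof -
    have "l\<^sup>2 * K\<^sup>2 / (2 * q) - l * th / 2 = - (q * th\<^sup>2 / (8 * K\<^sup>2))"
      using q K by (simp add: l_def field_simps power2_eq_square)
    then show ?thesis by (simp add: exp_add[symmetric] mult.assoc[symmetric] mult.commute)
  qed
  finally show ?thesis .
qed

text \<open>Probabilistic method. For indices drawn independently with law \<open>p\<close>, the
  average of the atoms misses its mean by more than \<open>th\<close> at a given point with
  probability at most 4 exp (- q th^2 / (8 K^2)). Averaging over the measure and over the sample
  points adds up two such bounds, so a single \<open>s\<close> is good for both. This
  \<open>s\<close> may depend on \<open>X\<close>.\<close>

lemma (in prob_space) maurey:
  fixes p :: "'c \<Rightarrow> real" and u :: "'c \<Rightarrow> 'a \<Rightarrow> complex" and q m :: nat and th :: real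
  assumes At: "finite At" and p: "\<And>a. a \<in> At \<Longrightarrow> 0 \<le> p a" "sum p At = 1"
    and [measurable]: "\<And>a. a \<in> At \<Longrightarrow> u a \<in> borel_measurable M"
    and u: "\<And>a x. a \<in> At \<Longrightarrow> x \<in> space M \<Longrightarrow> cmod (u a x) \<le> K"
    and q: "0 < q" and th: "0 < th" and K: "0 < K" and m: "0 < m"
    and X: "\<And>l. l < m \<Longrightarrow> X l \<in> space M"
  shows "\<exists>s \<in> {..<q} \<rightarrow>\<^sub>E At.
    expectation (\<lambda>x. of_bool (th < cmod ((\<Sum>i<q. u (s i) x) / q - (\<Sum>a\<in>At. p a * u a x)))) +
    (\<Sum>l<m. of_bool (th < cmod ((\<Sum>i<q. u (s i) (X l)) / q - (\<Sum>a\<in>At. p a * u a (X l))))) / m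
      \<le> 8 * exp (- (q * th\<^sup>2 / (8 * K\<^sup>2)))"
proof (rule ccontr)
  define exc :: "(nat \<Rightarrow> 'c) \<Rightarrow> 'a \<Rightarrow> real" where
    "exc s x = of_bool (th < cmod ((\<Sum>i<q. u (s i) x) / q - (\<Sum>a\<in>At. p a * u a x)))" for s x
  define S where "S = ({..<q} \<rightarrow>\<^sub>E At)"
  define c where "c = exp (- (q * th\<^sup>2 / (8 * K\<^sup>2)))"
  define wt where "wt s = (\<Prod>i<q. p (s i))" for s
  define \<Phi> where "\<Phi> s = expectation (exc s) + (\<Sum>l<m. exc s (X l)) / m" for s
  assume "\<not> ?thesis"
  then have large: "8 * c < \<Phi> s" if "s \<in> S" for s
    using that unfolding S_def c_def \<Phi>_def exc_def by fastforce
  have fS: "finite S" unfolding S_def using At by (intro finite_PiE) auto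
  have wt0: "0 \<le> wt s" if "s \<in> S" for s
    unfolding wt_def using p that by (intro prod_nonneg) (auto simp: S_def dest!: PiE_mem)
  have wt1: "sum wt S = 1"
  proof -
    have "sum wt S = (\<Prod>i<q. \<Sum>a\<in>At. p a)"
      unfolding wt_def S_def using At by (subst prod_sum_PiE) auto
    then show ?thesis using p by simp
  qed
  have meas: "exc s \<in> borel_measurable M" if "s \<in> S" for s
  proof -
    have [measurable]: "u (s i) \<in> borel_measurable M" if "i < q" for i
      using that \<open>s \<in> S\<close> unfolding S_def by (auto dest!: PiE_mem)
    show ?thesis unfolding exc_def[abs_def] of_bool_def by measurable
  qed
  have int: "integrable M (exc s)" if "s \<in> S" for s
    using meas[OF that] by (intro integrable_const_bound[where B = 1]) (auto simp: exc_def)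
  have pt: "(\<Sum>s\<in>S. wt s * exc s x) \<le> 4 * c" if "x \<in> space M" for x
    unfolding S_def wt_def exc_def c_def
    by (rule finite_hoeffding_complex_tail) (use At p u that q th K in auto)
  have "(\<Sum>s\<in>S. wt s * expectation (exc s)) = expectation (\<lambda>x. \<Sum>s\<in>S. wt s * exc s x)"
    using int by simp
  also have "\<dots> \<le> expectation (\<lambda>x. 4 * c)"
    using int pt by (intro integral_mono) auto
  finally have 1: "(\<Sum>s\<in>S. wt s * expectation (exc s)) \<le> 4 * c" by (simp add: prob_space)
  have "(\<Sum>s\<in>S. wt s * ((\<Sum>l<m. exc s (X l)) / m)) = (\<Sum>l<m. \<Sum>s\<in>S. wt s * exc s (X l)) / m"
    by (subst sum.swap) (simp add: sum_distrib_left sum_divide_distrib)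
  also have "\<dots> \<le> (\<Sum>l<m. 4 * c) / m"
    using pt X by (intro divide_right_mono sum_mono) auto
  finally have 2: "(\<Sum>s\<in>S. wt s * ((\<Sum>l<m. exc s (X l)) / m)) \<le> 4 * c" using m by simp
  have "(\<Sum>s\<in>S. wt s * \<Phi> s) \<le> 8 * c"
    using 1 2 by (simp add: \<Phi>_def distrib_left sum.distrib)
  moreover have "(\<Sum>s\<in>S. wt s * (8 * c)) < (\<Sum>s\<in>S. wt s * \<Phi> s)"
  proof (rule sum_strict_mono_ex1[OF fS])
    show "\<forall>s\<in>S. wt s * (8 * c) \<le> wt s * \<Phi> s"
      using less_imp_le[OF large] wt0 by (intro ballI mult_left_mono) auto
    obtain s where s: "s \<in> S" "wt s \<noteq> 0" using wt1 sum.neutral[of S wt] by (metis zero_neq_one)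
    then have "0 < wt s" using wt0[of s] by simp
    then show "\<exists>s\<in>S. wt s * (8 * c) < wt s * \<Phi> s"
      using large[of s] s by (intro bexI[of _ s] mult_strict_left_mono)
  qed
  ultimately show False using wt1 by (simp add: sum_distrib_right[symmetric])
qed

section \<open>Dyadic slices of the squared modulus\<close>

definition level :: "real \<Rightarrow> real \<Rightarrow> real" where
  "level c v = min (max (v\<^sup>2 - c / 2) 0) (c / 2)"

lemma level_nonneg: "0 \<le> c \<Longrightarrow> 0 \<le> level c v"
  by (simp add: level_def)

lemma level_le: "level c v \<le> c / 2"
  by (simp only: level_def min.cobounded2)

lemma level_measurable [measurable]: "level c \<in> borel_measurable borel"
  unfolding level_def[abs_def] by measurable

text \<open>A slice is min (v^2) c - min (v^2) (c / 2), so the sum over halved values of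
  \<open>c\<close> telescopes.\<close>

lemma sum_level:
  assumes "0 \<le> v" "v \<le> K"
  shows "(\<Sum>t<r. level (K\<^sup>2 / 2 ^ t) v) = v\<^sup>2 - min (v\<^sup>2) (K\<^sup>2 / 2 ^ r)"
proof (induction r)
  case 0
  have "v\<^sup>2 \<le> K\<^sup>2" using assms by (intro power_mono) auto
  then show ?case by simp
next
  case (Suc r)
  have "0 \<le> K\<^sup>2 / 2 ^ r" by simp
  moreover have "level c v = min (v\<^sup>2) c - min (v\<^sup>2) (c / 2)" if "0 \<le> c" for c
    using that unfolding level_def min_def max_def by auto
  ultimately have "level (K\<^sup>2 / 2 ^ r) v = min (v\<^sup>2) (K\<^sup>2 / 2 ^ r) - min (v\<^sup>2) (K\<^sup>2 / 2 ^ r / 2)" by blast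
  then show ?case using Suc by (simp add: mult.commute)
qed

text \<open>A slice varies only for \<open>v\<close> between sqrt (c / 2) and sqrt c, hence at most
  2 sqrt c times as much as \<open>v\<close>. If c > 4 u^2, both arguments lie below the slice and
  there is no error at all. So at a given point only the levels with c at most 4 u^2 contribute, and
  their errors form a geometric series of size u^2.\<close>

lemma level_diff:
  assumes uv: "0 \<le> u" "0 \<le> v" "\<bar>u - v\<bar> \<le> th * sqrt c" and th: "0 \<le> th" "th \<le> 1 / 5" and c: "0 \<le> c"
  shows "\<bar>level c u - level c v\<bar> \<le> (if c \<le> 4 * u\<^sup>2 then 2 * th * c else 0)"
proof -
  define k where "k = sqrt c"
  have k: "0 \<le> k" "k\<^sup>2 = c" using c by (auto simp: k_def)
  have lev: "level c w = max ((min w k)\<^sup>2) (c / 2) - c / 2" if "0 \<le> w" for w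
  proof (cases "w \<le> k")
    case True
    then have "w\<^sup>2 \<le> c" unfolding k(2)[symmetric] using that by (intro power_mono) auto
    then show ?thesis using True c by (auto simp: level_def min_def max_def)
  next
    case False
    then have "c \<le> w\<^sup>2" unfolding k(2)[symmetric] using that k by (intro power_mono) auto
    then show ?thesis using False k c by (auto simp: level_def min_def max_def)
  qed
  have d: "\<bar>min u k - min v k\<bar> \<le> th * k" using uv k_def by (auto simp: min_def)
  have "\<bar>(min u k)\<^sup>2 - (min v k)\<^sup>2\<bar> = \<bar>min u k - min v k\<bar> * (min u k + min v k)"
    using uv k by (simp add: square_diff_square_factored power2_eq_square abs_mult)
  also have "\<dots> \<le> (th * k) * (k + k)"
    using uv k d th by (intro mult_mono add_mono) auto
  also have "\<dots> = 2 * th * c" using k by (simp add: power2_eq_square)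
  finally have A: "\<bar>level c u - level c v\<bar> \<le> 2 * th * c"
    using lev[OF uv(1)] lev[OF uv(2)] mult_nonneg_nonneg[OF c th(1)] by (auto simp: max_def)
  show ?thesis
  proof (cases "c \<le> 4 * u\<^sup>2")
    case False
    then have "(2 * u)\<^sup>2 < k\<^sup>2" using k by (simp add: power_mult_distrib)
    then have u2: "2 * u < k" using k power_less_imp_less_base by blast
    \<comment> \<open>1/2 + 1/5 = 7/10, and its square 49/100 is still below 1/2.\<close>
    have "th * k \<le> 1 / 5 * k" using th k by (intro mult_right_mono) auto
    then have "v \<le> 7 / 10 * k" using u2 uv unfolding k_def[symmetric] by linarith
    then have "v\<^sup>2 \<le> (7 / 10 * k)\<^sup>2" using uv by (intro power_mono) auto
    then have "v\<^sup>2 \<le> c / 2" using k c by (simp add: power_mult_distrib power_divide)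
    moreover have "u\<^sup>2 \<le> c / 2" using False c by simp
    ultimately show ?thesis using False c by (simp add: level_def)
  qed (use A in simp)
qed

text \<open>From the first term that is at most \<open>y\<close> on, the series is bounded by twice
  that term. The induction on \<open>r\<close> skips the larger terms by halving
  \<open>c\<close>.\<close>

lemma sum_geometric_below:
  fixes c y :: real
  assumes "0 \<le> c" "0 \<le> y"
  shows "(\<Sum>t<r. if c / 2 ^ t \<le> y then c / 2 ^ t else 0) \<le> 2 * y"
  using assms(1)
proof (induction r arbitrary: c)
  case 0
  then show ?case using assms by simp
next
  case (Suc r)
  show ?case
  proof (cases "c \<le> y")
    case True
    have "(\<Sum>t<Suc r. if c / 2 ^ t \<le> y then c / 2 ^ t else 0) \<le> (\<Sum>t<Suc r. c * (1 / 2) ^ t)"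
      using Suc.prems by (intro sum_mono) (auto simp: power_divide)
    also have "\<dots> = c * (2 * (1 - (1 / 2) ^ Suc r))"
      by (simp only: sum_distrib_left[symmetric] sum_gp_strict) simp
    also have "\<dots> \<le> c * 2" using Suc.prems by (intro mult_left_mono) auto
    finally show ?thesis using True by simp
  next
    case False
    have "c / 2 ^ Suc t = c / 2 / 2 ^ t" for t by simp
    then show ?thesis using Suc.IH[of "c / 2"] Suc.prems False
      by (subst sum.lessThan_Suc_shift) (simp del: power_Suc divide_divide_eq_left cong: if_cong)
  qed
qed

section \<open>Atoms whose convex hull contains an l1 ball\<close>

definition atom :: "real \<Rightarrow> ('i \<Rightarrow> complex) \<Rightarrow> ('i \<times> nat) option \<Rightarrow> complex" where
  "atom R \<beta> a = (case a of None \<Rightarrow> 0 | Some (j, k) \<Rightarrow> R * \<i> ^ k * \<beta> j)"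

definition atoms :: "'i set \<Rightarrow> ('i \<times> nat) option set" where
  "atoms J = insert None (Some ` (J \<times> {..<4}))"

lemma finite_atoms [simp]: "finite J \<Longrightarrow> finite (atoms J)"
  by (simp add: atoms_def)

lemma card_atoms: "finite J \<Longrightarrow> card (atoms J) = 4 * card J + 1"
  by (simp add: atoms_def card_image card_insert_if image_iff)

lemma sum_atoms:
  "finite J \<Longrightarrow> sum f (atoms J) = f None + (\<Sum>j\<in>J. \<Sum>k<4. f (Some (j, k)))"
  by (simp add: atoms_def image_iff sum.reindex sum.cartesian_product)

lemma norm_atom_le:
  assumes "a \<in> atoms J" "\<And>j. j \<in> J \<Longrightarrow> cmod (\<beta> j) \<le> B" "0 \<le> R" "0 \<le> B"
  shows "cmod (atom R \<beta> a) \<le> R * B"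
  using assms by (auto simp: atoms_def atom_def norm_mult norm_power intro!: mult_left_mono)

text \<open>Each coefficient is split into nonnegative multiples of 1, i, -1, -i. Their total is at
  most twice the l1 norm, hence at most \<open>R\<close>, and the zero atom \<open>None\<close>
  takes the weight that is left. The weights are fixed before \<open>\<beta>\<close>, so one
  \<open>p\<close> represents a function at all points simultaneously.\<close>

lemma convex_combination_atoms:
  assumes J: "finite J" and R: "0 < R" "2 * (\<Sum>j\<in>J. cmod (z j)) \<le> R"
  shows "\<exists>p. (\<forall>a\<in>atoms J. 0 \<le> p a) \<and> sum p (atoms J) = (1::real) \<and>
    (\<forall>\<beta>. (\<Sum>a\<in>atoms J. p a * atom R \<beta> a) = (\<Sum>j\<in>J. z j * \<beta> j))"
proof -
  define w where "w k \<zeta> = (if k = 0 then max (Re \<zeta>) 0 else if k = 1 then max (Im \<zeta>) 0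
    else if k = 2 then max (- Re \<zeta>) 0 else max (- Im \<zeta>) 0)" for k :: nat and \<zeta>
  have w0: "0 \<le> w k \<zeta>" for k \<zeta> by (simp add: w_def)
  have w1: "(\<Sum>k<4. w k \<zeta>) = \<bar>Re \<zeta>\<bar> + \<bar>Im \<zeta>\<bar>" for \<zeta>
    by (simp add: w_def eval_nat_numeral)
  have w2: "(\<Sum>k<4. w k \<zeta> * \<i> ^ k) = \<zeta>" for \<zeta>
    by (simp add: w_def eval_nat_numeral complex_eq_iff max_def)
  define p where "p a = (case a of None \<Rightarrow> 1 - (\<Sum>j\<in>J. \<Sum>k<4. w k (z j)) / R | Some (j, k) \<Rightarrow> w k (z j) / R)" for a
  have "(\<Sum>j\<in>J. \<Sum>k<4. w k (z j)) \<le> (\<Sum>j\<in>J. 2 * cmod (z j))"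
    unfolding w1 by (intro sum_mono) (metis abs_Re_le_cmod abs_Im_le_cmod add_mono mult_2)
  also have "\<dots> \<le> R" using R by (simp add: sum_distrib_left)
  finally have "0 \<le> p a" if "a \<in> atoms J" for a
    using R w0 by (auto simp: p_def split: option.split)
  moreover have "sum p (atoms J) = 1"
    using J by (simp add: sum_atoms p_def sum_divide_distrib)
  moreover have "(\<Sum>a\<in>atoms J. p a * atom R \<beta> a) = (\<Sum>j\<in>J. z j * \<beta> j)" for \<beta>
  proof -
    have "(\<Sum>a\<in>atoms J. p a * atom R \<beta> a) = (\<Sum>j\<in>J. \<Sum>k<4. w k (z j) * \<i> ^ k * \<beta> j)"
      using J R by (simp add: sum_atoms p_def atom_def mult.assoc)
    also have "\<dots> = (\<Sum>j\<in>J. z j * \<beta> j)"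
      by (simp add: sum_distrib_right[symmetric] w2)
    finally show ?thesis .
  qed
  ultimately show ?thesis by blast
qed

text \<open>The bound is required at every point because the functions are evaluated at individual
  sample points. A system that is bounded almost everywhere enters after truncation.\<close>

locale orthonormal_functions = prob_space M for M :: "'a measure" +
  fixes J :: "'i set" and b :: "'i \<Rightarrow> 'a \<Rightarrow> complex" and B :: real
  assumes J: "finite J"
    and b_meas [measurable]: "\<And>j. j \<in> J \<Longrightarrow> b j \<in> borel_measurable M"
    and b_bound: "\<And>j x. j \<in> J \<Longrightarrow> x \<in> space M \<Longrightarrow> cmod (b j x) \<le> B"
    and orth: "\<And>i j. i \<in> J \<Longrightarrow> j \<in> J \<Longrightarrow> (LINT x|M. b i x * cnj (b j x)) = (if i = j then 1 else 0)"
    and B: "0 < B"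
begin

definition lincomb :: "('i \<Rightarrow> complex) \<Rightarrow> 'a \<Rightarrow> complex" where
  "lincomb z x = (\<Sum>j\<in>J. z j * b j x)"

lemma lincomb_meas [measurable]: "lincomb z \<in> borel_measurable M"
  unfolding lincomb_def[abs_def] by measurable

lemma norm_lincomb_le:
  assumes "x \<in> space M"
  shows "cmod (lincomb z x) \<le> B * (\<Sum>j\<in>J. cmod (z j))"
proof -
  have "cmod (lincomb z x) \<le> (\<Sum>j\<in>J. cmod (z j) * B)"
    unfolding lincomb_def using assms
    by (intro sum_norm_le) (auto simp: norm_mult intro!: mult_left_mono b_bound)
  then show ?thesis by (simp add: sum_distrib_left mult.commute)
qed

lemma expectation_norm_lincomb_sq:
  "expectation (\<lambda>x. (cmod (lincomb z x))\<^sup>2) = (\<Sum>j\<in>J. (cmod (z j))\<^sup>2)"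
proof -
  have [measurable]: "cnj \<in> borel_measurable borel"
    by (intro borel_measurable_continuous_onI continuous_intros)
  have int: "integrable M (\<lambda>x. b i x * cnj (b j x))" if "i \<in> J" "j \<in> J" for i j
    using that b_bound B
    by (intro integrable_const_bound[where B = "B * B"]) (auto simp: norm_mult intro!: AE_I2 mult_mono)
  have "complex_of_real (expectation (\<lambda>x. (cmod (lincomb z x))\<^sup>2))
      = (LINT x|M. lincomb z x * cnj (lincomb z x))"
    by (simp add: complex_norm_square[symmetric] flip: integral_complex_of_real)
  also have "\<dots> = (LINT x|M. (\<Sum>i\<in>J. \<Sum>j\<in>J. (z i * cnj (z j)) * (b i x * cnj (b j x))))"
    by (simp add: lincomb_def sum_product mult_ac)
  also have "\<dots> = (\<Sum>i\<in>J. \<Sum>j\<in>J. (z i * cnj (z j)) * (LINT x|M. b i x * cnj (b j x)))"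
  proof -
    have "(LINT x|M. (\<Sum>j\<in>J. (z i * cnj (z j)) * (b i x * cnj (b j x))))
        = (\<Sum>j\<in>J. (z i * cnj (z j)) * (LINT x|M. b i x * cnj (b j x)))" if "i \<in> J" for i
      using int that by (subst Bochner_Integration.integral_sum) (auto simp del: mult_cancel_left)
    then show ?thesis
      using int by (subst Bochner_Integration.integral_sum) (auto intro!: Bochner_Integration.integrable_sum integrable_mult_right)
  qed
  also have "\<dots> = (\<Sum>i\<in>J. \<Sum>j\<in>J. (z i * cnj (z j)) * (if i = j then 1 else 0))"
    by (simp add: orth)
  also have "\<dots> = (\<Sum>i\<in>J. z i * cnj (z i))"
    using J by (simp add: if_distrib cong: if_cong)
  also have "\<dots> = complex_of_real (\<Sum>j\<in>J. (cmod (z j))\<^sup>2)"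
    by (simp add: complex_norm_square flip: of_real_power)
  finally show ?thesis by (simp only: of_real_eq_iff)
qed

text \<open>Only the index sequence \<open>\<sigma>\<close> distinguishes these functions for given
  \<open>R\<close> and \<open>q\<close>, so with values in \<open>atoms J\<close> there are at most
  (4 |J| + 1)^q of them.\<close>

definition net_fun :: "real \<Rightarrow> nat \<Rightarrow> (nat \<Rightarrow> ('i \<times> nat) option) \<Rightarrow> 'a \<Rightarrow> complex" where
  "net_fun R q \<sigma> x = (\<Sum>i<q. atom R (\<lambda>j. b j x) (\<sigma> i)) / q"

lemma atom_meas:
  assumes "a \<in> atoms J"
  shows "(\<lambda>x. atom R (\<lambda>j. b j x) a) \<in> borel_measurable M"
  using assms by (auto simp: atoms_def atom_def)

lemma net_fun_meas:
  assumes "\<sigma> \<in> {..<q} \<rightarrow>\<^sub>E atoms J"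
  shows "net_fun R q \<sigma> \<in> borel_measurable M"
  unfolding net_fun_def[abs_def]
  by (intro borel_measurable_divide borel_measurable_sum atom_meas) (use assms in auto)

lemma approx_on_levels:
  fixes q m :: nat and th :: real
  assumes z: "2 * (\<Sum>j\<in>J. cmod (z j)) \<le> R" and R: "0 < R"
    and m: "0 < m" and X: "\<And>l. l < m \<Longrightarrow> X l \<in> space M"
    and q: "0 < q" and th: "0 < th"
  shows "\<exists>\<sigma> \<in> {..<q} \<rightarrow>\<^sub>E atoms J.
    expectation (\<lambda>x. of_bool (th < cmod (net_fun R q \<sigma> x - lincomb z x))) +
    (\<Sum>l<m. of_bool (th < cmod (net_fun R q \<sigma> (X l) - lincomb z (X l)))) / m
     \<le> 8 * exp (- (q * th\<^sup>2 / (8 * (R * B)\<^sup>2)))"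
proof -
  obtain p where p: "\<forall>a\<in>atoms J. 0 \<le> p a" "sum p (atoms J) = (1::real)"
    "\<And>\<beta>. (\<Sum>a\<in>atoms J. p a * atom R \<beta> a) = (\<Sum>j\<in>J. z j * \<beta> j)"
    using convex_combination_atoms[OF J R z] by blast
  have "\<exists>\<sigma> \<in> {..<q} \<rightarrow>\<^sub>E atoms J.
    expectation (\<lambda>x. of_bool (th < cmod ((\<Sum>i<q. atom R (\<lambda>j. b j x) (\<sigma> i)) / q - (\<Sum>a\<in>atoms J. p a * atom R (\<lambda>j. b j x) a)))) +
    (\<Sum>l<m. of_bool (th < cmod ((\<Sum>i<q. atom R (\<lambda>j. b j (X l)) (\<sigma> i)) / q - (\<Sum>a\<in>atoms J. p a * atom R (\<lambda>j. b j (X l)) a)))) / m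
     \<le> 8 * exp (- (q * th\<^sup>2 / (8 * (R * B)\<^sup>2)))"
    by (rule maurey[where u = "\<lambda>a x. atom R (\<lambda>j. b j x) a"]) (use J R p m q th X B in \<open>auto intro!: norm_atom_le b_bound atom_meas\<close>)
  then show ?thesis by (simp only: p(3) net_fun_def lincomb_def)
qed

text \<open>Deterministic for a fixed \<open>X\<close>: all randomness sits in the hypothesis
  \<open>net\<close>, which is transferred from net functions to \<open>lincomb z\<close> slice by
  slice. The errors come from that hypothesis, from the replacement of the function on each slice,
  from the exceptional sets, and from the part of the square below K^2 / 2^r.\<close>

lemma near_isometry_on_net:
  fixes m r :: nat and q :: "nat \<Rightarrow> nat" and \<epsilon> :: "nat \<Rightarrow> real" and \<Lambda> s :: real
  defines "K \<equiv> 2 * sqrt s * B"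
  defines "Y \<equiv> (\<lambda>t \<sigma> x. level (K\<^sup>2 / 2 ^ t) (cmod (net_fun (2 * sqrt s) (q t) \<sigma> x)))"
  assumes s: "0 < s" and m: "0 < m" and X: "\<And>l. l < m \<Longrightarrow> X l \<in> space M"
    and q: "\<And>t. 8 * 2 ^ t * \<Lambda> * 1600\<^sup>2 \<le> q t" "\<And>t. 0 < q t"
    and \<Lambda>: "8000 * K\<^sup>2 \<le> exp \<Lambda>" and r: "200 * K\<^sup>2 \<le> 2 ^ r"
    and net: "\<And>t \<sigma>. t < r \<Longrightarrow> \<sigma> \<in> {..<q t} \<rightarrow>\<^sub>E atoms J \<Longrightarrow>
       \<bar>(\<Sum>l<m. Y t \<sigma> (X l)) - m * expectation (Y t \<sigma>)\<bar> \<le> m * (1 / 100 * expectation (Y t \<sigma>) + \<epsilon> t)"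
    and \<epsilon>: "(\<Sum>t<r. \<epsilon> t) \<le> 1 / 100"
    and z2: "(\<Sum>j\<in>J. (cmod (z j))\<^sup>2) \<le> 1" and z1: "(\<Sum>j\<in>J. cmod (z j)) \<le> sqrt s"
  shows "\<bar>(\<Sum>l<m. (cmod (lincomb z (X l)))\<^sup>2) / m - (\<Sum>j\<in>J. (cmod (z j))\<^sup>2)\<bar> \<le> 1 / 20"
proof -
  define G where "G = (\<Sum>j\<in>J. (cmod (z j))\<^sup>2)"
  define g where "g x = cmod (lincomb z x)" for x
  define c where "c t = K\<^sup>2 / 2 ^ t" for t :: nat
  define avg :: "('a \<Rightarrow> real) \<Rightarrow> real" where "avg F = (\<Sum>l<m. F (X l)) / m" for F
  \<comment> \<open>Chosen so that 2 * th * 8 = 1/100, where 8 is the factor from summing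
    \<open>c t\<close> over the levels with c t at most 4 g^2.\<close>
  define th :: real where "th = 1 / 1600"
  have K: "0 < K" using s B by (simp add: K_def)
  have c0: "0 < c t" for t using K by (simp add: c_def)
  have [measurable]: "g \<in> borel_measurable M" unfolding g_def[abs_def] by measurable
  have g0: "0 \<le> g x" for x by (simp add: g_def)
  have gK: "g x \<le> K" if "x \<in> space M" for x
  proof -
    have "g x \<le> B * (\<Sum>j\<in>J. cmod (z j))" unfolding g_def using that by (rule norm_lincomb_le)
    also have "\<dots> \<le> B * sqrt s" using z1 B by (intro mult_left_mono) auto
    also have "\<dots> \<le> K" using B s by (simp add: K_def)
    finally show ?thesis .
  qed
  have avg_mono: "avg F \<le> avg F'" if "\<And>x. x \<in> space M \<Longrightarrow> F x \<le> F' x" for F F'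
    unfolding avg_def using X that by (intro divide_right_mono sum_mono) auto
  have avg_add: "avg (\<lambda>x. F x + F' x) = avg F + avg F'" for F F'
    by (simp add: avg_def sum.distrib add_divide_distrib)
  have avg_cmult: "avg (\<lambda>x. k * F x) = k * avg F" for F k
    by (simp add: avg_def sum_distrib_left)
  have avg_sum: "avg (\<lambda>x. \<Sum>t<r. F t x) = (\<Sum>t<r. avg (F t))" for F :: "nat \<Rightarrow> 'a \<Rightarrow> real" and r :: nat
    unfolding avg_def by (subst sum.swap) (simp add: sum_divide_distrib)
  define Q where "Q t \<sigma> \<longleftrightarrow> expectation (\<lambda>x. of_bool (th * sqrt (c t) < cmod (net_fun (2 * sqrt s) (q t) \<sigma> x - lincomb z x))) +
    avg (\<lambda>x. of_bool (th * sqrt (c t) < cmod (net_fun (2 * sqrt s) (q t) \<sigma> x - lincomb z x)))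
     \<le> 8 * exp (- \<Lambda>)" for t \<sigma>
  have "\<exists>\<sigma> \<in> {..<q t} \<rightarrow>\<^sub>E atoms J. Q t \<sigma>" for t
  proof -
    \<comment> \<open>The tolerance th * sqrt (c t) shrinks with \<open>t\<close>;
      \<open>q t\<close> grows like 2^t in order to keep the exponent at \<Lambda> or above on all
      levels.\<close>
    have "\<Lambda> \<le> q t * (th * sqrt (c t))\<^sup>2 / (8 * (2 * sqrt s * B)\<^sup>2)"
    proof -
      have "(th * sqrt (c t))\<^sup>2 = c t / 1600\<^sup>2" using c0[of t] by (simp add: th_def power_mult_distrib power_divide)
      then have "q t * (th * sqrt (c t))\<^sup>2 / (8 * (2 * sqrt s * B)\<^sup>2) = q t / (8 * 2 ^ t * 1600\<^sup>2)"
        using K by (simp add: c_def K_def[symmetric])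
      also have "\<Lambda> \<le> \<dots>" using q(1)[of t] by (simp add: field_simps)
      finally show ?thesis .
    qed
    then have le: "8 * exp (- (q t * (th * sqrt (c t))\<^sup>2 / (8 * (2 * sqrt s * B)\<^sup>2))) \<le> 8 * exp (- \<Lambda>)"
      by simp
    have "0 < th * sqrt (c t)" using c0[of t] by (simp add: th_def)
    with z1 s m X q(2) have "\<exists>\<sigma> \<in> {..<q t} \<rightarrow>\<^sub>E atoms J.
      expectation (\<lambda>x. of_bool (th * sqrt (c t) < cmod (net_fun (2 * sqrt s) (q t) \<sigma> x - lincomb z x))) +
       (\<Sum>l<m. of_bool (th * sqrt (c t) < cmod (net_fun (2 * sqrt s) (q t) \<sigma> (X l) - lincomb z (X l)))) / m
        \<le> 8 * exp (- (q t * (th * sqrt (c t))\<^sup>2 / (8 * (2 * sqrt s * B)\<^sup>2)))"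
      by (intro approx_on_levels) auto
    then show ?thesis unfolding Q_def avg_def by (rule bexE) (rule bexI, erule order_trans[OF _ le], assumption)
  qed
  then obtain \<sigma> where \<sigma>: "\<And>t. \<sigma> t \<in> {..<q t} \<rightarrow>\<^sub>E atoms J" and exc: "\<And>t. Q t (\<sigma> t)"
    by metis
  define h where "h t = net_fun (2 * sqrt s) (q t) (\<sigma> t)" for t
  have [measurable]: "h t \<in> borel_measurable M" for t unfolding h_def by (rule net_fun_meas[OF \<sigma>])
  define e :: "nat \<Rightarrow> 'a \<Rightarrow> real" where "e t x = of_bool (th * sqrt (c t) < cmod (h t x - lincomb z x))" for t x
  have [measurable]: "e t \<in> borel_measurable M" for t unfolding e_def[abs_def] of_bool_def by measurable
  have exc': "expectation (e t) + avg (e t) \<le> 8 * exp (- \<Lambda>)" for t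
    using exc[of t] unfolding Q_def e_def[abs_def] h_def .
  define L where "L t x = level (c t) (g x)" for t x
  define H where "H t x = level (c t) (cmod (h t x))" for t x
  define d where "d t x = (if c t \<le> 4 * (g x)\<^sup>2 then 2 * th * c t else 0)" for t x
  have [measurable]: "L t \<in> borel_measurable M" "H t \<in> borel_measurable M" "d t \<in> borel_measurable M" for t
    unfolding L_def[abs_def] H_def[abs_def] d_def[abs_def] by measurable
  \<comment> \<open>Off the exceptional set the error is \<open>d t x\<close>. On it nothing better
    than the height c t / 2 of the slice is available.\<close>
  have LH: "\<bar>L t x - H t x\<bar> \<le> d t x + c t / 2 * e t x" for t x
  proof (cases "th * sqrt (c t) < cmod (h t x - lincomb z x)")
    case True
    have "\<bar>L t x - H t x\<bar> \<le> c t / 2"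
      using level_nonneg[of "c t"] level_le[of "c t"] c0[of t] unfolding L_def H_def
      by (smt (verit, best))
    moreover have "0 \<le> d t x" using c0[of t] by (simp add: d_def th_def)
    ultimately show ?thesis using True by (simp add: e_def)
  next
    case False
    have "\<bar>g x - cmod (h t x)\<bar> \<le> cmod (h t x - lincomb z x)"
      unfolding g_def by (metis abs_minus_commute norm_triangle_ineq3)
    then have "\<bar>level (c t) (g x) - level (c t) (cmod (h t x))\<bar> \<le> d t x"
      unfolding d_def using False c0[of t] g0 by (intro level_diff) (auto simp: th_def)
    then show ?thesis using False by (simp add: L_def H_def e_def)
  qed
  have L_range: "0 \<le> L t x" "L t x \<le> K\<^sup>2" "0 \<le> H t x" "H t x \<le> K\<^sup>2" for t x
  proof -
    have "1 \<le> (2::real) ^ t" by simp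
    then have "1 \<le> (2::real) ^ t * 2" by linarith
    then have "c t / 2 \<le> K\<^sup>2" using K by (simp add: c_def divide_le_eq mult_le_cancel_left1)
    then show "0 \<le> L t x" "L t x \<le> K\<^sup>2" "0 \<le> H t x" "H t x \<le> K\<^sup>2"
      using level_nonneg[of "c t"] level_le[of "c t"] c0[of t] unfolding L_def H_def
      by (smt (verit, best))+
  qed
  have int: "integrable M (L t)" "integrable M (H t)" "integrable M (d t)" "integrable M (e t)" for t
  proof -
    show "integrable M (L t)" "integrable M (H t)"
      using L_range by (auto intro!: integrable_const_bound[where B = "K\<^sup>2"])
    show "integrable M (d t)" using c0[of t]
      by (intro integrable_const_bound[where B = "2 * th * c t"]) (auto simp: d_def th_def)
    show "integrable M (e t)" 
      by (intro integrable_const_bound[where B = 1]) (auto simp: e_def)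
  qed
  have intg: "integrable M (\<lambda>x. (g x)\<^sup>2)"
    using gK g0 by (intro integrable_const_bound[where B = "K\<^sup>2"]) (auto intro!: AE_I2 power_mono)
  define D where "D t = (expectation (d t) + avg (d t)) + c t / 2 * (expectation (e t) + avg (e t))" for t
  have avgL: "\<bar>avg (L t) - expectation (L t)\<bar> \<le> 1 / 100 * expectation (L t) + \<epsilon> t + 101 / 100 * D t" if "t < r" for t
  proof -
    have HY: "H t = Y t (\<sigma> t)" by (simp add: H_def Y_def c_def h_def fun_eq_iff)
    have "\<bar>m * avg (H t) - m * expectation (H t)\<bar> \<le> m * (1 / 100 * expectation (H t) + \<epsilon> t)"
      using net[OF that \<sigma>] m unfolding HY avg_def by simp
    then have 1: "\<bar>avg (H t) - expectation (H t)\<bar> \<le> 1 / 100 * expectation (H t) + \<epsilon> t"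
      using m by (simp add: right_diff_distrib[symmetric] abs_mult mult_le_cancel_left_pos)
    have LHx: "L t x \<le> H t x + (d t x + c t / 2 * e t x)" "H t x \<le> L t x + (d t x + c t / 2 * e t x)" for x
      using LH[of t x] by auto
    define A1 where "A1 = avg (d t) + c t / 2 * avg (e t)"
    define E1 where "E1 = expectation (d t) + c t / 2 * expectation (e t)"
    have 2: "avg (L t) \<le> avg (H t) + A1" "avg (H t) \<le> avg (L t) + A1"
      unfolding A1_def avg_add[symmetric] avg_cmult[symmetric] using LHx by (intro avg_mono; simp)+
    have E: "expectation (\<lambda>x. F x + (d t x + c t / 2 * e t x)) = expectation F + E1" if "integrable M F" for F
      unfolding E1_def using that int by simp
    have 3: "expectation (L t) \<le> expectation (H t) + E1"
      unfolding E[OF int(2), symmetric] using int LHx by (intro integral_mono) auto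
    have 5: "expectation (H t) \<le> expectation (L t) + E1"
      unfolding E[OF int(1), symmetric] using int LHx by (intro integral_mono) auto
    have 4: "0 \<le> E1" "0 \<le> A1"
      using c0[of t] unfolding E1_def A1_def avg_def
      by (auto intro!: add_nonneg_nonneg mult_nonneg_nonneg integral_nonneg_AE divide_nonneg_nonneg sum_nonneg simp: d_def e_def th_def)
    have "D t = E1 + A1" unfolding D_def E1_def A1_def by (simp add: algebra_simps)
    then show ?thesis using 1 2 3 4 5 unfolding abs_le_iff by linarith
  qed
  define Gh where "Gh = avg (\<lambda>x. (g x)\<^sup>2)"
  have EG: "expectation (\<lambda>x. (g x)\<^sup>2) = G"
    unfolding g_def G_def by (rule expectation_norm_lincomb_sq)
  have tel: "(\<Sum>t<r. L t x) = (g x)\<^sup>2 - min ((g x)\<^sup>2) (K\<^sup>2 / 2 ^ r)" if "x \<in> space M" for x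
    unfolding L_def c_def using g0 gK[OF that] by (rule sum_level)
  have Kr: "K\<^sup>2 / 2 ^ r \<le> 1 / 200" using r by (simp add: field_simps)
  have tel': "(\<Sum>t<r. L t x) \<le> (g x)\<^sup>2" "(g x)\<^sup>2 \<le> (\<Sum>t<r. L t x) + 1 / 200" if "x \<in> space M" for x
  proof -
    have "min ((g x)\<^sup>2) (K\<^sup>2 / 2 ^ r) \<le> 1 / 200" using Kr by (rule min.coboundedI2)
    moreover have "0 \<le> min ((g x)\<^sup>2) (K\<^sup>2 / 2 ^ r)" by simp
    ultimately show "(\<Sum>t<r. L t x) \<le> (g x)\<^sup>2" "(g x)\<^sup>2 \<le> (\<Sum>t<r. L t x) + 1 / 200"
      using tel[OF that] by linarith+
  qed
  have sL: "(\<Sum>t<r. avg (L t)) \<le> Gh" "Gh \<le> (\<Sum>t<r. avg (L t)) + 1 / 200"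
  proof -
    show "(\<Sum>t<r. avg (L t)) \<le> Gh" unfolding Gh_def avg_sum[symmetric] using tel' by (intro avg_mono)
    have "Gh \<le> avg (\<lambda>x. (\<Sum>t<r. L t x) + 1 / 200)" unfolding Gh_def using tel' by (intro avg_mono)
    also have "\<dots> = (\<Sum>t<r. avg (L t)) + 1 / 200" unfolding avg_add avg_sum using m by (simp add: avg_def)
    finally show "Gh \<le> (\<Sum>t<r. avg (L t)) + 1 / 200" .
  qed
  have sE: "(\<Sum>t<r. expectation (L t)) \<le> G" "G \<le> (\<Sum>t<r. expectation (L t)) + 1 / 200"
  proof -
    have eq: "(\<Sum>t<r. expectation (L t)) = expectation (\<lambda>x. \<Sum>t<r. L t x)" using int by simp
    show "(\<Sum>t<r. expectation (L t)) \<le> G" unfolding eq EG[symmetric] using int intg tel' by (intro integral_mono) auto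
    have "G \<le> expectation (\<lambda>x. (\<Sum>t<r. L t x) + 1 / 200)" unfolding EG[symmetric] using int intg tel' by (intro integral_mono) auto
    also have "\<dots> = (\<Sum>t<r. expectation (L t)) + 1 / 200" using int by (simp add: prob_space)
    finally show "G \<le> (\<Sum>t<r. expectation (L t)) + 1 / 200" .
  qed
  \<comment> \<open>The replacement errors of all levels together cost one hundredth of the square,
    with no factor \<open>r\<close>.\<close>
  have sd: "(\<Sum>t<r. d t x) \<le> 1 / 100 * (g x)\<^sup>2" for x
  proof -
    have "(\<Sum>t<r. d t x) = 2 * th * (\<Sum>t<r. if K\<^sup>2 / 2 ^ t \<le> 4 * (g x)\<^sup>2 then K\<^sup>2 / 2 ^ t else 0)"
      unfolding sum_distrib_left by (intro sum.cong) (auto simp: d_def c_def)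
    also have "\<dots> \<le> 2 * th * (2 * (4 * (g x)\<^sup>2))"
      by (intro mult_left_mono sum_geometric_below) (auto simp: th_def)
    finally show ?thesis by (simp add: th_def)
  qed
  have sD: "(\<Sum>t<r. D t) \<le> 1 / 100 * (G + Gh) + 1 / 1000"
  proof -
    have "(\<Sum>t<r. expectation (d t)) \<le> 1 / 100 * G"
    proof -
      have "(\<Sum>t<r. expectation (d t)) = expectation (\<lambda>x. \<Sum>t<r. d t x)" using int by simp
      also have "\<dots> \<le> expectation (\<lambda>x. 1 / 100 * (g x)\<^sup>2)" using int intg sd by (intro integral_mono) auto
      finally show ?thesis using EG by simp
    qed
    moreover have "(\<Sum>t<r. avg (d t)) \<le> 1 / 100 * Gh"
      unfolding avg_sum[symmetric] Gh_def avg_cmult[symmetric] using sd by (intro avg_mono)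
    moreover have "(\<Sum>t<r. c t / 2 * (expectation (e t) + avg (e t))) \<le> 1 / 1000"
    proof -
      have "(\<Sum>t<r. c t / 2 * (expectation (e t) + avg (e t))) \<le> (\<Sum>t<r. c t / 2 * (8 * exp (- \<Lambda>)))"
        using exc' c0 by (intro sum_mono mult_left_mono) (auto intro: less_imp_le)
      also have "\<dots> = 4 * exp (- \<Lambda>) * (\<Sum>t<r. c t)" unfolding sum_distrib_left by (intro sum.cong) auto
      \<comment> \<open>The heights sum to at most 2 K^2; the assumption on \<Lambda> makes
        exceptional sets of measure 8 exp (- \<Lambda>) negligible against this.\<close>
      also have "\<dots> \<le> 4 * exp (- \<Lambda>) * (2 * K\<^sup>2)"
      proof -
        have "(\<Sum>t<r. c t) = (\<Sum>t<r. if K\<^sup>2 / 2 ^ t \<le> K\<^sup>2 then K\<^sup>2 / 2 ^ t else 0)"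
          by (intro sum.cong) (auto simp: c_def divide_le_eq mult_le_cancel_left1)
        also have "\<dots> \<le> 2 * K\<^sup>2" by (rule sum_geometric_below) auto
        finally show ?thesis by (intro mult_left_mono) auto
      qed
      also have "\<dots> \<le> 1 / 1000" using \<Lambda> by (simp add: exp_minus field_simps)
      finally show ?thesis .
    qed
    ultimately show ?thesis unfolding D_def sum.distrib by argo
  qed
  have "\<bar>(\<Sum>t<r. avg (L t)) - (\<Sum>t<r. expectation (L t))\<bar>
     \<le> (\<Sum>t<r. 1 / 100 * expectation (L t) + \<epsilon> t + 101 / 100 * D t)"
    unfolding sum_subtractf[symmetric] using avgL by (intro order_trans[OF sum_abs] sum_mono) auto
  also have "\<dots> = 1 / 100 * (\<Sum>t<r. expectation (L t)) + (\<Sum>t<r. \<epsilon> t) + 101 / 100 * (\<Sum>t<r. D t)"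
    by (simp add: sum.distrib sum_distrib_left)
  finally have fin: "\<bar>(\<Sum>t<r. avg (L t)) - (\<Sum>t<r. expectation (L t))\<bar> \<le> \<dots>" .
  have G1: "G \<le> 1" using z2 by (simp add: G_def)
  have "\<bar>Gh - G\<bar> \<le> 1 / 20" using fin sD sE sL \<epsilon> G1 by argo
  then show ?thesis by (simp add: Gh_def G_def g_def avg_def)
qed

end

section \<open>The restricted near isometry event\<close>

lemma real_nat_ceiling_le: "0 \<le> x \<Longrightarrow> real (nat \<lceil>x\<rceil>) \<le> x + 1" for x :: real
  using ceiling_correct[of x] by (simp add: of_nat_nat)

definition near_isometry :: "'i set \<Rightarrow> nat \<Rightarrow> (nat \<Rightarrow> 'i \<Rightarrow> complex) \<Rightarrow> real \<Rightarrow> bool" where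
  "near_isometry J m A s \<longleftrightarrow> (\<forall>z.
     \<bar>(\<Sum>l<m. (cmod (\<Sum>j\<in>J. A l j * z j))\<^sup>2) - (\<Sum>j\<in>J. (cmod (z j))\<^sup>2)\<bar>
       \<le> 1 / 20 * ((\<Sum>j\<in>J. (cmod (z j))\<^sup>2) + (\<Sum>j\<in>J. cmod (z j))\<^sup>2 / s))"

text \<open>Both sides scale quadratically. Division by the square root of the bracket on the right
  brings both norms into the range of the hypothesis.\<close>

lemma near_isometryI:
  assumes s: "0 < s" and J: "finite J"
    and *: "\<And>z. (\<Sum>j\<in>J. (cmod (z j))\<^sup>2) \<le> 1 \<Longrightarrow> (\<Sum>j\<in>J. cmod (z j)) \<le> sqrt s \<Longrightarrow>
      \<bar>(\<Sum>l<m. (cmod (\<Sum>j\<in>J. A l j * z j))\<^sup>2) - (\<Sum>j\<in>J. (cmod (z j))\<^sup>2)\<bar> \<le> 1 / 20"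
  shows "near_isometry J m A s"
  unfolding near_isometry_def
proof
  fix z :: "'a \<Rightarrow> complex"
  define n2 where "n2 = (\<Sum>j\<in>J. (cmod (z j))\<^sup>2)"
  define n1 where "n1 = (\<Sum>j\<in>J. cmod (z j))"
  define \<rho> where "\<rho> = sqrt (n2 + n1\<^sup>2 / s)"
  have n0: "0 \<le> n2" "0 \<le> n1" by (auto simp: n2_def n1_def intro: sum_nonneg)
  show "\<bar>(\<Sum>l<m. (cmod (\<Sum>j\<in>J. A l j * z j))\<^sup>2) - n2\<bar> \<le> 1 / 20 * (n2 + n1\<^sup>2 / s)"
  proof (cases "n2 = 0")
    case True
    then have "\<forall>j\<in>J. z j = 0" using J by (simp add: n2_def sum_nonneg_eq_0_iff)
    then have "(\<Sum>j\<in>J. A l j * z j) = 0" for l by (intro sum.neutral) auto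
    then show ?thesis using True s by simp
  next
    case False
    then have "0 < n2 + n1\<^sup>2 / s" using n0 s by (intro add_pos_nonneg) auto
    then have \<rho>: "0 < \<rho>" "\<rho>\<^sup>2 = n2 + n1\<^sup>2 / s"
      unfolding \<rho>_def by (simp only: real_sqrt_gt_zero, simp only: real_sqrt_pow2 less_imp_le)
    define w where "w j = z j / \<rho>" for j
    have w2: "(\<Sum>j\<in>J. (cmod (w j))\<^sup>2) = n2 / \<rho>\<^sup>2"
      by (simp add: w_def n2_def norm_divide power_divide sum_divide_distrib)
    have w1: "(\<Sum>j\<in>J. cmod (w j)) = n1 / \<rho>"
      using \<rho> by (simp add: w_def n1_def norm_divide sum_divide_distrib)
    have wA: "(\<Sum>l<m. (cmod (\<Sum>j\<in>J. A l j * w j))\<^sup>2) = (\<Sum>l<m. (cmod (\<Sum>j\<in>J. A l j * z j))\<^sup>2) / \<rho>\<^sup>2"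
    proof -
      have "(\<Sum>j\<in>J. A l j * w j) = (\<Sum>j\<in>J. A l j * z j) / \<rho>" for l
        by (simp add: w_def sum_divide_distrib)
      then show ?thesis by (simp only:) (simp add: norm_divide power_divide flip: sum_divide_distrib)
    qed
    have "n2 \<le> \<rho>\<^sup>2" unfolding \<rho>(2) using s by simp
    then have 1: "(\<Sum>j\<in>J. (cmod (w j))\<^sup>2) \<le> 1" unfolding w2 using \<rho>(1) by (simp add: divide_le_eq)
    have "(sqrt s * \<rho>)\<^sup>2 = s * n2 + n1\<^sup>2" using \<rho> s by (simp add: power_mult_distrib distrib_left)
    then have "n1\<^sup>2 \<le> (sqrt s * \<rho>)\<^sup>2" using s n0 by simp
    then have "n1 \<le> sqrt s * \<rho>" by (rule power2_le_imp_le) (use \<rho>(1) s in simp)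
    then have 2: "(\<Sum>j\<in>J. cmod (w j)) \<le> sqrt s" unfolding w1 using \<rho>(1) by (simp add: divide_le_eq)
    have "\<bar>((\<Sum>l<m. (cmod (\<Sum>j\<in>J. A l j * z j))\<^sup>2) - n2) / \<rho>\<^sup>2\<bar> \<le> 1 / 20"
      using *[OF 1 2] unfolding wA w2 by (simp add: diff_divide_distrib)
    then have "\<bar>(\<Sum>l<m. (cmod (\<Sum>j\<in>J. A l j * z j))\<^sup>2) - n2\<bar> \<le> 1 / 20 * \<rho>\<^sup>2"
      using \<rho>(1) by (simp add: abs_divide divide_le_eq)
    then show ?thesis by (simp only: \<rho>(2))
  qed
qed

context orthonormal_functions
begin

text \<open>The functions tested are finitely many and fixed before \<open>X\<close> is drawn.
  Afterwards the net function that fits a given \<open>z\<close> may be chosen in dependence on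
  \<open>X\<close>.\<close>

lemma near_isometry_event:
  fixes m r :: nat and s \<gamma> \<Lambda> :: real
  defines "K \<equiv> 2 * sqrt s * B" and "P \<equiv> \<Pi>\<^sub>M l\<in>{..<m}. M"
  assumes s: "0 < s" and m: "0 < m" and \<gamma>: "0 < \<gamma>" "\<gamma> < 1" and r0: "0 < r"
    and \<Lambda>: "1 \<le> \<Lambda>" "8000 * K\<^sup>2 \<le> exp \<Lambda>" and r: "200 * K\<^sup>2 \<le> 2 ^ r"
    and sample: "10000 * K\<^sup>2 * (r * (9 * 1600\<^sup>2 * \<Lambda> * ln (4 * card J + 1)) + 2 * ln (2 * r / \<gamma>)) \<le> m"
  shows "\<exists>E\<in>sets P. 1 - \<gamma> \<le> measure P E \<and>
    (\<forall>X\<in>E. near_isometry J m (\<lambda>l j. b j (X l) / sqrt m) s)"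
proof -
  interpret PS: product_prob_space "\<lambda>_::nat. M" "{..<m}" by unfold_locales
  interpret P: prob_space P unfolding P_def by (rule prob_space_PiM) (rule prob_space_axioms)
  define q where "q t = nat \<lceil>8 * 2 ^ t * \<Lambda> * 1600\<^sup>2\<rceil>" for t :: nat
  define N where "N = 4 * card J + 1"
  define Y where "Y t \<sigma> x = level (K\<^sup>2 / 2 ^ t) (cmod (net_fun (2 * sqrt s) (q t) \<sigma> x))" for t \<sigma> x
  define net where "net t = ({..<q t} \<rightarrow>\<^sub>E atoms J)" for t
  \<comment> \<open>Solves m * (1/100) * \<epsilon> t / (K^2 / 2^t) = 9 * 1600^2 \<Lambda> 2^t ln N
    + ln (2 r / \<gamma>). The first term on the right pays for the net, the second for the failure
    probability. After division by 2^t the second is summable over \<open>t\<close>, so it is not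
    charged \<open>r\<close> times.\<close>
  define \<epsilon> where "\<epsilon> t = 100 * K\<^sup>2 / m * (9 * 1600\<^sup>2 * \<Lambda> * ln N + ln (2 * r / \<gamma>) / 2 ^ t)" for t :: nat
  define bad where "bad t \<sigma> = {X \<in> space P. \<not> \<bar>(\<Sum>l<m. Y t \<sigma> (X l)) - m * expectation (Y t \<sigma>)\<bar>
      \<le> m * (1 / 100 * expectation (Y t \<sigma>) + \<epsilon> t)}" for t \<sigma>
  define E where "E = space P - (\<Union>t\<in>{..<r}. \<Union>\<sigma>\<in>net t. bad t \<sigma>)"
  have K: "0 < K" using s B by (simp add: K_def)
  have q_ge: "8 * 2 ^ t * \<Lambda> * 1600\<^sup>2 \<le> q t" for t
    unfolding q_def by (rule real_nat_ceiling_ge)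
  have q_pos: "0 < q t" for t
  proof -
    have "0 < 8 * 2 ^ t * \<Lambda> * 1600\<^sup>2" using \<Lambda> by simp
    then have "0 < real (q t)" using q_ge[of t] by linarith
    then show ?thesis by simp
  qed
  have q_le: "q t \<le> 9 * 1600\<^sup>2 * \<Lambda> * 2 ^ t" for t
  proof -
    have "1 * 1 \<le> \<Lambda> * 2 ^ t" using \<Lambda> by (intro mult_mono) auto
    moreover have "q t \<le> 8 * 2 ^ t * \<Lambda> * 1600\<^sup>2 + 1"
      unfolding q_def using \<Lambda> by (intro real_nat_ceiling_le) auto
    ultimately show ?thesis by (simp add: mult_ac)
  qed
  have N: "1 \<le> N" by (simp add: N_def)
  have lnN: "0 \<le> ln N" using N by simp
  have r\<gamma>: "1 \<le> 2 * r / \<gamma>" using r0 \<gamma> by (simp add: le_divide_eq)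
  have finnet: "finite (net t)" for t unfolding net_def using J by (intro finite_PiE) auto
  have cardnet: "card (net t) = N ^ q t" for t
    unfolding net_def N_def using J by (simp add: card_PiE card_atoms)
  have Ym: "Y t \<sigma> \<in> borel_measurable M" if "\<sigma> \<in> net t" for t \<sigma>
  proof -
    have [measurable]: "net_fun (2 * sqrt s) (q t) \<sigma> \<in> borel_measurable M"
      using that unfolding net_def by (rule net_fun_meas)
    show ?thesis unfolding Y_def[abs_def] by measurable
  qed
  have bad_sets: "bad t \<sigma> \<in> sets P" if "\<sigma> \<in> net t" for t \<sigma>
  proof -
    note [measurable] = Ym[OF that]
    have [measurable]: "(\<lambda>X. \<Sum>l<m. Y t \<sigma> (X l)) \<in> borel_measurable P" unfolding P_def by measurable
    show ?thesis unfolding bad_def by measurable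
  qed
  have bad_prob: "measure P (bad t \<sigma>) \<le> \<gamma> / r / card (net t)" if "\<sigma> \<in> net t" for t \<sigma>
  proof -
    have c: "0 < K\<^sup>2 / 2 ^ t" using K by simp
    have rate: "m * (1 / 100) * \<epsilon> t / (K\<^sup>2 / 2 ^ t) = 9 * 1600\<^sup>2 * \<Lambda> * 2 ^ t * ln N + ln (2 * r / \<gamma>)"
      using K m by (simp add: \<epsilon>_def field_simps)
    have "measure P (bad t \<sigma>) \<le> 2 * exp (- (m * (1 / 100) * \<epsilon> t / (K\<^sup>2 / 2 ^ t)))"
      unfolding bad_def P_def using level_nonneg[OF less_imp_le[OF c]] level_le[of "K\<^sup>2 / 2 ^ t"] c
      by (intro chernoff_iid Ym that) (auto simp: Y_def intro: order_trans[OF level_le])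
    then have 1: "measure P (bad t \<sigma>) \<le> 2 * exp (- (9 * 1600\<^sup>2 * \<Lambda> * 2 ^ t * ln N + ln (2 * r / \<gamma>)))"
      by (simp only: rate)
    have 2: "2 * exp (- (9 * 1600\<^sup>2 * \<Lambda> * 2 ^ t * ln N + ln (2 * r / \<gamma>))) \<le> 2 * exp (- (q t * ln N + ln (2 * r / \<gamma>)))"
      using mult_right_mono[OF q_le lnN] by simp
    have 3: "2 * exp (- (q t * ln N + ln (2 * r / \<gamma>))) = \<gamma> / r / card (net t)"
    proof -
      have "exp (q t * ln N) = N ^ q t" using N by (simp add: exp_of_nat_mult)
      moreover have "exp (ln (2 * r / \<gamma>)) = 2 * r / \<gamma>" using r\<gamma> by (intro exp_ln) linarith
      ultimately have "2 * exp (- (q t * ln N + ln (2 * r / \<gamma>))) = 2 * (inverse (N ^ q t) * inverse (2 * r / \<gamma>))"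
        by (simp only: exp_minus exp_add inverse_mult_distrib)
      then show ?thesis using \<gamma> by (simp add: cardnet field_simps)
    qed
    show ?thesis using 1 2 3 by linarith
  qed
  have sub: "measure P (\<Union>t\<in>{..<r}. \<Union>\<sigma>\<in>net t. bad t \<sigma>) \<le> \<gamma>"
  proof -
    have "measure P (\<Union>t\<in>{..<r}. \<Union>\<sigma>\<in>net t. bad t \<sigma>) \<le> (\<Sum>t<r. measure P (\<Union>\<sigma>\<in>net t. bad t \<sigma>))"
      using bad_sets finnet by (intro measure_UNION_le) auto
    also have "\<dots> \<le> (\<Sum>t<r. \<Sum>\<sigma>\<in>net t. measure P (bad t \<sigma>))"
      using bad_sets finnet by (intro sum_mono measure_UNION_le) auto
    also have "\<dots> \<le> (\<Sum>t<r. \<Sum>\<sigma>\<in>net t. \<gamma> / r / card (net t))"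
      by (intro sum_mono bad_prob)
    also have "\<dots> = \<gamma>" using r0 N by (simp add: cardnet)
    finally show ?thesis .
  qed
  have Es: "E \<in> sets P" unfolding E_def using bad_sets finnet by (auto intro!: sets.finite_UN)
  have "measure P E = 1 - measure P (\<Union>t\<in>{..<r}. \<Union>\<sigma>\<in>net t. bad t \<sigma>)"
    unfolding E_def using bad_sets finnet by (intro P.prob_compl) (auto intro!: sets.finite_UN)
  then have prob: "1 - \<gamma> \<le> measure P E" using sub by simp
  have \<epsilon>: "(\<Sum>t<r. \<epsilon> t) \<le> 1 / 100"
  proof -
    have "(\<Sum>t<r. \<epsilon> t) = 100 * K\<^sup>2 / m * (r * (9 * 1600\<^sup>2 * \<Lambda> * ln N) + ln (2 * r / \<gamma>) * (\<Sum>t<r. (1 / 2) ^ t))"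
      unfolding \<epsilon>_def sum_distrib_left[symmetric] sum.distrib
      by (simp add: sum_distrib_left power_divide)
    also have "\<dots> \<le> 100 * K\<^sup>2 / m * (r * (9 * 1600\<^sup>2 * \<Lambda> * ln N) + ln (2 * r / \<gamma>) * 2)"
    proof -
      have "(\<Sum>t<r. (1 / 2 :: real) ^ t) \<le> 2" by (simp only: sum_gp_strict) simp
      then show ?thesis using r\<gamma> by (intro mult_left_mono add_left_mono) auto
    qed
    also have "\<dots> \<le> 1 / 100" using sample m by (simp add: N_def field_simps)
    finally show ?thesis .
  qed
  have "near_isometry J m (\<lambda>l j. b j (X l) / sqrt m) s" if "X \<in> E" for X
  proof (rule near_isometryI[OF s J])
    fix z :: "'i \<Rightarrow> complex"
    assume z: "(\<Sum>j\<in>J. (cmod (z j))\<^sup>2) \<le> 1" "(\<Sum>j\<in>J. cmod (z j)) \<le> sqrt s"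
    have XP: "X \<in> space P" using that by (simp add: E_def)
    then have X: "X l \<in> space M" if "l < m" for l
      using that by (auto simp: P_def space_PiM PiE_iff)
    have good: "\<bar>(\<Sum>l<m. Y t \<sigma> (X l)) - m * expectation (Y t \<sigma>)\<bar> \<le> m * (1 / 100 * expectation (Y t \<sigma>) + \<epsilon> t)"
      if "t < r" "\<sigma> \<in> {..<q t} \<rightarrow>\<^sub>E atoms J" for t \<sigma>
      using \<open>X \<in> E\<close> XP that unfolding E_def bad_def net_def by fastforce
    have "\<bar>(\<Sum>l<m. (cmod (lincomb z (X l)))\<^sup>2) / m - (\<Sum>j\<in>J. (cmod (z j))\<^sup>2)\<bar> \<le> 1 / 20"
      by (rule near_isometry_on_net[OF s m X q_ge q_pos _ _ _ \<epsilon> z])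
         (use \<Lambda> r good in \<open>simp_all add: K_def Y_def[abs_def]\<close>)
    moreover have "(\<Sum>j\<in>J. b j (X l) / sqrt m * z j) = lincomb z (X l) / sqrt m" for l
      by (simp add: lincomb_def sum_divide_distrib mult.commute)
    ultimately show "\<bar>(\<Sum>l<m. (cmod (\<Sum>j\<in>J. b j (X l) / sqrt m * z j))\<^sup>2) - (\<Sum>j\<in>J. (cmod (z j))\<^sup>2)\<bar> \<le> 1 / 20"
      using m by (simp add: norm_divide power_divide sum_divide_distrib)
  qed
  then show ?thesis using Es prob by blast
qed

end

text \<open>The alternatives are n = 1, where the logarithm is truncated at 1, and n >= 2, where |J|
  >= 3. In the latter case \<open>ln L\<close> can be negative. The first bound keeps a tenth of
  \<open>L\<^sup>2 * ln N\<close> when \<open>ln L\<close> is added, so the required sample size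
  stays positive.\<close>

lemma log_factor_lower:
  fixes L :: real and N :: nat
  assumes "1 \<le> L \<and> 2 \<le> N \<or> ln 2 \<le> L \<and> 3 \<le> N"
  shows "- (9 / 10) * (L\<^sup>2 * ln N) \<le> ln L" "2 / 3 \<le> L" "1 / 4 \<le> L\<^sup>2 * ln N"
proof -
  show L: "2 / 3 \<le> L" using assms ln2_ge_two_thirds by linarith
  have N: "2 \<le> N" using assms by auto
  have "2 / 3 \<le> ln (real N)"
  proof -
    have "ln 2 \<le> ln (real N)" using N by (subst ln_le_cancel_iff) auto
    then show ?thesis using ln2_ge_two_thirds by linarith
  qed
  moreover have L2: "4 / 9 \<le> L\<^sup>2" using power_mono[OF L, of 2] by (simp add: power_divide)
  ultimately have "4 / 9 * (2 / 3) \<le> L\<^sup>2 * ln N" by (intro mult_mono) auto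
  then show "1 / 4 \<le> L\<^sup>2 * ln N" by simp
  show "- (9 / 10) * (L\<^sup>2 * ln N) \<le> ln L"
  proof (cases "1 \<le> L")
    case True
    then have "0 \<le> ln L" by simp
    with \<open>1 / 4 \<le> L\<^sup>2 * ln N\<close> show ?thesis by simp
  next
    case False
    then have "3 \<le> N" using assms by auto
    then have "ln 3 \<le> ln (real N)" by simp
    then have "4 / 9 * ln 3 \<le> L\<^sup>2 * ln N" using L2 by (intro mult_mono) auto
    \<comment> \<open>(3/2)^5 = 243/32 is below 9. With L >= 2/3 this gives ln L >= - 2/5 * ln 3,
      and 2/5 is 9/10 of 4/9.\<close>
    moreover have "5 * ln (3 / 2 :: real) \<le> 2 * ln 3"
    proof -
      have "5 * ln (3 / 2 :: real) = ln ((3 / 2) ^ 5)" by (simp only: ln_realpow)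
      also have "\<dots> \<le> ln (3 ^ 2)" by (subst ln_le_cancel_iff) (auto simp: eval_nat_numeral)
      also have "\<dots> = 2 * ln 3" by (simp only: ln_realpow)
      finally show ?thesis .
    qed
    moreover have "- ln (3 / 2) \<le> ln L"
      using L ln_mono[of "2 / 3" L] by (simp add: ln_div)
    ultimately show ?thesis by argo
  qed
qed

text \<open>Here \<open>D\<close> stands for B^2 n and 104 D for K^2. Both \<open>r\<close> and
  \<Lambda> are logarithms of multiples of \<open>D\<close>. As \<open>L\<close> is bounded away
  from 0, their additive constants are absorbed into multiples of \<open>L\<close>.\<close>

lemma sample_size_suffices:
  fixes D L \<gamma> :: real and N :: nat
  assumes D: "1 \<le> D" "ln D \<le> L" and L: "1 \<le> L \<and> 2 \<le> N \<or> ln 2 \<le> L \<and> 3 \<le> N"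
    and \<gamma>: "0 < \<gamma>" "\<gamma> < 1"
  shows "\<exists>(r::nat) \<Lambda>. 0 < r \<and> 1 \<le> \<Lambda> \<and> 8000 * (104 * D) \<le> exp \<Lambda> \<and> 200 * (104 * D) \<le> 2 ^ r \<and>
    r * (9 * 1600\<^sup>2 * \<Lambda> * ln (4 * N + 1)) + 2 * ln (2 * r / \<gamma>)
      \<le> 10 ^ 13 * (L\<^sup>2 * ln N + ln (inverse \<gamma> * L)) \<and>
    0 < L\<^sup>2 * ln N + ln (inverse \<gamma> * L)"
proof -
  note low = log_factor_lower[OF L]
  define P where "P = L\<^sup>2 * ln N"
  define W where "W = ln (inverse \<gamma> * L)"
  define \<Lambda> where "\<Lambda> = ln (832000 * D)"
  define r where "r = nat \<lceil>log 2 (20800 * D)\<rceil>"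
  have N: "2 \<le> N" using L by auto
  have lnN: "0 < ln (real N)" using N by simp
  have L0: "0 < L" using low by linarith
  have \<Lambda>_eq: "\<Lambda> = ln 832000 + ln D" unfolding \<Lambda>_def using D by (subst ln_mult) auto
  have "ln (832000::real) \<le> ln (2 ^ 20)" by simp
  also have "\<dots> \<le> 20" using ln_2_less_1 by (simp only: ln_realpow)
  finally have \<Lambda>_le: "\<Lambda> \<le> 31 * L" using \<Lambda>_eq D low(2) by linarith
  have \<Lambda>_ge: "1 \<le> \<Lambda>"
  proof -
    have "exp 1 \<le> (832000::real)" using exp_le by simp
    then have "1 \<le> ln (832000::real)" by (simp add: ln_ge_iff)
    moreover have "0 \<le> ln D" using D by simp
    ultimately show ?thesis using \<Lambda>_eq by simp
  qed
  have exp\<Lambda>: "exp \<Lambda> = 8000 * (104 * D)" unfolding \<Lambda>_def using D by simp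
  have "1 \<le> 20800 * D" using D by simp
  then have logD: "0 < log 2 (20800 * D)" using D by (subst zero_less_log_cancel_iff) auto
  have r0: "0 < r" unfolding r_def using logD by simp
  have r_ge: "200 * (104 * D) \<le> 2 ^ r"
  proof -
    have "20800 * D = 2 powr (log 2 (20800 * D))" using D by simp
    also have "\<dots> \<le> 2 powr r" unfolding r_def by (intro powr_mono real_nat_ceiling_ge) auto
    finally show ?thesis by (simp add: powr_realpow)
  qed
  have r_le: "r \<le> 26 * L"
  proof -
    have "log 2 (20800 * D) = log 2 20800 + log 2 D" using D by (subst log_mult) auto
    moreover have "log 2 20800 \<le> log 2 (2 ^ 15)" by (subst log_le_cancel_iff) auto
    moreover have "log 2 (2 ^ 15) = (15::real)" by (subst log_nat_power) auto
    moreover have "log 2 D \<le> 3 / 2 * L"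
    proof -
      have "ln D \<le> 3 / 2 * L * (2 / 3)" using D by simp
      also have "\<dots> \<le> 3 / 2 * L * ln 2" using L0 ln2_ge_two_thirds by (intro mult_left_mono) auto
      finally show ?thesis by (simp add: log_def divide_le_eq)
    qed
    moreover have "real r \<le> log 2 (20800 * D) + 1" unfolding r_def using logD by (intro real_nat_ceiling_le) auto
    ultimately show ?thesis using low(2) by linarith
  qed
  have ln4: "ln (4 * N + 1) \<le> 4 * ln N"
  proof -
    have "4 * N + 1 \<le> N ^ 4"
    proof -
      have "8 * N \<le> N ^ 3 * N" using power_mono[OF N, of 3] by (intro mult_right_mono) auto
      also have "\<dots> = N ^ 4" by (simp add: eval_nat_numeral)
      finally show ?thesis using N by linarith
    qed
    then have "real (4 * N + 1) \<le> real N ^ 4" by (metis of_nat_le_iff of_nat_power)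
    then have "ln (real (4 * N + 1)) \<le> ln (real N ^ 4)" using N by (subst ln_le_cancel_iff) auto
    also have "\<dots> = 4 * ln N" by (simp add: ln_realpow)
    finally show ?thesis by simp
  qed
  have first: "r * (9 * 1600\<^sup>2 * \<Lambda> * ln (4 * N + 1)) \<le> (26 * L) * (9 * 1600\<^sup>2 * (31 * L) * (4 * ln N))"
    using r_le \<Lambda>_le ln4 \<Lambda>_ge L0 by (intro mult_mono mult_nonneg_nonneg) auto
  have P: "1 / 4 \<le> P" using low(3) by (simp add: P_def)
  have W: "- (9 / 10) * P \<le> W"
  proof -
    have "1 * L \<le> inverse \<gamma> * L" using \<gamma> L0 by (intro mult_right_mono) (auto simp: one_le_inverse)
    then have "ln L \<le> W" unfolding W_def using L0 by (intro ln_mono) auto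
    then show ?thesis using low(1) by (simp add: P_def)
  qed
  have second: "2 * ln (2 * r / \<gamma>) \<le> 12 + 2 * W"
  proof -
    have "2 * r / \<gamma> \<le> 2 ^ 6 * (inverse \<gamma> * L)"
      using r_le \<gamma> L0 by (simp add: divide_inverse mult_ac mult_left_mono)
    then have "ln (2 * r / \<gamma>) \<le> ln (2 ^ 6 * (inverse \<gamma> * L))" using r0 \<gamma> by (intro ln_mono) auto
    also have "\<dots> = ln (2 ^ 6) + W" unfolding W_def using \<gamma> L0 by (subst ln_mult) auto
    also have "ln (2 ^ 6) = 6 * ln (2 :: real)" using ln_realpow[of 2 6] by simp
    finally show ?thesis using ln_2_less_1 by linarith
  qed
  have "r * (9 * 1600\<^sup>2 * \<Lambda> * ln (4 * N + 1)) + 2 * ln (2 * r / \<gamma>) \<le> 26 * 9 * 1600\<^sup>2 * 31 * 4 * P + 12 + 2 * W"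
    using first second by (simp add: P_def power2_eq_square mult_ac)
  \<comment> \<open>\<open>W\<close> may be as low as - 9/10 * P, so little more than a tenth of
    10^13 P is certain to be available. This decides the size of the constant.\<close>
  also have "\<dots> \<le> 10 ^ 13 * (P + W)" using P W by (simp add: power2_eq_square)
  finally show ?thesis
    using r0 \<Lambda>_ge exp\<Lambda> r_ge P W unfolding P_def W_def by (intro exI[of _ r] exI[of _ \<Lambda>]) auto
qed

section \<open>Stability of the decoders\<close>

definition vec_norm :: "nat \<Rightarrow> (nat \<Rightarrow> complex) \<Rightarrow> real" where
  "vec_norm m u = L2_set (\<lambda>l. cmod (u l)) {..<m}"

definition coeff_norm :: "'i set \<Rightarrow> ('i \<Rightarrow> complex) \<Rightarrow> real" where
  "coeff_norm J z = L2_set (\<lambda>j. cmod (z j)) J"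

definition mat_vec :: "'i set \<Rightarrow> (nat \<Rightarrow> 'i \<Rightarrow> complex) \<Rightarrow> ('i \<Rightarrow> complex) \<Rightarrow> nat \<Rightarrow> complex" where
  "mat_vec J A z l = (\<Sum>j\<in>J. A l j * z j)"

lemma vec_norm_nonneg [simp]: "0 \<le> vec_norm m u"
  by (simp add: vec_norm_def L2_set_nonneg)

lemma coeff_norm_nonneg [simp]: "0 \<le> coeff_norm J z"
  by (simp add: coeff_norm_def L2_set_nonneg)

lemma vec_norm_sq: "(vec_norm m u)\<^sup>2 = (\<Sum>l<m. (cmod (u l))\<^sup>2)"
  by (simp add: vec_norm_def L2_set_def sum_nonneg)

lemma coeff_norm_sq: "(coeff_norm J z)\<^sup>2 = (\<Sum>j\<in>J. (cmod (z j))\<^sup>2)"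
  by (simp add: coeff_norm_def L2_set_def sum_nonneg)

lemma vec_norm_triangle: "vec_norm m (\<lambda>l. u l + v l) \<le> vec_norm m u + vec_norm m v"
  unfolding vec_norm_def
  by (rule order_trans[OF L2_set_mono L2_set_triangle_ineq]) (auto intro: norm_triangle_ineq)

lemma vec_norm_minus: "vec_norm m (\<lambda>l. - u l) = vec_norm m u"
  by (simp add: vec_norm_def)

lemma vec_norm_triangle_diff: "vec_norm m (\<lambda>l. u l - v l) \<le> vec_norm m u + vec_norm m v"
  using vec_norm_triangle[of m u "\<lambda>l. - v l"] by (simp add: vec_norm_minus)

lemma coeff_norm_triangle_diff: "coeff_norm J (\<lambda>j. u j - v j) \<le> coeff_norm J u + coeff_norm J v"
  unfolding coeff_norm_def
  by (rule order_trans[OF L2_set_mono L2_set_triangle_ineq]) (auto intro: norm_triangle_ineq4)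

lemma vec_norm_cong: "(\<And>l. l < m \<Longrightarrow> u l = v l) \<Longrightarrow> vec_norm m u = vec_norm m v"
  unfolding vec_norm_def by (intro L2_set_cong) auto

lemma sum_norm_le_card:
  assumes "finite K" "card K \<le> k"
  shows "(\<Sum>j\<in>K. cmod (z j)) \<le> sqrt k * coeff_norm K z"
proof -
  have "(\<Sum>j\<in>K. \<bar>1\<bar> * \<bar>cmod (z j)\<bar>) \<le> L2_set (\<lambda>_. 1) K * L2_set (\<lambda>j. cmod (z j)) K"
    by (rule L2_set_mult_ineq)
  also have "L2_set (\<lambda>_. 1 :: real) K = sqrt (card K)"
    by (simp add: L2_set_def)
  also have "sqrt (card K) * L2_set (\<lambda>j. cmod (z j)) K \<le> sqrt k * L2_set (\<lambda>j. cmod (z j)) K"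
    using assms by (intro mult_right_mono) (auto simp: L2_set_nonneg)
  finally show ?thesis by (simp add: coeff_norm_def)
qed

lemma coeff_norm_mono_set:
  assumes "finite J" "K \<subseteq> J"
  shows "coeff_norm K z \<le> coeff_norm J z"
  unfolding coeff_norm_def L2_set_def using assms by (auto intro!: sum_mono2)

lemma mat_vec_diff: "mat_vec J A (\<lambda>j. u j - v j) l = mat_vec J A u l - mat_vec J A v l"
  by (simp add: mat_vec_def algebra_simps sum_subtractf)

lemma mat_vec_supp:
  assumes "finite J" "S \<subseteq> J" "z \<in> coeff_vectors S"
  shows "mat_vec J A z l = mat_vec S A z l"
  unfolding mat_vec_def using assms by (intro sum.mono_neutral_right) (auto simp: coeff_vectors_def)

lemma residual_norm_eq: "residual_norm J m A y z = vec_norm m (\<lambda>l. y l - mat_vec J A z l)"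
  by (simp add: residual_norm_def vec_norm_def residual_def mat_vec_def)

lemma near_isometry_bounds:
  assumes "near_isometry J m A s"
  shows "19 / 20 * (coeff_norm J z)\<^sup>2 \<le> (vec_norm m (mat_vec J A z))\<^sup>2 + 1 / 20 * ((\<Sum>j\<in>J. cmod (z j))\<^sup>2 / s)"
    and "(vec_norm m (mat_vec J A z))\<^sup>2 \<le> 21 / 20 * (coeff_norm J z)\<^sup>2 + 1 / 20 * ((\<Sum>j\<in>J. cmod (z j))\<^sup>2 / s)"
proof -
  have "\<bar>(vec_norm m (mat_vec J A z))\<^sup>2 - (coeff_norm J z)\<^sup>2\<bar>
     \<le> 1 / 20 * ((coeff_norm J z)\<^sup>2 + (\<Sum>j\<in>J. cmod (z j))\<^sup>2 / s)"
    using assms unfolding near_isometry_def vec_norm_sq coeff_norm_sq mat_vec_def by blast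
  then show "19 / 20 * (coeff_norm J z)\<^sup>2 \<le> (vec_norm m (mat_vec J A z))\<^sup>2 + 1 / 20 * ((\<Sum>j\<in>J. cmod (z j))\<^sup>2 / s)"
    and "(vec_norm m (mat_vec J A z))\<^sup>2 \<le> 21 / 20 * (coeff_norm J z)\<^sup>2 + 1 / 20 * ((\<Sum>j\<in>J. cmod (z j))\<^sup>2 / s)"
    by argo+
qed

text \<open>By Cauchy-Schwarz the l1 term is at most the l2 term, and the two errors of 1/20 add up
  to 1/10.\<close>

lemma near_isometry_sparse:
  assumes ni: "near_isometry J m A s" and J: "finite J" and U: "U \<subseteq> J" "card U \<le> k" "k \<le> s" "0 < s"
    and z: "z \<in> coeff_vectors U"
  shows "9 / 10 * (coeff_norm J z)\<^sup>2 \<le> (vec_norm m (mat_vec J A z))\<^sup>2"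
    and "(vec_norm m (mat_vec J A z))\<^sup>2 \<le> 11 / 10 * (coeff_norm J z)\<^sup>2"
proof -
  have "(\<Sum>j\<in>J. cmod (z j)) = (\<Sum>j\<in>U. cmod (z j))"
    using J U z by (intro sum.mono_neutral_right) (auto simp: coeff_vectors_def)
  also have "\<dots> \<le> sqrt k * coeff_norm U z"
    using J U finite_subset by (intro sum_norm_le_card) auto
  also have "\<dots> \<le> sqrt s * coeff_norm J z"
    using U J by (intro mult_mono coeff_norm_mono_set) auto
  finally have "(\<Sum>j\<in>J. cmod (z j))\<^sup>2 \<le> (sqrt s * coeff_norm J z)\<^sup>2"
    by (intro power_mono) (auto intro: sum_nonneg)
  then have "(\<Sum>j\<in>J. cmod (z j))\<^sup>2 / s \<le> (coeff_norm J z)\<^sup>2"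
    using U by (simp add: power_mult_distrib divide_le_eq mult.commute)
  then show "9 / 10 * (coeff_norm J z)\<^sup>2 \<le> (vec_norm m (mat_vec J A z))\<^sup>2"
    and "(vec_norm m (mat_vec J A z))\<^sup>2 \<le> 11 / 10 * (coeff_norm J z)\<^sup>2"
    using near_isometry_bounds[OF ni, of z] by argo+
qed

subsection \<open>The square-root Lasso\<close>

text \<open>Optimality against \<open>x\<close> bounds the error off \<open>K\<close> plus 3 sqrt n
  times the image of the error by the error on \<open>K\<close>, up to tail and noise
  (\<open>opt\<close>). The near isometry bounds the error on \<open>K\<close> by 1.03 sqrt n times
  the image plus a small share of the full l1 error. Since 2 * 1.03 < 3, the image terms are
  absorbed; this explains the weight 3 sqrt n.\<close>

lemma rlasso_stable:
  fixes n :: nat and x r :: "'i \<Rightarrow> complex"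
  assumes ni: "near_isometry J m A (26 * real n)" and n: "1 \<le> n" and J: "finite J"
    and y: "\<And>l. l < m \<Longrightarrow> y l = mat_vec J A x l + e l"
    and r: "is_arg_min (rlasso_objective J m (3 * sqrt n) A y) (\<lambda>z. z \<in> coeff_vectors J) r"
    and K: "K \<subseteq> J" "card K \<le> n"
  defines "\<sigma> \<equiv> (\<Sum>j\<in>J - K. cmod (x j))" and "\<eta> \<equiv> vec_norm m e"
  shows "(\<Sum>j\<in>J. cmod (r j - x j)) \<le> 12 * (\<sigma> + sqrt n * \<eta>)"
    and "sqrt n * coeff_norm J (\<lambda>j. r j - x j) \<le> 12 * (\<sigma> + sqrt n * \<eta>)"
proof -
  define v where "v j = r j - x j" for j
  define q where "q = sqrt n"
  define T where "T = vec_norm m (mat_vec J A v)"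
  define V where "V = (\<Sum>j\<in>J. cmod (v j))"
  define V1 where "V1 = (\<Sum>j\<in>K. cmod (v j))"
  define V2 where "V2 = (\<Sum>j\<in>J - K. cmod (v j))"
  have q: "1 \<le> q" "q\<^sup>2 = n" using n by (auto simp: q_def)
  have fK: "finite K" using K J finite_subset by auto
  have V: "V = V1 + V2" unfolding V_def V1_def V2_def using K J by (metis add.commute sum.subset_diff)
  have nn: "0 \<le> T" "0 \<le> V1" "0 \<le> V2" "0 \<le> \<sigma>" "0 \<le> \<eta>"
    by (auto simp: T_def V1_def V2_def \<sigma>_def \<eta>_def intro: sum_nonneg)
  \<comment> \<open>A competitor in the minimization must vanish off \<open>J\<close>, whereas
    \<open>x\<close> will be the full coefficient sequence.\<close>
  define x' where "x' j = (if j \<in> J then x j else 0)" for j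
  have "rlasso_objective J m (3 * q) A y r \<le> rlasso_objective J m (3 * q) A y x'"
    using r unfolding is_arg_min_linorder q_def by (auto simp: coeff_vectors_def x'_def)
  moreover have "rlasso_objective J m (3 * q) A y x' = (\<Sum>j\<in>J. cmod (x j)) + 3 * q * \<eta>"
  proof -
    have "mat_vec J A x' l = mat_vec J A x l" for l
      unfolding mat_vec_def by (intro sum.cong) (auto simp: x'_def)
    then have "residual_norm J m A y x' = \<eta>"
      unfolding residual_norm_eq \<eta>_def by (intro vec_norm_cong) (auto simp: y)
    then show ?thesis by (simp add: rlasso_objective_def x'_def)
  qed
  moreover have "T - \<eta> \<le> residual_norm J m A y r"
  proof -
    have "vec_norm m (\<lambda>l. e l - (y l - mat_vec J A r l)) = T"
      unfolding T_def by (intro vec_norm_cong) (simp add: y v_def[abs_def] mat_vec_diff)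
    then show ?thesis
      using vec_norm_triangle_diff[of m e "\<lambda>l. y l - mat_vec J A r l"] by (simp add: residual_norm_eq \<eta>_def)
  qed
  then have "3 * q * (T - \<eta>) \<le> 3 * q * residual_norm J m A y r" using q by (intro mult_left_mono) auto
  moreover have "(\<Sum>j\<in>J. cmod (x j)) - V1 + V2 - 2 * \<sigma> \<le> (\<Sum>j\<in>J. cmod (r j))"
  proof -
    have "cmod (x j) - cmod (v j) \<le> cmod (r j)" "cmod (v j) - cmod (x j) \<le> cmod (r j)" for j
      using norm_triangle_ineq4[of "r j" "v j"] norm_triangle_ineq4[of "r j" "x j"] by (auto simp: v_def)
    then have "(\<Sum>j\<in>K. cmod (x j) - cmod (v j)) \<le> (\<Sum>j\<in>K. cmod (r j))"
      "(\<Sum>j\<in>J - K. cmod (v j) - cmod (x j)) \<le> (\<Sum>j\<in>J - K. cmod (r j))"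
      by (auto intro!: sum_mono)
    moreover have "(\<Sum>j\<in>J. f j) = (\<Sum>j\<in>K. f j) + (\<Sum>j\<in>J - K. f j)" for f :: "'i \<Rightarrow> real"
      using K J by (metis add.commute sum.subset_diff)
    ultimately show ?thesis unfolding V1_def V2_def \<sigma>_def sum_subtractf by simp
  qed
  ultimately have opt: "V2 + 3 * (q * T) \<le> V1 + 2 * \<sigma> + 6 * (q * \<eta>)"
    unfolding rlasso_objective_def by (simp add: algebra_simps)
  \<comment> \<open>The constants round up the square roots of 20/19 and of 1 / (19 * 26).\<close>
  have l2: "q * coeff_norm J v \<le> 103 / 100 * (q * T) + 46 / 1000 * V"
  proof (rule power2_le_imp_le)
    have "19 / 20 * (q * coeff_norm J v)\<^sup>2 \<le> (q * T)\<^sup>2 + 1 / 20 * (V\<^sup>2 / 26)"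
    proof -
      have "q\<^sup>2 * (19 / 20 * (coeff_norm J v)\<^sup>2) \<le> q\<^sup>2 * (T\<^sup>2 + 1 / 20 * (V\<^sup>2 / (26 * q\<^sup>2)))"
        using near_isometry_bounds(1)[OF ni, of v] unfolding T_def V_def q by (intro mult_left_mono) auto
      also have "\<dots> = (q * T)\<^sup>2 + 1 / 20 * (V\<^sup>2 / 26)" using q(1) by (simp add: field_simps)
      finally show ?thesis by (simp add: power_mult_distrib)
    qed
    moreover have "(103 / 100 * (q * T) + 46 / 1000 * V)\<^sup>2
        = 10609 / 10000 * (q * T)\<^sup>2 + 529 / 250000 * V\<^sup>2 + 2369 / 25000 * ((q * T) * V)"
      by (simp add: power2_eq_square algebra_simps)
    moreover have "0 \<le> (q * T) * V" "0 \<le> (q * T)\<^sup>2" "0 \<le> V\<^sup>2" using q nn V by auto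
    ultimately show "(q * coeff_norm J v)\<^sup>2 \<le> (103 / 100 * (q * T) + 46 / 1000 * V)\<^sup>2"
      by argo
  qed (use q nn V in auto)
  have "V1 \<le> q * coeff_norm K v"
    unfolding V1_def q_def by (rule sum_norm_le_card[OF fK K(2)])
  also have "\<dots> \<le> q * coeff_norm J v" using q J K by (intro mult_left_mono coeff_norm_mono_set) auto
  finally have V1: "V1 \<le> q * coeff_norm J v" .
  have "V \<le> 12 * \<sigma> + 12 * (q * \<eta>)" "q * coeff_norm J v \<le> 12 * \<sigma> + 12 * (q * \<eta>)"
    using V1 l2 opt nn V q mult_nonneg_nonneg[of q T] mult_nonneg_nonneg[of q \<eta>] by linarith+
  then show "(\<Sum>j\<in>J. cmod (r j - x j)) \<le> 12 * (\<sigma> + sqrt n * \<eta>)"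
    "sqrt n * coeff_norm J (\<lambda>j. r j - x j) \<le> 12 * (\<sigma> + sqrt n * \<eta>)"
    by (simp_all add: V_def v_def[abs_def] q_def)
qed

definition adj_vec :: "nat \<Rightarrow> (nat \<Rightarrow> 'i \<Rightarrow> complex) \<Rightarrow> (nat \<Rightarrow> complex) \<Rightarrow> 'i \<Rightarrow> complex" where
  "adj_vec m A u j = (\<Sum>l<m. cnj (A l j) * u l)"

lemma correlation_eq: "correlation J m A y p j = cmod (adj_vec m A (\<lambda>l. y l - mat_vec J A p l) j)"
  by (simp add: correlation_def adj_vec_def residual_def mat_vec_def)

lemma vec_norm_sq_diff:
  "(vec_norm m (\<lambda>l. u l - mat_vec J A z l))\<^sup>2 =
     (vec_norm m u)\<^sup>2 - 2 * Re (\<Sum>j\<in>J. cnj (z j) * adj_vec m A u j) + (vec_norm m (mat_vec J A z))\<^sup>2"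
proof -
  have "(cmod (a - b))\<^sup>2 = (cmod a)\<^sup>2 - 2 * Re (cnj b * a) + (cmod b)\<^sup>2" for a b
    unfolding cmod_power2 by (simp add: power2_eq_square algebra_simps)
  then have "(vec_norm m (\<lambda>l. u l - mat_vec J A z l))\<^sup>2 =
     (vec_norm m u)\<^sup>2 - 2 * Re (\<Sum>l<m. cnj (mat_vec J A z l) * u l) + (vec_norm m (mat_vec J A z))\<^sup>2"
    by (simp add: vec_norm_sq sum.distrib sum_subtractf sum_distrib_left)
  moreover have "(\<Sum>l<m. cnj (mat_vec J A z l) * u l) = (\<Sum>j\<in>J. cnj (z j) * adj_vec m A u j)"
    unfolding mat_vec_def adj_vec_def sum_distrib_left cnj_sum sum_distrib_right
    by (subst sum.swap) (simp add: mult_ac)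
  ultimately show ?thesis by simp
qed

subsection \<open>Least squares\<close>

text \<open>A Gram-Schmidt step in the induction on \<open>S\<close>: the new column minus its own
  least squares fit is a direction \<open>d\<close> orthogonal to the old columns, and the old
  residual is corrected along \<open>d\<close>. Linearly dependent columns are covered: then
  \<open>d\<close> vanishes on the sample indices and the division by zero sets \<open>t\<close> to
  0.\<close>

lemma normal_equations_solvable:
  assumes "finite S"
  shows "\<exists>z. \<forall>k\<in>S. adj_vec m A (\<lambda>l. y l - mat_vec S A z l) k = 0"
  using assms
proof (induction S arbitrary: y rule: finite_induct)
  case empty
  then show ?case by simp
next
  case (insert k S)
  obtain w where w: "\<forall>i\<in>S. adj_vec m A (\<lambda>l. A l k - mat_vec S A w l) i = 0"
    using insert.IH[of "\<lambda>l. A l k"] by blast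
  obtain z where z: "\<forall>i\<in>S. adj_vec m A (\<lambda>l. y l - mat_vec S A z l) i = 0"
    using insert.IH[of y] by blast
  define d where "d l = A l k - mat_vec S A w l" for l
  define r where "r l = y l - mat_vec S A z l" for l
  define ip where "ip u v = (\<Sum>l<m. cnj (v l) * u l)" for u v :: "nat \<Rightarrow> complex"
  define t where "t = ip r d / ip d d"
  define z' where "z' i = (if i = k then t else z i - t * w i)" for i
  have res: "y l - mat_vec (insert k S) A z' l = r l - t * d l" for l
  proof -
    have "(\<Sum>j\<in>S. A l j * z' j) = (\<Sum>j\<in>S. A l j * (z j - t * w j))"
      using insert by (intro sum.cong) (auto simp: z'_def)
    also have "\<dots> = (\<Sum>j\<in>S. A l j * z j) - t * (\<Sum>j\<in>S. A l j * w j)"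
      by (simp add: algebra_simps sum_subtractf sum_distrib_left)
    finally show ?thesis
      using insert by (simp add: mat_vec_def r_def d_def z'_def algebra_simps)
  qed
  have lin: "adj_vec m A (\<lambda>l. r l - t * d l) i = adj_vec m A r i - t * adj_vec m A d i" for i
    by (simp add: adj_vec_def sum_subtractf sum_distrib_left algebra_simps)
  have S: "adj_vec m A (\<lambda>l. r l - t * d l) i = 0" if "i \<in> S" for i
    unfolding lin using w z that by (simp add: d_def[abs_def] r_def[abs_def])
  have d0: "ip (\<lambda>l. r l - t * d l) d = 0"
  proof (cases "ip d d = 0")
    case True
    have "complex_of_real (\<Sum>l<m. (cmod (d l))\<^sup>2) = ip d d"
      by (simp add: ip_def complex_norm_square mult.commute del: of_real_power)
    then have "(\<Sum>l<m. (cmod (d l))\<^sup>2) = 0" using True by (metis of_real_eq_0_iff)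
    then have "d l = 0" if "l < m" for l using that by (simp add: sum_nonneg_eq_0_iff)
    then show ?thesis by (simp add: ip_def)
  next
    case False
    have "ip (\<lambda>l. r l - t * d l) d = ip r d - t * ip d d"
      by (simp add: ip_def sum_subtractf sum_distrib_left algebra_simps)
    then show ?thesis using False by (simp add: t_def)
  qed
  have "adj_vec m A u k = ip u d + (\<Sum>i\<in>S. cnj (w i) * adj_vec m A u i)" for u
  proof -
    have "ip u d = adj_vec m A u k - (\<Sum>l<m. cnj (mat_vec S A w l) * u l)"
      by (simp add: ip_def d_def adj_vec_def algebra_simps sum_subtractf)
    moreover have "(\<Sum>l<m. cnj (mat_vec S A w l) * u l) = (\<Sum>i\<in>S. cnj (w i) * adj_vec m A u i)"
      unfolding mat_vec_def adj_vec_def sum_distrib_left cnj_sum sum_distrib_right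
      by (subst sum.swap) (simp add: mult_ac)
    ultimately show ?thesis by simp
  qed
  then have "adj_vec m A (\<lambda>l. r l - t * d l) k = 0" using S d0 by simp
  then have "\<forall>i\<in>insert k S. adj_vec m A (\<lambda>l. y l - mat_vec (insert k S) A z' l) i = 0"
    unfolding res using S by blast
  then show ?case by blast
qed

definition least_squares ::
    "'i set \<Rightarrow> nat \<Rightarrow> (nat \<Rightarrow> 'i \<Rightarrow> complex) \<Rightarrow> (nat \<Rightarrow> complex) \<Rightarrow> 'i set \<Rightarrow> ('i \<Rightarrow> complex) \<Rightarrow> bool" where
  "least_squares J m A y S p \<longleftrightarrow> p \<in> coeff_vectors S \<and>
     (\<forall>k\<in>S. adj_vec m A (\<lambda>l. y l - mat_vec J A p l) k = 0)"

lemma least_squares_pythagoras: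
  assumes "least_squares J m A y S p" "z \<in> coeff_vectors S"
  shows "(vec_norm m (\<lambda>l. y l - mat_vec J A z l))\<^sup>2 =
    (vec_norm m (\<lambda>l. y l - mat_vec J A p l))\<^sup>2 + (vec_norm m (mat_vec J A (\<lambda>j. z j - p j)))\<^sup>2"
proof -
  let ?u = "\<lambda>l. y l - mat_vec J A p l"
  have "cnj (z j - p j) * adj_vec m A ?u j = 0" for j
    using assms by (cases "j \<in> S") (auto simp: least_squares_def coeff_vectors_def)
  then have "(\<Sum>j\<in>J. cnj (z j - p j) * adj_vec m A ?u j) = 0" by (intro sum.neutral) auto
  moreover have "(\<lambda>l. ?u l - mat_vec J A (\<lambda>j. z j - p j) l) = (\<lambda>l. y l - mat_vec J A z l)"
    by (simp add: mat_vec_diff)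
  ultimately show ?thesis
    using vec_norm_sq_diff[of m ?u J A "\<lambda>j. z j - p j"] by simp
qed

lemma least_squares_le:
  assumes "least_squares J m A y S p" "z \<in> coeff_vectors S"
  shows "vec_norm m (\<lambda>l. y l - mat_vec J A p l) \<le> vec_norm m (\<lambda>l. y l - mat_vec J A z l)"
  by (rule power2_le_imp_le) (use least_squares_pythagoras[OF assms] in auto)

text \<open>\<open>arg_min\<close> is a mere choice, so a minimizer must be exhibited: a solution of
  the normal equations. By Pythagoras any other minimizer has the same image under the matrix, hence
  the same residual, and satisfies the normal equations as well.\<close>

lemma least_squares_arg_min:
  assumes J: "finite J" "S \<subseteq> J"
  shows "least_squares J m A y S (arg_min (residual_norm J m A y) (\<lambda>z. z \<in> coeff_vectors S))"
proof -
  have "finite S" using J finite_subset by auto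
  then obtain z0 where z0: "\<forall>k\<in>S. adj_vec m A (\<lambda>l. y l - mat_vec S A z0 l) k = 0"
    using normal_equations_solvable by blast
  define z where "z j = (if j \<in> S then z0 j else 0)" for j
  have zS: "z \<in> coeff_vectors S" by (auto simp: z_def coeff_vectors_def)
  have "mat_vec J A z l = mat_vec S A z0 l" for l
    unfolding mat_vec_supp[OF J zS] unfolding mat_vec_def by (intro sum.cong) (auto simp: z_def)
  then have z: "least_squares J m A y S z" using z0 zS by (simp add: least_squares_def)
  define p where "p = arg_min (residual_norm J m A y) (\<lambda>z. z \<in> coeff_vectors S)"
  have "is_arg_min (residual_norm J m A y) (\<lambda>z. z \<in> coeff_vectors S) z"
    unfolding is_arg_min_linorder residual_norm_eq using zS least_squares_le[OF z] by blast
  then have "is_arg_min (residual_norm J m A y) (\<lambda>z. z \<in> coeff_vectors S) p"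
    unfolding p_def arg_min_def 
    by (rule someI[where P = "is_arg_min (residual_norm J m A y) (\<lambda>z. z \<in> coeff_vectors S)"])
  then have pS: "p \<in> coeff_vectors S" and "residual_norm J m A y p \<le> residual_norm J m A y z"
    unfolding is_arg_min_linorder using zS by auto
  then have "(vec_norm m (\<lambda>l. y l - mat_vec J A p l))\<^sup>2 \<le> (vec_norm m (\<lambda>l. y l - mat_vec J A z l))\<^sup>2"
    unfolding residual_norm_eq by (intro power_mono) auto
  then have "(vec_norm m (mat_vec J A (\<lambda>j. p j - z j)))\<^sup>2 \<le> 0"
    using least_squares_pythagoras[OF z pS] by simp
  then have "mat_vec J A (\<lambda>j. p j - z j) l = 0" if "l < m" for l
    using that by (simp add: vec_norm_sq sum_nonneg_eq_0_iff sum_nonneg order_antisym_conv)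
  then have "mat_vec J A p l = mat_vec J A z l" if "l < m" for l
    using that by (simp add: mat_vec_diff)
  then have "adj_vec m A (\<lambda>l. y l - mat_vec J A p l) k = adj_vec m A (\<lambda>l. y l - mat_vec J A z l) k" for k
    unfolding adj_vec_def by (intro sum.cong) auto
  then show ?thesis using z pS unfolding p_def[symmetric] by (simp add: least_squares_def)
qed

subsection \<open>Decreasing enumerations\<close>

lemma decreasing_enumeration:
  fixes w :: "'i \<Rightarrow> real"
  assumes "finite T"
  shows "\<exists>f. bij_betw f {..<card T} T \<and> (\<forall>i j. i \<le> j \<longrightarrow> j < card T \<longrightarrow> w (f j) \<le> w (f i))"
proof -
  obtain xs where xs: "set xs = T" "distinct xs" using assms finite_distinct_list by blast
  define ys where "ys = sort_key (\<lambda>x. - w x) xs"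
  have ys: "set ys = T" "distinct ys" "sorted (map (\<lambda>x. - w x) ys)" using xs by (simp_all add: ys_def)
  have len: "length ys = card T" using ys distinct_card by fastforce
  have "bij_betw (\<lambda>i. ys ! i) {..<card T} T"
    by (rule bij_betw_nth[OF ys(2)]) (simp_all only: len ys(1))
  moreover have "w (ys ! j) \<le> w (ys ! i)" if "i \<le> j" "j < card T" for i j
  proof -
    have "map (\<lambda>x. - w x) ys ! i \<le> map (\<lambda>x. - w x) ys ! j"
      using that len by (intro sorted_nth_mono[OF ys(3)]) auto
    then show ?thesis using that len by simp
  qed
  ultimately show ?thesis by blast
qed

text \<open>Exchange argument with pivot \<open>w (f g)\<close>: indices of the tail weigh at most
  the pivot, indices of \<open>Q\<close> outside the tail at least the pivot, and the latter are no
  fewer than the tail indices outside \<open>Q\<close>.\<close>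

lemma sum_tail_le:
  fixes w :: "'i \<Rightarrow> real"
  assumes f: "bij_betw f {..<d} T" and dec: "\<And>i j. i \<le> j \<Longrightarrow> j < d \<Longrightarrow> w (f j) \<le> w (f i)"
    and T: "finite T" and Q: "Q \<subseteq> T" "d - g \<le> card Q" and w: "\<And>i. 0 \<le> w i"
  shows "(\<Sum>i\<in>{g..<d}. w (f i)) \<le> sum w Q"
proof (cases "g < d")
  case False
  then show ?thesis using w by (simp add: sum_nonneg)
next
  case True
  define H where "H = f ` {g..<d}"
  have inj: "inj_on f {..<d}" and im: "f ` {..<d} = T" using f by (auto simp: bij_betw_def)
  have injH: "inj_on f {g..<d}" using inj by (rule inj_on_subset) auto
  have fin: "finite H" "finite Q" using T Q finite_subset by (auto simp: H_def)
  have cH: "card H = d - g" unfolding H_def using injH by (simp add: card_image)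
  have "card (H - Q) = card H - card (H \<inter> Q)" "card (Q - H) = card Q - card (H \<inter> Q)"
    using fin by (simp_all add: card_Diff_subset_Int Int_commute)
  then have cc: "card (H - Q) \<le> card (Q - H)" using cH Q by simp
  have lo: "w (f g) \<le> w q" if "q \<in> Q - H" for q
  proof -
    have "q \<in> f ` {..<d}" using that Q im by blast
    then obtain i where "i < d" "q = f i" by blast
    moreover have "i < g" using that calculation by (auto simp: H_def not_less)
    ultimately show ?thesis using dec[of i g] True by simp
  qed
  have hi: "w q \<le> w (f g)" if "q \<in> H - Q" for q
    using that dec[of g] by (auto simp: H_def)
  have "sum w (H - Q) \<le> card (H - Q) * w (f g)" using hi sum_bounded_above[of "H - Q" w "w (f g)"] by simp
  also have "\<dots> \<le> card (Q - H) * w (f g)" using cc w by (intro mult_right_mono) auto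
  also have "\<dots> \<le> sum w (Q - H)" using lo sum_bounded_below[of "Q - H" "w (f g)" w] by simp
  finally have "sum w (H - Q) \<le> sum w (Q - H)" .
  moreover have "sum w H = sum w (H - Q) + sum w (H \<inter> Q)" "sum w Q = sum w (Q - H) + sum w (H \<inter> Q)"
    using fin by (simp_all add: sum.Int_Diff[of H w Q] sum.Int_Diff[of Q w H] Int_commute)
  moreover have "(\<Sum>i\<in>{g..<d}. w (f i)) = sum w H"
    unfolding H_def using injH by (simp add: sum.reindex)
  ultimately show ?thesis by simp
qed

lemma omp_index_maximal:
  assumes J: "finite J" "J \<noteq> {}" and e: "bij_betw e {..<card J} J"
  shows "omp_index e J m A y p \<in> J"
    and "j \<in> J \<Longrightarrow> correlation J m A y p j \<le> correlation J m A y p (omp_index e J m A y p)"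
proof -
  let ?c = "correlation J m A y p"
  have "Max (?c ` J) \<in> ?c ` J" using J by (intro Max_in) auto
  then obtain i where i: "i \<in> J" "Max (?c ` J) = ?c i" by (rule imageE)
  have "\<forall>j\<in>J. ?c j \<le> ?c i" unfolding i(2)[symmetric] using J by (auto intro!: Max_ge)
  moreover obtain k where "k < card J" "i = e k"
    using e i(1) unfolding bij_betw_def by (metis imageE lessThan_iff)
  ultimately have "\<exists>k. k < card J \<and> (\<forall>j\<in>J. ?c j \<le> ?c (e k))" by blast
  from LeastI_ex[OF this] show "omp_index e J m A y p \<in> J"
    "j \<in> J \<Longrightarrow> ?c j \<le> ?c (omp_index e J m A y p)"
    using e unfolding omp_index_def bij_betw_def by auto
qed

lemma add_square_le:
  fixes a b c :: real
  assumes "0 < c"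
  shows "(a + b)\<^sup>2 \<le> (1 + 1 / c) * a\<^sup>2 + (1 + c) * b\<^sup>2"
proof -
  have "0 \<le> (a - c * b)\<^sup>2 / c" using assms by simp
  also have "\<dots> = 1 / c * a\<^sup>2 - 2 * (a * b) + c * b\<^sup>2"
    using assms by (simp add: power2_eq_square field_simps)
  finally show ?thesis by (simp add: power2_sum algebra_simps)
qed

section \<open>Energy decay in orthogonal matching pursuit\<close>

locale omp_run =
  fixes J :: "'i set" and m n :: nat and A :: "nat \<Rightarrow> 'i \<Rightarrow> complex" and e :: "nat \<Rightarrow> 'i" and y :: "nat \<Rightarrow> complex"
  assumes J: "finite J" "J \<noteq> {}" and e: "bij_betw e {..<card J} J"
    and n: "1 \<le> n" and ni: "near_isometry J m A (26 * real n)"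
begin

definition supp :: "nat \<Rightarrow> 'i set" where "supp i = fst (omp e J m A y i)"
definition iter :: "nat \<Rightarrow> 'i \<Rightarrow> complex" where "iter i = snd (omp e J m A y i)"
definition res :: "nat \<Rightarrow> nat \<Rightarrow> complex" where "res i l = y l - mat_vec J A (iter i) l"
definition energy :: "nat \<Rightarrow> real" where "energy i = (vec_norm m (res i))\<^sup>2"
definition pick :: "nat \<Rightarrow> 'i" where "pick i = omp_index e J m A y (iter i)"

lemma supp_0 [simp]: "supp 0 = {}" and iter_0 [simp]: "iter 0 = (\<lambda>_. 0)"
  by (simp_all add: supp_def iter_def)

lemma supp_Suc: "supp (Suc i) = insert (pick i) (supp i)"
  and iter_Suc: "iter (Suc i) = arg_min (residual_norm J m A y) (\<lambda>z. z \<in> coeff_vectors (supp (Suc i)))"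
  by (simp_all add: supp_def iter_def pick_def Let_def split: prod.split)

lemma pick_in: "pick i \<in> J"
  unfolding pick_def by (rule omp_index_maximal[OF J e])

lemma supp_subset: "supp i \<subseteq> J"
  using pick_in by (induction i) (auto simp: supp_Suc)

lemma finite_supp [simp]: "finite (supp i)"
  using supp_subset J finite_subset by blast

lemma card_supp: "card (supp i) \<le> i"
  by (induction i) (auto simp: supp_Suc card_insert_if)

lemma supp_mono: "i \<le> i' \<Longrightarrow> supp i \<subseteq> supp i'"
  by (rule lift_Suc_mono_le[of supp]) (auto simp: supp_Suc)

lemma least_squares_iter: "least_squares J m A y (supp i) (iter i)"
proof (cases i)
  case 0
  then show ?thesis by (simp add: least_squares_def coeff_vectors_def)
next
  case (Suc i')
  then show ?thesis using least_squares_arg_min[OF J(1) supp_subset] iter_Suc by metis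
qed

lemma iter_coeff: "iter i \<in> coeff_vectors (supp i)"
  using least_squares_iter by (simp add: least_squares_def)

lemma energy_le: "z \<in> coeff_vectors (supp i) \<Longrightarrow> energy i \<le> (vec_norm m (\<lambda>l. y l - mat_vec J A z l))\<^sup>2"
  unfolding energy_def res_def using least_squares_le[OF least_squares_iter]
  by (intro power_mono) auto

lemma energy_nonneg: "0 \<le> energy i"
  by (simp add: energy_def)

lemma energy_antimono: "i \<le> i' \<Longrightarrow> energy i' \<le> energy i"
  using iter_coeff[of i] supp_mono[of i i'] energy_le[of "iter i" i']
  by (auto simp: coeff_vectors_def energy_def[of i] res_def[abs_def] subset_iff)

lemma adj_vec_res_supp: "j \<in> supp i \<Longrightarrow> adj_vec m A (res i) j = 0"
  using least_squares_iter[of i] by (simp add: least_squares_def res_def[abs_def])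

definition gain :: "nat \<Rightarrow> real" where "gain i = cmod (adj_vec m A (res i) (pick i))"

lemma gain_ge: "j \<in> J \<Longrightarrow> cmod (adj_vec m A (res i) j) \<le> gain i"
  using omp_index_maximal(2)[OF J e, of j m A y "iter i"]
  unfolding gain_def pick_def correlation_eq res_def[abs_def] .

text \<open>The new least squares residual is no larger than after a move along the selected column
  alone. The squared norm of a column is at most 11/10, and 10/11 is the optimal step for that
  bound.\<close>

lemma energy_Suc: "energy (Suc i) \<le> energy i - 10 / 11 * (gain i)\<^sup>2"
proof -
  define c where "c = adj_vec m A (res i) (pick i)"
  define d where "d j = (if j = pick i then 10 / 11 * c else 0)" for j
  have d: "d \<in> coeff_vectors {pick i}" by (auto simp: d_def coeff_vectors_def)
  have "(\<lambda>j. iter i j + d j) \<in> coeff_vectors (supp (Suc i))"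
    using iter_coeff[of i] d by (auto simp: coeff_vectors_def supp_Suc)
  then have "energy (Suc i) \<le> (vec_norm m (\<lambda>l. y l - mat_vec J A (\<lambda>j. iter i j + d j) l))\<^sup>2"
    by (rule energy_le)
  also have "(\<lambda>l. y l - mat_vec J A (\<lambda>j. iter i j + d j) l) = (\<lambda>l. res i l - mat_vec J A d l)"
    by (simp add: res_def mat_vec_def distrib_left sum.distrib diff_diff_eq)
  also have "(vec_norm m (\<lambda>l. res i l - mat_vec J A d l))\<^sup>2 =
     energy i - 2 * Re (\<Sum>j\<in>J. cnj (d j) * adj_vec m A (res i) j) + (vec_norm m (mat_vec J A d))\<^sup>2"
    unfolding energy_def by (rule vec_norm_sq_diff)
  also have "(\<Sum>j\<in>J. cnj (d j) * adj_vec m A (res i) j) = cnj (10 / 11 * c) * c"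
  proof -
    have "(\<Sum>j\<in>J. cnj (d j) * adj_vec m A (res i) j) = (\<Sum>j\<in>{pick i}. cnj (d j) * adj_vec m A (res i) j)"
      using J pick_in by (intro sum.mono_neutral_right) (auto simp: d_def)
    then show ?thesis by (simp add: d_def c_def)
  qed
  also have "Re (cnj (10 / 11 * c) * c) = 10 / 11 * (gain i)\<^sup>2"
    unfolding gain_def c_def[symmetric] cmod_power2 by (simp add: power2_eq_square algebra_simps)
  finally have 1: "energy (Suc i) \<le> energy i - 2 * (10 / 11 * (gain i)\<^sup>2) + (vec_norm m (mat_vec J A d))\<^sup>2" .
  have "(vec_norm m (mat_vec J A d))\<^sup>2 \<le> 11 / 10 * (coeff_norm J d)\<^sup>2"
    by (rule near_isometry_sparse(2)[OF ni J(1), of "{pick i}" 1]) (use pick_in n d in auto)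
  also have "(coeff_norm J d)\<^sup>2 = (\<Sum>j\<in>{pick i}. (cmod (d j))\<^sup>2)"
    unfolding coeff_norm_sq using J pick_in by (intro sum.mono_neutral_right) (auto simp: d_def)
  also have "\<dots> = 100 / 121 * (gain i)\<^sup>2"
    by (simp add: d_def gain_def c_def[symmetric] norm_mult power_mult_distrib norm_divide power_divide)
  finally show ?thesis using 1 by argo
qed

text \<open>A residual well above that of a competitor \<open>u\<close> forces a large correlation.
  The residual is orthogonal to the columns already selected, so only the at most \<open>k\<close>
  indices of \<open>U\<close> outside the support contribute to the inner product.\<close>

lemma energy_excess_le:
  assumes U: "U \<subseteq> J" "card (supp i \<union> U) \<le> 26 * n" "card (U - supp i) \<le> k"
    and u: "u \<in> coeff_vectors U"
  shows "energy i - (vec_norm m (\<lambda>l. y l - mat_vec J A u l))\<^sup>2 \<le> 10 / 9 * (k * (gain i)\<^sup>2)"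
proof -
  define d where "d j = u j - iter i j" for j
  define D where "D = coeff_norm J d"
  have d: "d \<in> coeff_vectors (supp i \<union> U)"
    using u iter_coeff[of i] by (auto simp: d_def coeff_vectors_def)
  have "(\<lambda>l. y l - mat_vec J A u l) = (\<lambda>l. res i l - mat_vec J A d l)"
    by (simp add: res_def d_def[abs_def] mat_vec_diff)
  then have 1: "(vec_norm m (\<lambda>l. y l - mat_vec J A u l))\<^sup>2 =
     energy i - 2 * Re (\<Sum>j\<in>J. cnj (d j) * adj_vec m A (res i) j) + (vec_norm m (mat_vec J A d))\<^sup>2"
    unfolding energy_def by (simp only: vec_norm_sq_diff)
  have 2: "9 / 10 * D\<^sup>2 \<le> (vec_norm m (mat_vec J A d))\<^sup>2"
    unfolding D_def by (rule near_isometry_sparse(1)[OF ni J(1) _ U(2) _ _ d]) (use U supp_subset n in auto)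
  have fU: "finite (U - supp i)" using U J finite_subset by blast
  have "(\<Sum>j\<in>J. cnj (d j) * adj_vec m A (res i) j) = (\<Sum>j\<in>U - supp i. cnj (d j) * adj_vec m A (res i) j)"
    using J U d adj_vec_res_supp by (intro sum.mono_neutral_right) (auto simp: coeff_vectors_def)
  then have "Re (\<Sum>j\<in>J. cnj (d j) * adj_vec m A (res i) j) \<le> cmod (\<Sum>j\<in>U - supp i. cnj (d j) * adj_vec m A (res i) j)"
    by (simp only: complex_Re_le_cmod)
  also have "\<dots> \<le> (\<Sum>j\<in>U - supp i. gain i * cmod (d j))"
    using U gain_ge by (intro sum_norm_le) (auto simp: norm_mult mult.commute[of "gain i"] intro!: mult_left_mono)
  also have "\<dots> \<le> gain i * (sqrt k * coeff_norm (U - supp i) d)"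
    unfolding sum_distrib_left[symmetric]
    by (intro mult_left_mono sum_norm_le_card fU U) (simp add: gain_def)
  also have "\<dots> \<le> gain i * (sqrt k * D)"
    unfolding D_def using J U by (intro mult_left_mono coeff_norm_mono_set) (auto simp: gain_def)
  finally have 3: "Re (\<Sum>j\<in>J. cnj (d j) * adj_vec m A (res i) j) \<le> gain i * (sqrt k * D)" .
  \<comment> \<open>This square eliminates the unknown distance \<open>D\<close>; it vanishes where
    the upper bound for the excess is maximal.\<close>
  have "0 \<le> (gain i * sqrt k - 9 / 10 * D)\<^sup>2" by simp
  also have "\<dots> = k * (gain i)\<^sup>2 - 9 / 5 * (gain i * (sqrt k * D)) + 81 / 100 * D\<^sup>2"
    by (simp add: power2_diff power_mult_distrib) (simp add: power2_eq_square)
  finally have "2 * (gain i * (sqrt k * D)) - 9 / 10 * D\<^sup>2 \<le> 10 / 9 * (k * (gain i)\<^sup>2)" by argo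
  then show ?thesis using 1 2 3 by argo
qed

text \<open>Gain and excess combine to a contraction of the excess by 1 - 9 / (11 k) in each step.
  As exp (9/11) > 2, every \<open>k\<close> steps halve it. The limit of 24 n steps keeps the union
  of the support with \<open>U\<close> within 26 n indices.\<close>

lemma energy_phase:
  assumes U: "U \<subseteq> J" "card U \<le> 2 * n" and k: "1 \<le> k" "card (U - supp i) \<le> k"
    and u: "u \<in> coeff_vectors U" and i: "i + 3 * k \<le> 24 * n"
  shows "energy (i + 3 * k) \<le> (vec_norm m (\<lambda>l. y l - mat_vec J A u l))\<^sup>2 + 1 / 8 * energy i"
proof -
  define b where "b = (vec_norm m (\<lambda>l. y l - mat_vec J A u l))\<^sup>2"
  define \<theta> where "\<theta> = 1 - 9 / (11 * real k)"
  have \<theta>: "0 \<le> \<theta>" using k by (simp add: \<theta>_def divide_le_eq)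
  have step: "energy (Suc i') - b \<le> \<theta> * (energy i' - b)" if "i \<le> i'" "i' < i + 3 * k" for i'
  proof -
    have "card (supp i' \<union> U) \<le> card (supp i') + card U" by (rule card_Un_le)
    then have 1: "card (supp i' \<union> U) \<le> 26 * n" using card_supp[of i'] U that i by linarith
    have "finite (U - supp i)" using U J finite_subset by blast
    then have "card (U - supp i') \<le> card (U - supp i)"
      using supp_mono[OF that(1)] by (intro card_mono) auto
    then have "energy i' - b \<le> 10 / 9 * (k * (gain i')\<^sup>2)"
      unfolding b_def using k by (intro energy_excess_le[OF U(1) 1 _ u]) auto
    then have "9 / (11 * k) * (energy i' - b) \<le> 9 / (11 * k) * (10 / 9 * (k * (gain i')\<^sup>2))"
      by (intro mult_left_mono) auto
    also have "\<dots> = 10 / 11 * (gain i')\<^sup>2" using k by simp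
    finally have "9 / (11 * k) * (energy i' - b) \<le> 10 / 11 * (gain i')\<^sup>2" .
    moreover have "\<theta> * (energy i' - b) = (energy i' - b) - 9 / (11 * k) * (energy i' - b)"
      unfolding \<theta>_def by (simp only: left_diff_distrib mult_1)
    ultimately show ?thesis using energy_Suc[of i'] by linarith
  qed
  have it: "energy (i + t) - b \<le> \<theta> ^ t * max (energy i - b) 0" if "t \<le> 3 * k" for t
    using that
  proof (induction t)
    case (Suc t)
    have "energy (i + Suc t) - b \<le> \<theta> * (energy (i + t) - b)" using step[of "i + t"] Suc.prems by simp
    also have "\<dots> \<le> \<theta> * (\<theta> ^ t * max (energy i - b) 0)" using Suc \<theta> by (intro mult_left_mono) auto
    finally show ?case by (simp add: mult_ac)
  qed simp
  have "\<theta> ^ k \<le> 1 / 2"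
  proof -
    have "\<theta> \<le> exp (- (9 / (11 * real k)))" unfolding \<theta>_def using exp_ge_add_one_self[of "- (9 / (11 * real k))"] by simp
    then have "\<theta> ^ k \<le> exp (- (9 / (11 * real k))) ^ k" using \<theta> by (rule power_mono)
    also have "\<dots> = exp (real k * - (9 / (11 * real k)))" by (simp only: exp_of_nat_mult)
    also have "real k * - (9 / (11 * real k)) = - (9 / 11)" using k by simp
    also have "exp (- (9 / 11 :: real)) = inverse (exp (9 / 11))" by (rule exp_minus)
    also have "\<dots> \<le> inverse 2"
      using exp_lower_Taylor_quadratic[of "9 / 11"] by (intro le_imp_inverse_le) (auto simp: power2_eq_square)
    finally show ?thesis by simp
  qed
  then have "(\<theta> ^ k) ^ 3 \<le> (1 / 2) ^ 3" using \<theta> by (intro power_mono) auto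
  then have "\<theta> ^ (3 * k) \<le> 1 / 8" by (simp add: power_mult[symmetric] mult.commute power_divide)
  then have "\<theta> ^ (3 * k) * max (energy i - b) 0 \<le> 1 / 8 * max (energy i - b) 0" by (intro mult_right_mono) auto
  then have "energy (i + 3 * k) \<le> b + 1 / 8 * max (energy i - b) 0" using it[of "3 * k"] by simp
  also have "\<dots> \<le> b + 1 / 8 * energy i"
    using energy_nonneg by (intro add_left_mono mult_left_mono) (auto simp: b_def)
  finally show ?thesis unfolding b_def .
qed

text \<open>Induction on the number of missing indices, with a budget of 12 steps for each.
  \<open>W j\<close> is the energy of the missing coefficients outside the \<open>g j\<close>
  largest, and \<open>L\<close> is the first \<open>j\<close> at which it drops by a factor of at
  least 4. Before \<open>L\<close> the factor 1/8 of a phase outpaces this decay, so the residual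
  energy remains comparable with \<open>W j\<close>, up to noise.\<close>

lemma energy_bound_from:
  assumes y: "\<And>l. l < m \<Longrightarrow> y l = mat_vec J A x l + \<epsilon> l"
    and S: "S \<subseteq> J" "card S \<le> 2 * n" and x: "x \<in> coeff_vectors S"
    and miss: "card (S - supp i) \<le> d" and i: "i + 12 * d \<le> 24 * n"
  shows "energy (i + 12 * d) \<le> 100 * (vec_norm m \<epsilon>)\<^sup>2"
  using miss i
proof (induction d arbitrary: i rule: less_induct)
  case (less d i)
  define \<nu> where "\<nu> = vec_norm m \<epsilon>"
  define T where "T = S - supp i"
  have finS: "finite S" using S J finite_subset by blast
  then have finT: "finite T" by (simp add: T_def)
  show ?case
  proof (cases "card T < d")
    case True
    then have "energy (i + 12 * card T) \<le> 100 * \<nu>\<^sup>2"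
      unfolding \<nu>_def using less.prems by (intro less.IH) (auto simp: T_def)
    moreover have "energy (i + 12 * d) \<le> energy (i + 12 * card T)"
      using True by (intro energy_antimono) simp
    ultimately show ?thesis by (simp add: \<nu>_def)
  next
    case False
    then have cT: "card T = d" using less.prems by (simp add: T_def)
    define w where "w j = (cmod (x j))\<^sup>2" for j
    obtain f where f: "bij_betw f {..<d} T" and dec: "\<And>i j. i \<le> j \<Longrightarrow> j < d \<Longrightarrow> w (f j) \<le> w (f i)"
      using decreasing_enumeration[OF finT, of w] unfolding cT by blast
    have injf: "inj_on f {..<d}" and imf: "f ` {..<d} = T" using f by (auto simp: bij_betw_def)
    define tail where "tail k = (\<Sum>i\<in>{k..<d}. w (f i))" for k
    define top where "top k = f ` {..<min k d}" for k
    define approx where "approx k j = (if j \<in> S \<inter> supp i \<union> top k then x j else 0)" for k j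
    have top: "top k \<subseteq> T" "card (top k) \<le> k" for k
    proof -
      show "top k \<subseteq> T" unfolding top_def using imf by auto
      show "card (top k) \<le> k" unfolding top_def
        by (rule order_trans[OF card_image_le]) auto
    qed
    have tail0: "0 \<le> tail k" for k by (simp add: tail_def w_def sum_nonneg)
    have dist: "(vec_norm m (\<lambda>l. y l - mat_vec J A (approx k) l))\<^sup>2 \<le> 6 / 5 * tail k + 12 * \<nu>\<^sup>2" for k
    proof -
      define v where "v j = x j - approx k j" for j
      have vS: "v \<in> coeff_vectors S" using x by (auto simp: v_def approx_def coeff_vectors_def)
      have v: "v j = (if j \<in> f ` {k..<d} then x j else 0)" for j
      proof -
        have "j \<in> f ` {k..<d} \<longleftrightarrow> j \<in> T \<and> j \<notin> top k"
        proof -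
          have "f ` {k..<d} = f ` ({..<d} - {..<min k d})" by (intro arg_cong[where f = "(`) f"]) auto
          also have "\<dots> = T - top k"
            unfolding top_def imf[symmetric] using injf by (intro inj_on_image_set_diff) auto
          finally show ?thesis by simp
        qed
        then show ?thesis using x by (auto simp: v_def approx_def T_def coeff_vectors_def)
      qed
      have "(coeff_norm J v)\<^sup>2 = (\<Sum>j\<in>f ` {k..<d}. w j)"
      proof -
        have "f ` {k..<d} \<subseteq> J" using imf S by (auto simp: T_def)
        then show ?thesis
          unfolding coeff_norm_sq w_def using J by (intro sum.mono_neutral_cong_right) (auto simp: v)
      qed
      also have "\<dots> = tail k"
        unfolding tail_def using injf by (subst sum.reindex) (auto intro: inj_on_subset)
      finally have "(coeff_norm J v)\<^sup>2 = tail k" .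
      then have Av: "(vec_norm m (mat_vec J A v))\<^sup>2 \<le> 11 / 10 * tail k"
        using near_isometry_sparse(2)[OF ni J(1) S(1) S(2) _ _ vS] n by simp
      have "vec_norm m (\<lambda>l. y l - mat_vec J A (approx k) l) = vec_norm m (\<lambda>l. mat_vec J A v l + \<epsilon> l)"
        by (intro vec_norm_cong) (simp add: y v_def[abs_def] mat_vec_diff)
      also have "\<dots> \<le> vec_norm m (mat_vec J A v) + \<nu>" unfolding \<nu>_def by (rule vec_norm_triangle)
      finally have "(vec_norm m (\<lambda>l. y l - mat_vec J A (approx k) l))\<^sup>2 \<le> (vec_norm m (mat_vec J A v) + \<nu>)\<^sup>2"
        by (intro power_mono) auto
      also have "\<dots> \<le> 12 / 11 * (vec_norm m (mat_vec J A v))\<^sup>2 + 12 * \<nu>\<^sup>2"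
        using add_square_le[of 11 "vec_norm m (mat_vec J A v)" \<nu>] by simp
      finally show ?thesis using Av by argo
    qed
    have approx_supp: "approx k \<in> coeff_vectors (S \<inter> supp i \<union> top k)" for k
      by (simp add: approx_def coeff_vectors_def)
    \<comment> \<open>The values are 0, 1, 2, 4, ...; the leading 0 makes \<open>W 0\<close> the
      whole missing energy.\<close>
    define g :: "nat \<Rightarrow> nat" where "g j = (case j of 0 \<Rightarrow> 0 | Suc j' \<Rightarrow> 2 ^ j')" for j
    have gS: "g (Suc j) = 2 ^ j" and g0: "g 0 = 0" for j by (simp_all add: g_def)
    define W where "W j = tail (g j)" for j
    have "\<exists>j. W (Suc j) \<le> 1 / 4 * W j"
    proof -
      have "W (Suc d) = 0" unfolding W_def gS tail_def by (simp add: less_imp_le)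
      then show ?thesis using tail0 by (intro exI[of _ d]) (simp add: W_def)
    qed
    define L where "L = (LEAST j. W (Suc j) \<le> 1 / 4 * W j)"
    have L: "W (Suc L) \<le> 1 / 4 * W L"
      unfolding L_def by (rule LeastI_ex) fact
    have less_L: "W j < 4 * W (Suc j)" if "j < L" for j
      using not_less_Least[OF that[unfolded L_def]] by argo
    show ?thesis
    proof (cases "d = 0")
      case True
      then have "S \<subseteq> supp i" using cT finT by (simp add: T_def)
      then have "x \<in> coeff_vectors (supp i)" using x by (auto simp: coeff_vectors_def)
      then have "energy i \<le> (vec_norm m (\<lambda>l. y l - mat_vec J A x l))\<^sup>2" by (rule energy_le)
      also have "vec_norm m (\<lambda>l. y l - mat_vec J A x l) = \<nu>"
        unfolding \<nu>_def by (intro vec_norm_cong) (simp add: y)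
      also have "\<nu>\<^sup>2 \<le> 100 * \<nu>\<^sup>2" by simp
      finally show ?thesis using True by (simp add: \<nu>_def)
    next
      case False
      have gL: "g L < d"
      proof (cases L)
        case (Suc L')
        then have "W L' < 4 * W L" using less_L[of L'] by simp
        then have "0 < W L" using tail0[of "g L'"] by (simp add: W_def)
        then show ?thesis by (cases "g L < d") (auto simp: W_def tail_def)
      qed (use False in \<open>simp add: g0\<close>)
      \<comment> \<open>Phases 0 to \<open>L\<close> take 3 * (2^(L + 1) - 1) steps. For L > 0, g L
        = 2^(L - 1), so this is about 12 * g L, the origin of the 12. The summand 2 covers L =
        0.\<close>
      have twoL: "2 ^ (L + 1) \<le> 4 * g L + 2"
        by (cases L) (simp_all add: gS g0)
      \<comment> \<open>Phase \<open>j\<close> takes \<open>3 * 2 ^ j\<close> steps; its target has the \<open>2 ^ j\<close> largest missing coefficients added.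
        After phase \<open>L\<close> more than \<open>g L\<close> missing indices are found, or the energy is already small.\<close>
      define idx where "idx j = i + 3 * (2 ^ j - 1)" for j :: nat
      have idx0: "idx 0 = i" by (simp add: idx_def)
      have idxS: "idx (Suc j) = idx j + 3 * 2 ^ j" for j
      proof -
        have "(1::nat) \<le> 2 ^ j" by simp
        then show ?thesis unfolding idx_def power_Suc by arith
      qed
      have idx_le: "idx j \<le> i + 12 * g L + 3" if "j \<le> Suc L" for j
      proof -
        have "(2::nat) ^ j \<le> 2 ^ (L + 1)" using that by (intro power_increasing) auto
        then have "(2::nat) ^ j \<le> 4 * g L + 2" using twoL by linarith
        then show ?thesis unfolding idx_def by arith
      qed
      have phase: "energy (idx (Suc j)) \<le> 6 / 5 * W (Suc j) + 12 * \<nu>\<^sup>2 + 1 / 8 * energy (idx j)" if "j \<le> L" for j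
      proof -
        let ?U = "S \<inter> supp i \<union> top (2 ^ j)"
        have US: "?U \<subseteq> S" using top(1) by (auto simp: T_def)
        have "i \<le> idx j" by (simp add: idx_def)
        then have "?U - supp (idx j) \<subseteq> top (2 ^ j)" using supp_mono by blast
        then have "card (?U - supp (idx j)) \<le> card (top (2 ^ j))"
          using finT top(1) finite_subset by (intro card_mono) blast+
        then have 1: "card (?U - supp (idx j)) \<le> 2 ^ j" using top(2)[of "2 ^ j"] by linarith
        have 2: "card ?U \<le> 2 * n" using card_mono[OF finS US] S(2) by linarith
        have "idx j + 3 * 2 ^ j \<le> 24 * n"
          using idx_le[of "Suc j"] that gL less.prems(2) unfolding idxS by linarith
        then have "energy (idx j + 3 * 2 ^ j) \<le>
          (vec_norm m (\<lambda>l. y l - mat_vec J A (approx (2 ^ j)) l))\<^sup>2 + 1 / 8 * energy (idx j)"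
          using US S(1) 1 2 by (intro energy_phase[OF _ _ _ _ approx_supp]) auto
        then show ?thesis using dist[of "2 ^ j"] unfolding idxS W_def gS by linarith
      qed
      \<comment> \<open>W j < 4 * W (j + 1) turns the inherited 1/8 * 12/5 * W j into at most 6/5 *
        W (j + 1). With the 6/5 of the phase itself this restores 12/5.\<close>
      have induct: "energy (idx j) \<le> 12 / 5 * W j + 14 * \<nu>\<^sup>2" if "j \<le> L" for j
        using that
      proof (induction j)
        case 0
        have "approx 0 \<in> coeff_vectors (supp i)" by (auto simp: approx_def coeff_vectors_def top_def)
        then have "energy i \<le> (vec_norm m (\<lambda>l. y l - mat_vec J A (approx 0) l))\<^sup>2" by (rule energy_le)
        then show ?case using dist[of 0] tail0[of 0] zero_le_power2[of \<nu>] unfolding idx0 W_def g0 by linarith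
      next
        case (Suc j)
        then have "energy (idx j) \<le> 12 / 5 * W j + 14 * \<nu>\<^sup>2" "j < L" by simp_all
        then show ?case
          using phase[of j, OF less_imp_le] less_L[of j] zero_le_power2[of \<nu>] by argo
      qed
      define i' where "i' = idx (Suc L)"
      \<comment> \<open>In the last phase the tail does drop: 6/5 * 1/4 + 1/8 * 12/5 = 3/5.\<close>
      have fin: "energy i' \<le> 3 / 5 * W L + 14 * \<nu>\<^sup>2"
        using phase[OF order_refl] induct[OF order_refl] L zero_le_power2[of \<nu>] unfolding i'_def by argo
      have i'_ge: "i \<le> i'" by (simp add: i'_def idx_def)
      have i'_le: "i' \<le> i + 12 * g L + 3" unfolding i'_def by (rule idx_le) simp
      define d' where "d' = card (S - supp i')"
      show ?thesis
      proof (cases "d' + g L < d")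
        case True
        \<comment> \<open>The 3 surplus steps are covered because d' + g L is at most d - 1.\<close>
        then have "i' + 12 * d' \<le> i + 12 * d" using i'_le by linarith
        then have "energy (i' + 12 * d') \<le> 100 * (vec_norm m \<epsilon>)\<^sup>2"
          using True less.prems by (intro less.IH) (auto simp: d'_def)
        moreover have "energy (i + 12 * d) \<le> energy (i' + 12 * d')"
          using \<open>i' + 12 * d' \<le> i + 12 * d\<close> by (rule energy_antimono)
        ultimately show ?thesis by linarith
      next
        case False
        define z where "z j = x j - iter i' j" for j
        have sub: "S - supp i' \<subseteq> T" using supp_mono[OF i'_ge] by (auto simp: T_def)
        \<comment> \<open>At least d - g L indices are still missing, and any such set of
          coefficients carries at least the energy of the tail.\<close>
        have "W L \<le> sum w (S - supp i')"
          unfolding W_def tail_def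
        proof (rule sum_tail_le[where w = w, OF f _ finT sub])
          show "w (f k) \<le> w (f j)" if "j \<le> k" "k < d" for j k using that by (rule dec)
        qed (use False in \<open>auto simp: d'_def w_def\<close>)
        also have "\<dots> = (\<Sum>j\<in>S - supp i'. (cmod (z j))\<^sup>2)"
          using iter_coeff[of i'] by (intro sum.cong) (auto simp: w_def z_def coeff_vectors_def)
        also have "\<dots> \<le> (coeff_norm J z)\<^sup>2"
          unfolding coeff_norm_sq using J S by (intro sum_mono2) auto
        finally have WL: "W L \<le> (coeff_norm J z)\<^sup>2" .
        have zc: "z \<in> coeff_vectors (S \<union> supp i')"
          using x iter_coeff[of i'] by (auto simp: z_def coeff_vectors_def)
        have "card (S \<union> supp i') \<le> card S + card (supp i')" by (rule card_Un_le)
        then have cU: "card (S \<union> supp i') \<le> 26 * n"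
          using S(2) card_supp[of i'] i'_le gL less.prems(2) by linarith
        have lower: "9 / 10 * (coeff_norm J z)\<^sup>2 \<le> (vec_norm m (mat_vec J A z))\<^sup>2"
          by (rule near_isometry_sparse(1)[OF ni J(1) _ cU _ _ zc]) (use S supp_subset n in auto)
        have "vec_norm m (mat_vec J A z) = vec_norm m (\<lambda>l. res i' l - \<epsilon> l)"
          by (intro vec_norm_cong) (simp add: res_def y z_def[abs_def] mat_vec_diff)
        also have "\<dots> \<le> vec_norm m (res i') + \<nu>" unfolding \<nu>_def by (rule vec_norm_triangle_diff)
        finally have "(vec_norm m (mat_vec J A z))\<^sup>2 \<le> (vec_norm m (res i') + \<nu>)\<^sup>2"
          by (intro power_mono) auto
        also have "\<dots> \<le> 9 / 8 * energy i' + 9 * \<nu>\<^sup>2"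
          using add_square_le[of 8 "vec_norm m (res i')" \<nu>] by (simp add: energy_def)
        \<comment> \<open>9/8 * 3/5 = 27/40 is below 9/10, so \<open>W L\<close> is bounded by a
          multiple of the squared noise.\<close>
        finally have "energy i' \<le> 100 * \<nu>\<^sup>2" using WL lower fin zero_le_power2[of \<nu>] by argo
        moreover have "energy (i + 12 * d) \<le> energy i'"
          using i'_le gL by (intro energy_antimono) linarith
        ultimately show ?thesis by (simp add: \<nu>_def)
      qed
    qed
  qed
qed

lemma energy_final:
  assumes "\<And>l. l < m \<Longrightarrow> y l = mat_vec J A x l + \<epsilon> l"
    and S: "S \<subseteq> J" "card S \<le> 2 * n" and "x \<in> coeff_vectors S"
  shows "energy (24 * n) \<le> 100 * (vec_norm m \<epsilon>)\<^sup>2"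
  using energy_bound_from[OF assms(1) S assms(4), of 0 "2 * n"] S(2) by simp

end
text \<open>The 2 n largest entries serve all \<open>K\<close> at once. Removing \<open>K\<close>
  leaves at least \<open>n\<close> of them, each at least \<open>M\<close>, so n * M is bounded by
  the tail of \<open>K\<close>. This is the step of Stechkin's inequality that makes 2 n terms
  necessary in place of \<open>n\<close>.\<close>

lemma best_terms:
  fixes x :: "'i \<Rightarrow> complex" and n :: nat
  assumes J: "finite J" and n: "1 \<le> n"
  shows "\<exists>S\<subseteq>J. card S \<le> 2 * n \<and> (\<forall>K\<subseteq>J. card K \<le> n \<longrightarrow>
    (\<Sum>j\<in>J - S. cmod (x j)) \<le> 2 * (\<Sum>j\<in>J - K. cmod (x j)) \<and>
    n * (coeff_norm (J - S) x)\<^sup>2 \<le> 2 * (\<Sum>j\<in>J - K. cmod (x j))\<^sup>2)"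
proof (cases "card J \<le> 2 * n")
  case True
  then show ?thesis
    by (intro exI[of _ J] conjI allI impI) (simp_all add: sum_nonneg coeff_norm_def)
next
  case False
  obtain f where f: "bij_betw f {..<card J} J"
    and dec: "\<And>i j. i \<le> j \<Longrightarrow> j < card J \<Longrightarrow> cmod (x (f j)) \<le> cmod (x (f i))"
    using decreasing_enumeration[OF J, of "\<lambda>j. cmod (x j)"] by blast
  have injf: "inj_on f {..<card J}" and imf: "f ` {..<card J} = J" using f by (auto simp: bij_betw_def)
  define S where "S = f ` {..<2 * n}"
  define M where "M = cmod (x (f (2 * n)))"
  have "S \<subseteq> f ` {..<card J}" unfolding S_def using False by (intro image_mono) auto
  then have SJ: "S \<subseteq> J" unfolding imf .
  have fS: "finite S" by (simp add: S_def)
  have "inj_on f {..<2 * n}" using injf False by (intro inj_on_subset[OF injf]) auto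
  then have cS: "card S = 2 * n" by (simp add: S_def card_image)
  have big: "M \<le> cmod (x j)" if "j \<in> S" for j
    using that dec False by (auto simp: S_def M_def)
  have small: "cmod (x j) \<le> M" if j: "j \<in> J - S" for j
  proof -
    have "j \<in> f ` {..<card J}" using j imf by simp
    then obtain i where "i < card J" "j = f i" by blast
    moreover have "2 * n \<le> i" using j calculation by (auto simp: S_def not_less[symmetric])
    ultimately show ?thesis using dec by (simp add: M_def)
  qed
  have "(\<Sum>j\<in>J - S. cmod (x j)) \<le> 2 * (\<Sum>j\<in>J - K. cmod (x j)) \<and>
    n * (coeff_norm (J - S) x)\<^sup>2 \<le> 2 * (\<Sum>j\<in>J - K. cmod (x j))\<^sup>2" if K: "K \<subseteq> J" "card K \<le> n" for K
  proof -
    define \<sigma> where "\<sigma> = (\<Sum>j\<in>J - K. cmod (x j))"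
    have fK: "finite K" using K J finite_subset by blast
    have M0: "0 \<le> M" by (simp add: M_def)
    have \<sigma>0: "0 \<le> \<sigma>" by (simp add: \<sigma>_def sum_nonneg)
    have "card S - card K \<le> card (S - K)" using fK by (rule diff_card_le_card_Diff)
    then have "n \<le> card (S - K)" using cS K by linarith
    then have "n * M \<le> card (S - K) * M" using M0 by (intro mult_right_mono) auto
    also have "\<dots> \<le> (\<Sum>j\<in>S - K. cmod (x j))"
      using big sum_bounded_below[of "S - K" M "\<lambda>j. cmod (x j)"] by simp
    also have "\<dots> \<le> \<sigma>" unfolding \<sigma>_def using J SJ by (intro sum_mono2) auto
    finally have nM: "n * M \<le> \<sigma>" .
    have "(\<Sum>j\<in>J - S. cmod (x j)) = (\<Sum>j\<in>(J - S) \<inter> K. cmod (x j)) + (\<Sum>j\<in>J - S - K. cmod (x j))"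
      using J by (intro sum.Int_Diff) auto
    also have "(J - S) \<inter> K = K - S" using K by auto
    also have "(\<Sum>j\<in>J - S - K. cmod (x j)) \<le> \<sigma>"
      unfolding \<sigma>_def using J by (intro sum_mono2) auto
    also have "(\<Sum>j\<in>K - S. cmod (x j)) \<le> card (K - S) * M"
      using small K sum_bounded_above[of "K - S" "\<lambda>j. cmod (x j)" M] by auto
    also have "\<dots> \<le> n * M"
      using M0 K card_mono[of K "K - S"] fK by (intro mult_right_mono) auto
    finally have 1: "(\<Sum>j\<in>J - S. cmod (x j)) \<le> 2 * \<sigma>" using nM by linarith
    have "(coeff_norm (J - S) x)\<^sup>2 \<le> (\<Sum>j\<in>J - S. M * cmod (x j))"
      unfolding coeff_norm_sq using small by (intro sum_mono) (auto simp: power2_eq_square intro!: mult_right_mono)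
    also have "\<dots> \<le> M * (2 * \<sigma>)" unfolding sum_distrib_left[symmetric] using 1 M0 by (intro mult_left_mono)
    finally have "n * (coeff_norm (J - S) x)\<^sup>2 \<le> n * (M * (2 * \<sigma>))" by (intro mult_left_mono) auto
    also have "\<dots> = (n * M) * (2 * \<sigma>)" by simp
    also have "\<dots> \<le> \<sigma> * (2 * \<sigma>)" using nM \<sigma>0 by (intro mult_right_mono) auto
    finally show ?thesis using 1 by (simp add: \<sigma>_def power2_eq_square)
  qed
  then show ?thesis using SJ cS by (intro exI[of _ S]) auto
qed

text \<open>The entries off \<open>S\<close> count as additional noise. They are not sparse, and it
  is the l1 term of the near isometry that bounds their image by \<sigma>. The remaining error lives
  on 26 n indices, where it is controlled by its image, hence by the final residual and the
  noise.\<close>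

lemma omp_stable:
  fixes n :: nat and x :: "'i \<Rightarrow> complex"
  assumes ni: "near_isometry J m A (26 * real n)" and n: "1 \<le> n" and J: "finite J" "J \<noteq> {}"
    and e: "bij_betw e {..<card J} J"
    and y: "\<And>l. l < m \<Longrightarrow> y l = mat_vec J A x l + \<epsilon> l"
    and K: "K \<subseteq> J" "card K \<le> n"
  defines "\<sigma> \<equiv> (\<Sum>j\<in>J - K. cmod (x j))" and "\<eta> \<equiv> vec_norm m \<epsilon>"
    and "p \<equiv> snd (omp e J m A y (24 * n))"
  shows "(\<Sum>j\<in>J. cmod (p j - x j)) \<le> 300 * (\<sigma> + sqrt n * \<eta>)"
    and "sqrt n * coeff_norm J (\<lambda>j. p j - x j) \<le> 300 * (\<sigma> + sqrt n * \<eta>)"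
proof -
  interpret omp_run J m n A e y by unfold_locales (use J e n ni in auto)
  obtain S where S: "S \<subseteq> J" "card S \<le> 2 * n"
    and tail1: "(\<Sum>j\<in>J - S. cmod (x j)) \<le> 2 * \<sigma>"
    and tail2: "n * (coeff_norm (J - S) x)\<^sup>2 \<le> 2 * \<sigma>\<^sup>2"
    using best_terms[OF J(1) n, of x] K unfolding \<sigma>_def by blast
  define xS where "xS j = (if j \<in> S then x j else 0)" for j
  define xR where "xR j = (if j \<in> J - S then x j else 0)" for j
  define q where "q = sqrt n"
  define \<delta> where "\<delta> l = mat_vec J A xR l + \<epsilon> l" for l
  define \<nu> where "\<nu> = vec_norm m \<delta>"
  have q: "1 \<le> q" "q\<^sup>2 = n" using n by (auto simp: q_def)
  have \<sigma>0: "0 \<le> \<sigma>" by (simp add: \<sigma>_def sum_nonneg)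
  have \<eta>0: "0 \<le> \<eta>" by (simp add: \<eta>_def)
  then have q\<eta>0: "0 \<le> q * \<eta>" using q by simp
  have xSc: "xS \<in> coeff_vectors S" by (simp add: xS_def coeff_vectors_def)
  have split: "mat_vec J A x l = mat_vec J A xS l + mat_vec J A xR l" for l
    unfolding mat_vec_def sum.distrib[symmetric] using S by (intro sum.cong) (auto simp: xS_def xR_def)
  have y': "y l = mat_vec J A xS l + \<delta> l" if "l < m" for l
    using y[OF that] by (simp add: \<delta>_def split)
  have sumR: "(\<Sum>j\<in>J. cmod (xR j)) = (\<Sum>j\<in>J - S. cmod (x j))"
    using J by (intro sum.mono_neutral_cong_right) (auto simp: xR_def)
  have normR: "(coeff_norm J xR)\<^sup>2 = (coeff_norm (J - S) x)\<^sup>2"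
    unfolding coeff_norm_sq using J by (intro sum.mono_neutral_cong_right) (auto simp: xR_def)
  have qR: "q * coeff_norm J xR \<le> 2 * \<sigma>"
  proof (rule power2_le_imp_le)
    have "(q * coeff_norm J xR)\<^sup>2 \<le> 2 * \<sigma>\<^sup>2" using tail2 by (simp add: power_mult_distrib q normR)
    also have "\<dots> \<le> (2 * \<sigma>)\<^sup>2" by (simp add: power_mult_distrib)
    finally show "(q * coeff_norm J xR)\<^sup>2 \<le> (2 * \<sigma>)\<^sup>2" .
  qed (use \<sigma>0 in simp)
  have "q * vec_norm m (mat_vec J A xR) \<le> 3 * \<sigma>"
  proof (rule power2_le_imp_le)
    have "(q * vec_norm m (mat_vec J A xR))\<^sup>2 \<le> q\<^sup>2 * (21 / 20 * (coeff_norm J xR)\<^sup>2 + 1 / 20 * ((\<Sum>j\<in>J. cmod (xR j))\<^sup>2 / (26 * q\<^sup>2)))"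
      unfolding power_mult_distrib
      using near_isometry_bounds(2)[OF ni, of xR] q by (intro mult_left_mono) auto
    also have "\<dots> = 21 / 20 * (q * coeff_norm J xR)\<^sup>2 + 1 / 520 * (\<Sum>j\<in>J. cmod (xR j))\<^sup>2"
      using q(1) by (simp add: field_simps)
    also have "\<dots> \<le> 21 / 20 * (2 * \<sigma>)\<^sup>2 + 1 / 520 * (2 * \<sigma>)\<^sup>2"
      using qR q tail1 by (intro add_mono mult_left_mono power_mono) (auto simp: sumR intro: sum_nonneg)
    also have "\<dots> \<le> (3 * \<sigma>)\<^sup>2" by (simp add: power_mult_distrib)
    finally show "(q * vec_norm m (mat_vec J A xR))\<^sup>2 \<le> (3 * \<sigma>)\<^sup>2" .
  qed (use \<sigma>0 in simp)
  moreover have "\<nu> \<le> vec_norm m (mat_vec J A xR) + \<eta>"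
    unfolding \<nu>_def \<eta>_def \<delta>_def[abs_def] by (rule vec_norm_triangle)
  then have "q * \<nu> \<le> q * (vec_norm m (mat_vec J A xR) + \<eta>)" using q by (intro mult_left_mono) auto
  ultimately have q\<nu>: "q * \<nu> \<le> 3 * \<sigma> + q * \<eta>" by (simp add: distrib_left)
  have p: "p = iter (24 * n)" by (simp add: p_def iter_def)
  define z where "z j = xS j - p j" for j
  have zc: "z \<in> coeff_vectors (S \<union> supp (24 * n))"
    using xSc iter_coeff[of "24 * n"] by (auto simp: z_def p coeff_vectors_def)
  have "card (S \<union> supp (24 * n)) \<le> card S + card (supp (24 * n))" by (rule card_Un_le)
  then have cU: "card (S \<union> supp (24 * n)) \<le> 26 * n" using S(2) card_supp[of "24 * n"] by linarith
  have "(vec_norm m (res (24 * n)))\<^sup>2 \<le> (10 * \<nu>)\<^sup>2"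
    using energy_final[OF y' S xSc] unfolding energy_def \<nu>_def by (simp add: power_mult_distrib)
  then have "vec_norm m (res (24 * n)) \<le> 10 * \<nu>"
    by (rule power2_le_imp_le) (simp add: \<nu>_def)
  moreover have "vec_norm m (mat_vec J A z) = vec_norm m (\<lambda>l. res (24 * n) l - \<delta> l)"
    by (intro vec_norm_cong) (simp add: res_def y' z_def[abs_def] p mat_vec_diff)
  moreover have "vec_norm m (\<lambda>l. res (24 * n) l - \<delta> l) \<le> vec_norm m (res (24 * n)) + \<nu>"
    unfolding \<nu>_def by (rule vec_norm_triangle_diff)
  ultimately have "vec_norm m (mat_vec J A z) \<le> 11 * \<nu>" by linarith
  then have "(vec_norm m (mat_vec J A z))\<^sup>2 \<le> (11 * \<nu>)\<^sup>2" by (intro power_mono) auto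
  moreover have "9 / 10 * (coeff_norm J z)\<^sup>2 \<le> (vec_norm m (mat_vec J A z))\<^sup>2"
    by (rule near_isometry_sparse(1)[OF ni J(1) _ cU _ _ zc]) (use S supp_subset n in auto)
  ultimately have "9 / 10 * (coeff_norm J z)\<^sup>2 \<le> (11 * \<nu>)\<^sup>2" by (rule order_trans[rotated])
  then have "(coeff_norm J z)\<^sup>2 \<le> (12 * \<nu>)\<^sup>2"
  proof -
    have "(11 * \<nu>)\<^sup>2 = 121 * \<nu>\<^sup>2" "(12 * \<nu>)\<^sup>2 = 144 * \<nu>\<^sup>2" by (simp_all add: power_mult_distrib)
    then show ?thesis using \<open>9 / 10 * (coeff_norm J z)\<^sup>2 \<le> (11 * \<nu>)\<^sup>2\<close> zero_le_power2[of \<nu>] by argo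
  qed
  then have zn: "coeff_norm J z \<le> 12 * \<nu>" by (rule power2_le_imp_le) (simp add: \<nu>_def)
  then have qz: "q * coeff_norm J z \<le> 12 * (q * \<nu>)" using q by (simp add: mult.left_commute mult_left_mono)
  have diff: "x j - p j = z j - (- xR j)" "p j - x j = - xR j - z j" if "j \<in> J" for j
    using that S by (auto simp: z_def xS_def xR_def)
  have "(\<Sum>j\<in>J. cmod (z j)) = (\<Sum>j\<in>S \<union> supp (24 * n). cmod (z j))"
    using J S supp_subset zc by (intro sum.mono_neutral_right) (auto simp: coeff_vectors_def)
  also have "\<dots> \<le> sqrt (26 * n) * coeff_norm (S \<union> supp (24 * n)) z"
    using cU S J finite_subset[OF S(1) J(1)] sum_norm_le_card[of "S \<union> supp (24 * n)" "26 * n" z] by simp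
  also have "\<dots> \<le> sqrt (26 * n) * coeff_norm J z"
    using S supp_subset J by (intro mult_left_mono coeff_norm_mono_set) auto
  also have "\<dots> \<le> (6 * q) * coeff_norm J z"
  proof -
    have "sqrt 26 \<le> 6" by (intro real_le_lsqrt) auto
    then show ?thesis by (intro mult_right_mono) (simp_all add: real_sqrt_mult q_def mult_right_mono)
  qed
  finally have z1: "(\<Sum>j\<in>J. cmod (z j)) \<le> 72 * (q * \<nu>)" using qz by simp
  have "(\<Sum>j\<in>J. cmod (p j - x j)) \<le> (\<Sum>j\<in>J. cmod (xR j) + cmod (z j))"
    by (intro sum_mono) (metis diff(2) norm_minus_cancel norm_triangle_ineq4)
  also have "\<dots> \<le> 2 * \<sigma> + 72 * (q * \<nu>)" using z1 tail1 by (simp add: sum.distrib sumR)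
  also have "\<dots> \<le> 300 * \<sigma> + 300 * (q * \<eta>)" using q\<nu> \<sigma>0 q\<eta>0 by linarith
  finally show "(\<Sum>j\<in>J. cmod (p j - x j)) \<le> 300 * (\<sigma> + sqrt n * \<eta>)" by (simp add: q_def)
  have "coeff_norm J (\<lambda>j. p j - x j) = coeff_norm J (\<lambda>j. - xR j - z j)"
    unfolding coeff_norm_def by (intro L2_set_cong) (simp_all add: diff)
  also have "\<dots> \<le> coeff_norm J (\<lambda>j. - xR j) + coeff_norm J z" by (rule coeff_norm_triangle_diff)
  also have "coeff_norm J (\<lambda>j. - xR j) = coeff_norm J xR" by (simp add: coeff_norm_def)
  finally have "q * coeff_norm J (\<lambda>j. p j - x j) \<le> q * (coeff_norm J xR + coeff_norm J z)"
    using q by (intro mult_left_mono) auto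
  also have "\<dots> \<le> 300 * \<sigma> + 300 * (q * \<eta>)"
    unfolding distrib_left using qR qz q\<nu> \<sigma>0 q\<eta>0 by linarith
  finally show "sqrt n * coeff_norm J (\<lambda>j. p j - x j) \<le> 300 * (\<sigma> + sqrt n * \<eta>)" by (simp add: q_def)
qed

section \<open>Bounded orthonormal systems and the Wiener space\<close>

text \<open>For complex terms \<open>infsum\<close> is 0 wherever the series does not converge
  absolutely. The set of absolute convergence is measurable, and on it the value is the sum along an
  enumeration.\<close>

lemma measurable_infsum_countable:
  fixes u :: "'i \<Rightarrow> 'a \<Rightarrow> complex"
  assumes I: "countable I" and u: "\<And>j. j \<in> I \<Longrightarrow> u j \<in> borel_measurable M"
  shows "(\<lambda>x. \<Sum>\<^sub>\<infinity>j\<in>I. u j x) \<in> borel_measurable M"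
proof (cases "finite I")
  case True
  then show ?thesis using u by simp
next
  case False
  define e where "e = from_nat_into I"
  have e: "bij_betw e UNIV I"
    unfolding e_def using I False by (rule bij_betw_from_nat_into)
  then have [measurable]: "u (e k) \<in> borel_measurable M" for k
    using u by (auto simp: bij_betw_def)
  have "(\<Sum>\<^sub>\<infinity>j\<in>I. u j x) = (if (\<Sum>k. ennreal (cmod (u (e k) x))) < \<infinity> then (\<Sum>k. u (e k) x) else 0)" for x
  proof -
    have eq: "(\<Sum>\<^sub>\<infinity>j\<in>I. u j x) = (\<Sum>\<^sub>\<infinity>k. u (e k) x)"
      using infsum_reindex_bij_betw[OF e, of "\<lambda>j. u j x"] by simp
    have summ: "summable (\<lambda>k. cmod (u (e k) x)) \<longleftrightarrow> (\<Sum>k. ennreal (cmod (u (e k) x))) < \<infinity>"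
    proof
      assume "summable (\<lambda>k. cmod (u (e k) x))"
      then have "(\<Sum>k. ennreal (cmod (u (e k) x))) = ennreal (\<Sum>k. cmod (u (e k) x))"
        by (intro suminf_ennreal2) auto
      then show "(\<Sum>k. ennreal (cmod (u (e k) x))) < \<infinity>" by simp
    next
      assume "(\<Sum>k. ennreal (cmod (u (e k) x))) < \<infinity>"
      then show "summable (\<lambda>k. cmod (u (e k) x))"
        by (intro summable_suminf_not_top) (auto simp: less_top)
    qed
    show ?thesis
    proof (cases "summable (\<lambda>k. cmod (u (e k) x))")
      case True
      then have "(\<lambda>k. u (e k) x) sums (\<Sum>k. u (e k) x)"
        by (rule summable_sums[OF summable_norm_cancel])
      then have "(\<Sum>\<^sub>\<infinity>k. u (e k) x) = (\<Sum>k. u (e k) x)"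
        by (rule infsumI[OF norm_summable_imp_has_sum[OF True]])
      then show ?thesis using True summ eq by simp
    next
      case False
      then have "\<not> (\<lambda>k. u (e k) x) summable_on UNIV"
        unfolding summable_on_iff_abs_summable_on_complex
        by (simp add: summable_on_UNIV_nonneg_real_iff)
      then show ?thesis using False summ eq by (simp add: infsum_not_exists)
    qed
  qed
  then show ?thesis by simp
qed

section \<open>Coefficients and expansions in the Wiener space\<close>

locale bounded_system = prob_space M for M :: "'a measure" +
  fixes I :: "'i set" and b :: "'i \<Rightarrow> 'a \<Rightarrow> complex" and B :: real
  assumes I: "countable I"
    and b_measurable [measurable]: "\<And>j. j \<in> I \<Longrightarrow> b j \<in> borel_measurable M"
    and b_bounded: "\<And>j. j \<in> I \<Longrightarrow> AE x in M. cmod (b j x) \<le> B"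
    and orthonormal: "\<And>i j. i \<in> I \<Longrightarrow> j \<in> I \<Longrightarrow> L2_inner M (b i) (b j) = (if i = j then 1 else 0)"
    and B_nonneg: "0 \<le> B"
begin

text \<open>Countability of \<open>I\<close> makes one null set suffice for all \<open>j\<close>. On
  the remaining points expansions in the Wiener space converge absolutely and uniformly.\<close>

definition good :: "'a set" where
  "good = {x \<in> space M. \<forall>j\<in>I. cmod (b j x) \<le> B}"

lemma AE_good: "AE x in M. x \<in> good"
  using b_bounded I by (simp add: good_def AE_ball_countable)

definition coeff :: "('a \<Rightarrow> complex) \<Rightarrow> 'i \<Rightarrow> complex" where
  "coeff f j = L2_inner M f (b j)"

text \<open>A unit second moment on a probability space forces a bound of at least 1. This gives B^2
  n >= 1 in the sample size.\<close>

lemma bound_ge_one: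
  assumes "j \<in> I"
  shows "1 \<le> B"
proof -
  have [measurable]: "b j \<in> borel_measurable M" using assms by measurable
  have "complex_of_real (expectation (\<lambda>x. (cmod (b j x))\<^sup>2)) = (LINT x|M. b j x * cnj (b j x))"
    by (simp add: complex_norm_square[symmetric] flip: integral_complex_of_real)
  also have "\<dots> = 1" using orthonormal[OF assms assms] by (simp add: L2_inner_def)
  finally have "expectation (\<lambda>x. (cmod (b j x))\<^sup>2) = 1" by (simp only: of_real_eq_1_iff)
  moreover have "expectation (\<lambda>x. (cmod (b j x))\<^sup>2) \<le> expectation (\<lambda>x. B\<^sup>2)"
    using b_bounded[OF assms] by (intro integral_mono_AE') (auto elim!: eventually_mono intro!: power_mono)
  ultimately have "1 \<le> B\<^sup>2" by (simp add: prob_space)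
  then show ?thesis using B_nonneg by (intro power2_le_imp_le[of 1 B]) simp_all
qed

lemma wiener_summable:
  assumes "f \<in> wiener_space M I b"
  shows "(\<lambda>j. cmod (coeff f j)) summable_on I"
proof -
  have "(\<Sum>j\<in>F. cmod (coeff f j)) \<le> enn2real (wiener_norm M I b f)" if "F \<subseteq> I" "finite F" for F
  proof -
    have "ennreal (\<Sum>j\<in>F. cmod (coeff f j)) = (\<Sum>j\<in>F. ennreal (cmod (coeff f j)))" by simp
    also have "\<dots> = (\<Sum>\<^sub>\<infinity>j\<in>F. ennreal (cmod (coeff f j)))" using that by simp
    also have "\<dots> \<le> wiener_norm M I b f"
      unfolding wiener_norm_def coeff_def using that by (intro infsum_mono_neutral nonneg_summable_on_complete) auto
    finally have "enn2real (ennreal (\<Sum>j\<in>F. cmod (coeff f j))) \<le> enn2real (wiener_norm M I b f)"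
      using assms by (intro enn2real_mono) (auto simp: wiener_space_def)
    then show ?thesis by (simp add: sum_nonneg)
  qed
  then show ?thesis unfolding abs_summable_iff_bdd_above by (intro bdd_aboveI2) auto
qed

lemma wiener_expansion:
  assumes f: "f \<in> wiener_space M I b" and x: "x \<in> good"
  shows "(\<lambda>j. cmod (coeff f j * b j x)) summable_on I" and "f x = (\<Sum>\<^sub>\<infinity>j\<in>I. coeff f j * b j x)"
proof -
  show "(\<lambda>j. cmod (coeff f j * b j x)) summable_on I"
  proof (rule Infinite_Sum.abs_summable_on_comparison_test)
    show "(\<lambda>j. cmod (coeff f j * of_real B)) summable_on I"
      using summable_on_cmult_left[OF wiener_summable[OF f], of B] B_nonneg by (simp add: norm_mult)
    show "norm (coeff f j * b j x) \<le> norm (coeff f j * of_real B)" if "j \<in> I" for j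
      using that x B_nonneg by (auto simp: norm_mult good_def intro!: mult_left_mono)
  qed
  show "f x = (\<Sum>\<^sub>\<infinity>j\<in>I. coeff f j * b j x)"
    using f x by (simp add: wiener_space_def coeff_def good_def)
qed

lemma wiener_bounded:
  assumes f: "f \<in> wiener_space M I b" and x: "x \<in> good"
  shows "cmod (f x) \<le> B * (\<Sum>\<^sub>\<infinity>j\<in>I. cmod (coeff f j))"
proof -
  have "cmod (f x) \<le> (\<Sum>\<^sub>\<infinity>j\<in>I. cmod (coeff f j * b j x))"
    unfolding wiener_expansion(2)[OF assms] by (rule norm_infsum_bound[OF wiener_expansion(1)[OF assms]])
  also have "\<dots> \<le> (\<Sum>\<^sub>\<infinity>j\<in>I. B * cmod (coeff f j))"
    using wiener_expansion(1)[OF assms] summable_on_cmult_right[OF wiener_summable[OF f], of B] x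
    by (intro infsum_mono) (auto simp: norm_mult good_def mult.commute[of B] intro!: mult_left_mono)
  also have "\<dots> = B * (\<Sum>\<^sub>\<infinity>j\<in>I. cmod (coeff f j))" by (rule infsum_cmult_right')
  finally show ?thesis .
qed

lemma wiener_measurable:
  assumes f: "f \<in> wiener_space M I b"
  shows "f \<in> borel_measurable M"
proof -
  have "(\<lambda>x. \<Sum>\<^sub>\<infinity>j\<in>I. L2_inner M f (b j) * b j x) \<in> borel_measurable M"
    using I by (intro measurable_infsum_countable) auto
  moreover have "f x = (\<Sum>\<^sub>\<infinity>j\<in>I. L2_inner M f (b j) * b j x)" if "x \<in> space M" for x
    using f that by (simp add: wiener_space_def)
  ultimately show ?thesis by (subst measurable_cong) auto
qed

lemma integrable_times_cnj:
  assumes [measurable]: "g \<in> borel_measurable M" and g: "AE x in M. cmod (g x) \<le> s" and j: "j \<in> I"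
  shows "integrable M (\<lambda>x. g x * cnj (b j x))"
proof -
  have [measurable]: "cnj \<in> borel_measurable borel"
    by (intro borel_measurable_continuous_onI continuous_intros)
  have [measurable]: "b j \<in> borel_measurable M" using j by measurable
  show ?thesis
  proof (rule integrable_const_bound[where B = "s * B"])
    show "AE x in M. norm (g x * cnj (b j x)) \<le> s * B"
      using g b_bounded[OF j]
    proof eventually_elim
      case (elim x)
      then show ?case by (auto simp: norm_mult intro!: mult_mono order_trans[OF norm_ge_zero elim(1)])
    qed
  qed measurable
qed

text \<open>By orthonormality, subtracting terms from \<open>K\<close> does not alter the
  coefficients outside \<open>K\<close>, so the Wiener norm of the difference is at least the tail
  over \<open>J - K\<close>. Dropping the coefficients outside \<open>J\<close> is harmless for a
  lower bound.\<close>

lemma best_approx_ge: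
  assumes f: "f \<in> wiener_space M I b" and J: "finite J" "J \<subseteq> I"
    and K0: "\<And>K. K \<subseteq> J \<Longrightarrow> card K \<le> n \<Longrightarrow> \<sigma> \<le> (\<Sum>j\<in>J - K. cmod (coeff f j))"
  shows "ennreal \<sigma> \<le> best_approx M I b n f"
  unfolding best_approx_def
proof (intro INF_greatest)
  fix K and c :: "'i \<Rightarrow> complex"
  assume "K \<in> {K. K \<subseteq> I \<and> finite K \<and> card K \<le> n}"
  then have K: "K \<subseteq> I" "finite K" "card K \<le> n" by auto
  note [measurable] = wiener_measurable[OF f]
  have fb: "AE x in M. cmod (f x) \<le> B * (\<Sum>\<^sub>\<infinity>j\<in>I. cmod (coeff f j))"
    using AE_good by eventually_elim (rule wiener_bounded[OF f])
  have co: "coeff (\<lambda>x. f x - (\<Sum>k\<in>K. c k * b k x)) j = coeff f j" if j: "j \<in> J - K" for j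
  proof -
    have jI: "j \<in> I" using j J by auto
    have int: "integrable M (\<lambda>x. c k * (b k x * cnj (b j x)))" if "k \<in> K" for k
      using that K jI b_bounded by (intro integrable_mult_right integrable_times_cnj) auto
    have "coeff (\<lambda>x. f x - (\<Sum>k\<in>K. c k * b k x)) j
       = (LINT x|M. f x * cnj (b j x) - (\<Sum>k\<in>K. c k * (b k x * cnj (b j x))))"
      by (simp add: coeff_def L2_inner_def left_diff_distrib sum_distrib_right mult.assoc)
    also have "\<dots> = coeff f j - (\<Sum>k\<in>K. c k * L2_inner M (b k) (b j))"
      unfolding coeff_def L2_inner_def using int integrable_times_cnj[OF wiener_measurable[OF f] fb jI]
      by (subst Bochner_Integration.integral_diff)
        (auto simp: Bochner_Integration.integral_sum intro!: Bochner_Integration.integrable_sum)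
    also have "(\<Sum>k\<in>K. c k * L2_inner M (b k) (b j)) = 0"
      using j K jI by (intro sum.neutral) (auto simp: orthonormal subset_iff)
    finally show ?thesis by simp
  qed
  have "card (J \<inter> K) \<le> n" using card_mono[of K "J \<inter> K"] K by auto
  then have "\<sigma> \<le> (\<Sum>j\<in>J - K. cmod (coeff f j))" using K0[of "J \<inter> K"] by (simp add: Diff_Int)
  then have "ennreal \<sigma> \<le> (\<Sum>j\<in>J - K. ennreal (cmod (coeff f j)))" by (simp add: ennreal_leI)
  also have "\<dots> = (\<Sum>\<^sub>\<infinity>j\<in>J - K. ennreal (cmod (coeff (\<lambda>x. f x - (\<Sum>k\<in>K. c k * b k x)) j)))"
    using J co by simp
  also have "\<dots> \<le> wiener_norm M I b (\<lambda>x. f x - (\<Sum>k\<in>K. c k * b k x))"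
    unfolding wiener_norm_def coeff_def using J by (intro infsum_mono_neutral nonneg_summable_on_complete) auto
  finally show "ennreal \<sigma> \<le> wiener_norm M I b (\<lambda>x. f x - (\<Sum>k\<in>K. c k * b k x))" .
qed

section \<open>A null set common to all functions of the Wiener space\<close>

definition list_comb :: "('i \<times> complex) list \<Rightarrow> 'a \<Rightarrow> complex" where
  "list_comb zs x = (\<Sum>(j, a)\<leftarrow>zs. a * b j x)"

lemma list_comb_measurable: "zs \<in> lists (I \<times> UNIV) \<Longrightarrow> list_comb zs \<in> borel_measurable M"
proof (induction zs)
  case (Cons z zs)
  then have [measurable]: "list_comb zs \<in> borel_measurable M" "b (fst z) \<in> borel_measurable M" by auto
  have "list_comb (z # zs) = (\<lambda>x. snd z * b (fst z) x + list_comb zs x)"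
    by (simp add: list_comb_def split_def fun_eq_iff)
  then show ?case by simp
qed (simp add: list_comb_def[abs_def])

text \<open>A finite set carries all but \<delta> of the l1 norm, and its coefficients outside
  \<open>J\<close> are rounded into the dense set \<open>Q\<close>. Each of the two errors is at
  most B * \<delta> at every good point. With \<open>Q\<close> countable the lists range over a
  countable family.\<close>

lemma tail_approximation:
  assumes f: "f \<in> wiener_space M I b" and J: "finite J" "J \<subseteq> I" and \<epsilon>: "0 < \<epsilon>"
    and Q: "\<And>U :: complex set. open U \<Longrightarrow> U \<noteq> {} \<Longrightarrow> \<exists>d\<in>Q. d \<in> U"
  shows "\<exists>zs\<in>lists (I \<times> Q). \<forall>x\<in>good. cmod (f x - proj M b J f x - list_comb zs x) \<le> \<epsilon>"
proof -
  define \<delta> where "\<delta> = \<epsilon> / (2 * (B + 1))"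
  have \<delta>: "0 < \<delta>" "B * (2 * \<delta>) \<le> \<epsilon>" using \<epsilon> B_nonneg by (auto simp: \<delta>_def field_simps)
  have summ: "(\<lambda>j. cmod (coeff f j)) summable_on I" by (rule wiener_summable[OF f])
  obtain F where F: "finite F" "F \<subseteq> I" "dist (\<Sum>j\<in>F. cmod (coeff f j)) (\<Sum>\<^sub>\<infinity>j\<in>I. cmod (coeff f j)) \<le> \<delta>"
    using infsum_finite_approximation[OF summ \<delta>(1)] by blast
  define F' where "F' = F \<union> J"
  have F': "finite F'" "F' \<subseteq> I" "J \<subseteq> F'" using F J by (auto simp: F'_def)
  have tail: "(\<Sum>\<^sub>\<infinity>j\<in>I - F'. cmod (coeff f j)) \<le> \<delta>"
  proof -
    have "(\<Sum>\<^sub>\<infinity>j\<in>I - F'. cmod (coeff f j)) = (\<Sum>\<^sub>\<infinity>j\<in>I. cmod (coeff f j)) - (\<Sum>j\<in>F'. cmod (coeff f j))"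
      using F' summ by (subst infsum_Diff) auto
    moreover have "(\<Sum>j\<in>F. cmod (coeff f j)) \<le> (\<Sum>j\<in>F'. cmod (coeff f j))"
      using F' by (intro sum_mono2) (auto simp: F'_def)
    ultimately show ?thesis using F(3) by (simp add: dist_real_def)
  qed
  define k where "k = real (card F' + 1)"
  have k: "0 < k" by (simp add: k_def)
  have "0 < \<delta> / k" using \<delta> k by simp
  then have "\<exists>d\<in>Q. d \<in> ball (coeff f j) (\<delta> / k)" for j
    by (intro Q) auto
  then obtain r where r: "\<And>j. r j \<in> Q" "\<And>j. cmod (coeff f j - r j) < \<delta> / k"
    by (auto simp: dist_norm) metis
  obtain js where js: "set js = F' - J" "distinct js" using F' finite_distinct_list[of "F' - J"] by auto
  define zs where "zs = map (\<lambda>j. (j, r j)) js"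
  have lc: "list_comb zs x = (\<Sum>j\<in>F' - J. r j * b j x)" for x
    unfolding list_comb_def zs_def using js
    by (simp add: o_def sum_list_distinct_conv_sum_set)
  have "cmod (f x - proj M b J f x - list_comb zs x) \<le> \<epsilon>" if x: "x \<in> good" for x
  proof -
    note ex = wiener_expansion[OF f x]
    have bx: "cmod (b j x) \<le> B" if "j \<in> I" for j using x that by (simp add: good_def)
    have summx: "(\<lambda>j. coeff f j * b j x) summable_on I" by (rule abs_summable_summable[OF ex(1)])
    have "f x - (\<Sum>j\<in>F'. coeff f j * b j x) = (\<Sum>\<^sub>\<infinity>j\<in>I - F'. coeff f j * b j x)"
      using F' summx unfolding ex(2) by (subst infsum_Diff) auto
    also have "cmod \<dots> \<le> (\<Sum>\<^sub>\<infinity>j\<in>I - F'. cmod (coeff f j * b j x))"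
      by (intro norm_infsum_bound summable_on_subset_banach[OF ex(1)]) auto
    also have "\<dots> \<le> (\<Sum>\<^sub>\<infinity>j\<in>I - F'. B * cmod (coeff f j))"
      using bx by (intro infsum_mono summable_on_cmult_right summable_on_subset_banach[OF ex(1)] summable_on_subset_banach[OF summ])
        (auto simp: norm_mult mult.commute[of B] intro!: mult_left_mono)
    also have "\<dots> = B * (\<Sum>\<^sub>\<infinity>j\<in>I - F'. cmod (coeff f j))" by (rule infsum_cmult_right')
    also have "\<dots> \<le> B * \<delta>" using tail B_nonneg by (rule mult_left_mono)
    finally have 1: "cmod (f x - (\<Sum>j\<in>F'. coeff f j * b j x)) \<le> B * \<delta>" .
    have "cmod ((coeff f j - r j) * b j x) \<le> \<delta> / k * B" if "j \<in> F' - J" for j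
      unfolding norm_mult using that F' \<open>0 < \<delta> / k\<close>
      by (intro mult_mono less_imp_le[OF r(2)] bx) auto
    then have "cmod (\<Sum>j\<in>F' - J. (coeff f j - r j) * b j x) \<le> (\<Sum>j\<in>F' - J. \<delta> / k * B)"
      by (rule sum_norm_le)
    also have "\<dots> = card (F' - J) * (\<delta> / k * B)" by simp
    also have "\<dots> \<le> k * (\<delta> / k * B)"
      using \<delta> B_nonneg k F' card_mono[of F' "F' - J"] by (intro mult_right_mono) (auto simp: k_def)
    finally have 2: "cmod (\<Sum>j\<in>F' - J. (coeff f j - r j) * b j x) \<le> B * \<delta>" using k by (simp add: mult.commute)
    have "(\<Sum>j\<in>F'. coeff f j * b j x) = proj M b J f x + (\<Sum>j\<in>F' - J. coeff f j * b j x)"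
      unfolding proj_def coeff_def[symmetric] using F' by (simp add: sum.subset_diff add.commute)
    then have "f x - proj M b J f x - list_comb zs x =
       (f x - (\<Sum>j\<in>F'. coeff f j * b j x)) + (\<Sum>j\<in>F' - J. (coeff f j - r j) * b j x)"
      by (simp add: lc left_diff_distrib sum_subtractf)
    then have "cmod (f x - proj M b J f x - list_comb zs x) \<le> B * \<delta> + B * \<delta>"
      by (simp only: norm_triangle_mono[OF 1 2])
    then show ?thesis using \<delta>(2) by simp
  qed
  moreover have "zs \<in> lists (I \<times> Q)" using js F' r by (auto simp: zs_def)
  ultimately show ?thesis by blast
qed

text \<open>The exceptional null set must not depend on \<open>f\<close>; it is obtained from countably many
  functions, which approximate all differences \<open>f - P\<^sub>J f\<close> uniformly on \<^term>\<open>good\<close>.\<close>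

lemma sampling_null_set:
  "\<exists>N\<in>null_sets M. \<forall>x\<in>space M - N. x \<in> good \<and>
    (\<forall>f\<in>wiener_space M I b. \<forall>J s. finite J \<longrightarrow> J \<subseteq> I \<longrightarrow> 0 \<le> s \<longrightarrow>
      (AE y in M. cmod (f y - proj M b J f y) \<le> s) \<longrightarrow> cmod (f x - proj M b J f x) \<le> s)"
proof -
  obtain Q :: "complex set" where Q: "countable Q" "\<And>U. open U \<Longrightarrow> U \<noteq> {} \<Longrightarrow> \<exists>d\<in>Q. d \<in> U"
    using countable_dense_exists by blast
  define Z where "Z = lists (I \<times> Q)"
  have Z: "countable Z" unfolding Z_def using I Q by (intro countable_lists) auto
  \<comment> \<open>Off one null set no combination of the countable family exceeds its own
    essential supremum.\<close>
  let ?P = "\<lambda>x. x \<in> good \<and> (\<forall>zs\<in>Z. ennreal (cmod (list_comb zs x)) \<le> esssup M (\<lambda>x. ennreal (cmod (list_comb zs x))))"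
  have "AE x in M. ?P x"
    using Z AE_good by (simp add: AE_ball_countable esssup_AE)
  from AE_E[OF this] obtain N where "{x \<in> space M. \<not> ?P x} \<subseteq> N" "emeasure M N = 0" "N \<in> sets M" .
  then have N: "{x \<in> space M. \<not> ?P x} \<subseteq> N" "N \<in> null_sets M" by auto
  have "cmod (f x - proj M b J f x) \<le> s"
    if x: "x \<in> space M - N" and f: "f \<in> wiener_space M I b" and J: "finite J" "J \<subseteq> I"
      and s: "0 \<le> s" "AE y in M. cmod (f y - proj M b J f y) \<le> s" for x f J s
  proof (rule field_le_epsilon)
    fix \<epsilon> :: real assume \<epsilon>: "0 < \<epsilon>"
    obtain zs where zs: "zs \<in> Z" "\<forall>x\<in>good. cmod (f x - proj M b J f x - list_comb zs x) \<le> \<epsilon> / 2"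
      using tail_approximation[OF f J half_gt_zero[OF \<epsilon>] Q(2)] unfolding Z_def by blast
    have [measurable]: "list_comb zs \<in> borel_measurable M"
      using zs(1) by (intro list_comb_measurable) (auto simp: Z_def)
    have xg: "x \<in> good" and xz: "ennreal (cmod (list_comb zs x)) \<le> esssup M (\<lambda>x. ennreal (cmod (list_comb zs x)))"
      using x N zs(1) by auto
    \<comment> \<open>The almost everywhere bound passes from f - P_J f to the nearby combination,
      from there to its value at \<open>x\<close>, and back; each passage costs \<epsilon> /
      2.\<close>
    have "AE y in M. ennreal (cmod (list_comb zs y)) \<le> ennreal (s + \<epsilon> / 2)"
      using s(2) AE_good
    proof eventually_elim
      case (elim y)
      have "cmod (list_comb zs y) \<le> cmod (f y - proj M b J f y) + cmod (f y - proj M b J f y - list_comb zs y)"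
        using norm_triangle_ineq4[of "f y - proj M b J f y" "f y - proj M b J f y - list_comb zs y"] by simp
      then show ?case using elim zs(2) by (intro ennreal_leI) fastforce
    qed
    then have "esssup M (\<lambda>x. ennreal (cmod (list_comb zs x))) \<le> ennreal (s + \<epsilon> / 2)"
      by (intro esssup_I) auto
    with xz have "ennreal (cmod (list_comb zs x)) \<le> ennreal (s + \<epsilon> / 2)" by (rule order_trans)
    then have "cmod (list_comb zs x) \<le> s + \<epsilon> / 2" using s \<epsilon> by (subst (asm) ennreal_le_iff) auto
    moreover have "cmod (f x - proj M b J f x) \<le> cmod (f x - proj M b J f x - list_comb zs x) + cmod (list_comb zs x)"
      using norm_triangle_ineq[of "f x - proj M b J f x - list_comb zs x" "list_comb zs x"] by simp
    moreover have "cmod (f x - proj M b J f x - list_comb zs x) \<le> \<epsilon> / 2" using zs(2) xg by blast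
    ultimately show "cmod (f x - proj M b J f x) \<le> s + \<epsilon>" by linarith
  qed
  then show ?thesis using N by (intro bexI[OF _ N(2)]) blast
qed

text \<open>For j in \<open>I\<close> this alters \<open>b j\<close> on a null set only, so
  orthonormality survives, while the bound \<open>B\<close> now holds at every point as the
  concentration argument requires.\<close>

definition trunc :: "'i \<Rightarrow> 'a \<Rightarrow> complex" where
  "trunc j x = (if cmod (b j x) \<le> B then b j x else 0)"

lemma trunc_eq: "x \<in> good \<Longrightarrow> j \<in> I \<Longrightarrow> trunc j x = b j x"
  by (simp add: trunc_def good_def)

lemma orthonormal_trunc:
  assumes J: "finite J" "J \<subseteq> I" "J \<noteq> {}"
  shows "orthonormal_functions M J trunc B"
proof
  have [measurable]: "cnj \<in> borel_measurable borel"
    by (intro borel_measurable_continuous_onI continuous_intros)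
  show meas: "trunc j \<in> borel_measurable M" if "j \<in> J" for j
  proof -
    have [measurable]: "b j \<in> borel_measurable M" using that J by auto
    show ?thesis unfolding trunc_def[abs_def] by measurable
  qed
  show "(LINT x|M. trunc i x * cnj (trunc j x)) = (if i = j then 1 else 0)" if "i \<in> J" "j \<in> J" for i j
  proof -
    note [measurable] = meas[OF that(1)] meas[OF that(2)]
    have ij: "i \<in> I" "j \<in> I" using that J by auto
    then have [measurable]: "b i \<in> borel_measurable M" "b j \<in> borel_measurable M" by auto
    have "(LINT x|M. trunc i x * cnj (trunc j x)) = (LINT x|M. b i x * cnj (b j x))"
      using AE_good by (intro integral_cong_AE) (auto simp: trunc_eq ij elim!: eventually_mono)
    then show ?thesis using orthonormal[OF ij] by (simp add: L2_inner_def)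
  qed
  show "0 < B" using J bound_ge_one by force
qed (use J B_nonneg in \<open>auto simp: trunc_def\<close>)

text \<open>Interpolation between L2 and the sup norm. The l1 bound on the coefficients gives a
  supremum of at most C sqrt n R, the l2 bound an L2 norm of at most C R. Then |g|^t <= s^(t - 2)
  |g|^2 leaves the factor sqrt n to the power 1 - 2 / t.\<close>

lemma Lq_error:
  assumes f: "f \<in> wiener_space M I b" and J: "finite J" "J \<subseteq> I" "J \<noteq> {}" and n: "1 \<le> (n::nat)"
    and \<eta>: "AE x in M. cmod (f x - proj M b J f x) \<le> \<eta>" "0 \<le> \<eta>" "\<eta> \<le> R" and D: "0 \<le> D"
    and l1: "(\<Sum>j\<in>J. cmod (p j - coeff f j)) \<le> D * (sqrt n * R)"
    and l2: "coeff_norm J (\<lambda>j. p j - coeff f j) \<le> D * R" and q: "2 \<le> q"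
  shows "Lq_norm M q (\<lambda>x. f x - (\<Sum>j\<in>J. p j * b j x))
    \<le> ennreal ((D * (B + 2) + 2) * n powr (1 / 2 - enn2real (1 / q)) * R)"
proof -
  interpret T: orthonormal_functions M J trunc B by (rule orthonormal_trunc[OF J])
  define C where "C = D * (B + 2) + 2"
  define v where "v j = p j - coeff f j" for j
  define g where "g x = f x - (\<Sum>j\<in>J. p j * b j x)" for x
  define s where "s = C * (sqrt n * R)"
  have R: "0 \<le> R" using \<eta> by linarith
  have C: "0 \<le> C" "1 + D * B \<le> C" "2 + 2 * D\<^sup>2 \<le> C\<^sup>2"
  proof -
    have DB: "0 \<le> D * B" using D B_nonneg by simp
    show "1 + D * B \<le> C" "0 \<le> C" using D DB by (auto simp: C_def distrib_left)
    have "2 + 2 * D\<^sup>2 \<le> (2 * D + 2)\<^sup>2" using D by (simp add: power2_eq_square algebra_simps)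
    also have "\<dots> \<le> C\<^sup>2" using D DB by (intro power_mono) (auto simp: C_def distrib_left)
    finally show "2 + 2 * D\<^sup>2 \<le> C\<^sup>2" .
  qed
  have sn: "1 \<le> sqrt n" using n by simp
  have s0: "0 \<le> s" using C R by (simp add: s_def)
  have g: "g x = (f x - proj M b J f x) - T.lincomb v x" if "x \<in> good" for x
  proof -
    have "T.lincomb v x = (\<Sum>j\<in>J. v j * b j x)"
      unfolding T.lincomb_def using trunc_eq[OF that] J by (intro sum.cong) auto
    then show ?thesis
      by (simp add: g_def v_def proj_def coeff_def left_diff_distrib sum_subtractf)
  qed
  have AEg: "AE x in M. cmod (g x) \<le> s \<and> (cmod (g x))\<^sup>2 \<le> 2 * \<eta>\<^sup>2 + 2 * (cmod (T.lincomb v x))\<^sup>2"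
    using AE_good \<eta>(1)
  proof eventually_elim
    case (elim x)
    have xM: "x \<in> space M" using elim by (simp add: good_def)
    have t: "cmod (g x) \<le> \<eta> + cmod (T.lincomb v x)"
      unfolding g[OF elim(1)] using norm_triangle_ineq4[of "f x - proj M b J f x" "T.lincomb v x"] elim(2) by linarith
    have "(\<eta> + cmod (T.lincomb v x)) \<le> 1 * (sqrt n * R) + B * (D * (sqrt n * R))"
      using T.norm_lincomb_le[OF xM, of v] mult_left_mono[OF l1 B_nonneg] mult_right_mono[OF sn R] \<eta>(3)
      unfolding v_def[abs_def] by linarith
    also have "\<dots> = (1 + D * B) * (sqrt n * R)" by (simp add: algebra_simps)
    also have "\<dots> \<le> s" unfolding s_def using C R by (intro mult_right_mono) auto
    finally have "cmod (g x) \<le> s" using t by linarith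
    moreover have "(cmod (g x))\<^sup>2 \<le> (\<eta> + cmod (T.lincomb v x))\<^sup>2" using t by (intro power_mono) auto
    then have "(cmod (g x))\<^sup>2 \<le> 2 * \<eta>\<^sup>2 + 2 * (cmod (T.lincomb v x))\<^sup>2"
      using add_square_le[of 1 \<eta> "cmod (T.lincomb v x)"] by simp
    ultimately show ?case ..
  qed
  have [measurable]: "g \<in> borel_measurable M"
    unfolding g_def[abs_def] using J wiener_measurable[OF f] by (intro borel_measurable_diff borel_measurable_sum borel_measurable_times) auto
  have L2: "(\<integral>\<^sup>+ x. ennreal ((cmod (g x))\<^sup>2) \<partial>M) \<le> ennreal (C\<^sup>2 * R\<^sup>2)"
  proof -
    have le: "(\<integral>\<^sup>+ x. ennreal ((cmod (g x))\<^sup>2) \<partial>M) \<le> (\<integral>\<^sup>+ x. ennreal (2 * \<eta>\<^sup>2 + 2 * (cmod (T.lincomb v x))\<^sup>2) \<partial>M)"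
      by (rule nn_integral_mono_AE, rule eventually_mono[OF AEg]) (simp only: ennreal_leI)
    have "integrable M (\<lambda>x. (cmod (T.lincomb v x))\<^sup>2)"
      using T.norm_lincomb_le B_nonneg
      by (intro integrable_const_bound[where B = "(B * (\<Sum>j\<in>J. cmod (v j)))\<^sup>2"]) (auto intro!: AE_I2 power_mono)
    then have "(\<integral>\<^sup>+ x. ennreal (2 * \<eta>\<^sup>2 + 2 * (cmod (T.lincomb v x))\<^sup>2) \<partial>M)
       = ennreal (2 * \<eta>\<^sup>2 + 2 * expectation (\<lambda>x. (cmod (T.lincomb v x))\<^sup>2))"
      by (subst nn_integral_eq_integral) (auto simp: prob_space)
    also have "\<dots> = ennreal (2 * \<eta>\<^sup>2 + 2 * (coeff_norm J v)\<^sup>2)"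
      by (simp add: T.expectation_norm_lincomb_sq coeff_norm_sq)
    also have "\<dots> \<le> ennreal (C\<^sup>2 * R\<^sup>2)"
    proof (rule ennreal_leI)
      have "\<eta>\<^sup>2 \<le> R\<^sup>2" "(coeff_norm J v)\<^sup>2 \<le> (D * R)\<^sup>2"
        using \<eta> l2 unfolding v_def[abs_def] by (intro power_mono; simp)+
      then have "2 * \<eta>\<^sup>2 + 2 * (coeff_norm J v)\<^sup>2 \<le> (2 + 2 * D\<^sup>2) * R\<^sup>2" by (simp add: power_mult_distrib distrib_right)
      also have "\<dots> \<le> C\<^sup>2 * R\<^sup>2" using C by (intro mult_right_mono) auto
      finally show "2 * \<eta>\<^sup>2 + 2 * (coeff_norm J v)\<^sup>2 \<le> C\<^sup>2 * R\<^sup>2" .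
    qed
    finally show ?thesis using le by (rule order_trans[rotated])
  qed
  have "Lq_norm M q g \<le> ennreal (C * n powr (1 / 2 - enn2real (1 / q)) * R)"
  proof (cases "q = \<infinity>")
    case True
    \<comment> \<open>For infinite \<open>q\<close> the value of \<open>enn2real (1 / q)\<close> is
      0 and the exponent is 1/2.\<close>
    have "esssup M (\<lambda>x. ennreal (cmod (g x))) \<le> ennreal s"
      by (intro esssup_I eventually_mono[OF AEg]) (auto intro: ennreal_leI)
    then show ?thesis using True by (simp add: Lq_norm_def s_def powr_half_sqrt mult.assoc)
  next
    case False
    define t where "t = enn2real q"
    have qt: "q = ennreal t" using False by (simp add: t_def less_top)
    have t: "2 \<le> t" using q unfolding qt by (metis ennreal_le_iff2 ennreal_numeral leD linorder_not_le zero_less_numeral order_less_le_trans)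
    have inv_t: "enn2real (1 / q) = 1 / t"
      unfolding qt using t by (simp add: divide_ennreal[symmetric] flip: ennreal_1)
    define V where "V = s powr (t - 2) * (C\<^sup>2 * R\<^sup>2)"
    define N where "N = (\<integral>\<^sup>+ x. ennreal (cmod (g x) powr t) \<partial>M)"
    have V0: "0 \<le> V" by (simp add: V_def)
    have "N \<le> (\<integral>\<^sup>+ x. ennreal (s powr (t - 2)) * ennreal ((cmod (g x))\<^sup>2) \<partial>M)"
      unfolding N_def
    proof (rule nn_integral_mono_AE)
      show "AE x in M. ennreal (cmod (g x) powr t) \<le> ennreal (s powr (t - 2)) * ennreal ((cmod (g x))\<^sup>2)"
        using AEg
      proof eventually_elim
        case (elim x)
        have "cmod (g x) powr t = cmod (g x) powr (t - 2) * (cmod (g x))\<^sup>2"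
          by (cases "g x = 0") (simp_all add: powr_diff powr_numeral)
        also have "\<dots> \<le> s powr (t - 2) * (cmod (g x))\<^sup>2"
          using elim t by (intro mult_right_mono powr_mono2) auto
        finally show ?case by (simp add: ennreal_mult[symmetric] ennreal_leI)
      qed
    qed
    also have "\<dots> = ennreal (s powr (t - 2)) * (\<integral>\<^sup>+ x. ennreal ((cmod (g x))\<^sup>2) \<partial>M)"
      by (rule nn_integral_cmult) measurable
    also have "\<dots> \<le> ennreal (s powr (t - 2)) * ennreal (C\<^sup>2 * R\<^sup>2)"
      using L2 by (rule mult_left_mono) simp
    also have "\<dots> = ennreal V" by (simp add: V_def ennreal_mult)
    finally have NV: "N \<le> ennreal V" .
    then have Nfin: "N \<noteq> \<infinity>" by (auto simp: top_unique)
    have "Lq_norm M q g = ennreal (enn2real N powr (1 / t))"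
      using False Nfin by (simp add: Lq_norm_def N_def t_def Let_def)
    also have "\<dots> \<le> ennreal (V powr (1 / t))"
      using NV V0 t by (intro ennreal_leI powr_mono2) (auto intro: enn2real_leI)
    also have "V powr (1 / t) = C * n powr (1 / 2 - 1 / t) * R"
    proof (cases "C * R = 0")
      case True
      then have "V = 0" by (auto simp: V_def)
      then show ?thesis using True by auto
    next
      case False
      then have CR: "0 < C * R" using C R by (simp add: less_le)
      have "V = (sqrt n powr (t - 2)) * (C * R) powr t"
      proof -
        have "s = sqrt n * (C * R)" by (simp add: s_def)
        then have "s powr (t - 2) = sqrt n powr (t - 2) * (C * R) powr (t - 2)"
          using CR by (simp add: powr_mult)
        moreover have "(C * R) powr (t - 2) * (C * R)\<^sup>2 = (C * R) powr t"
          using CR by (simp add: powr_diff powr_numeral)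
        ultimately show ?thesis by (simp add: V_def power_mult_distrib mult.assoc)
      qed
      then have "V powr (1 / t) = (sqrt n powr (t - 2)) powr (1 / t) * ((C * R) powr t) powr (1 / t)"
        by (simp add: powr_mult)
      also have "((C * R) powr t) powr (1 / t) = C * R" using CR t by (simp add: powr_powr)
      also have "(sqrt n powr (t - 2)) powr (1 / t) = n powr (1 / 2 - 1 / t)"
        using t n by (simp add: powr_half_sqrt[symmetric] powr_powr field_simps)
      finally show ?thesis by simp
    qed
    finally show ?thesis unfolding inv_t .
  qed
  then show ?thesis unfolding C_def g_def .
qed

end

section \<open>From the sample size to recovery for both decoders\<close>

lemma bounded_system_of_bos:
  assumes T: "topological_prob_space T M" and S: "bounded_orthonormal_system T M I b"
    and B: "system_bound M I b = ennreal B" "0 \<le> B"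
  shows "bounded_system M I b B"
proof -
  interpret prob_space M using T by (simp add: topological_prob_space_def)
  have S': "continuous_orthonormal_system T M I b" using S by (simp add: bounded_orthonormal_system_def)
  have meas: "b j \<in> borel_measurable M" if "j \<in> I" for j
  proof (rule borel_measurableI)
    fix U :: "complex set" assume "open U"
    have "continuous_map T euclidean (b j)" using S' that by (simp add: continuous_orthonormal_system_def)
    then have "openin T {x \<in> topspace T. b j x \<in> U}"
      using \<open>open U\<close> openin_continuous_map_preimage by fastforce
    moreover have "b j -` U \<inter> space M = {x \<in> topspace T. b j x \<in> U}"
      using T by (auto simp: topological_prob_space_def)
    ultimately show "b j -` U \<inter> space M \<in> sets M" using T by (simp add: topological_prob_space_def)
  qed
  show ?thesis
  proof
    show "countable I" using S' by (simp add: continuous_orthonormal_system_def)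
    show "b j \<in> borel_measurable M" if "j \<in> I" for j using meas[OF that] .
    show "AE x in M. cmod (b j x) \<le> B" if "j \<in> I" for j
    proof -
      have "esssup M (\<lambda>x. ennreal (cmod (b j x))) \<le> ennreal B"
        unfolding B(1)[symmetric] system_bound_def using that by (intro SUP_upper2[OF that]) (simp add: Lq_norm_def)
      moreover have "AE x in M. ennreal (cmod (b j x)) \<le> esssup M (\<lambda>x. ennreal (cmod (b j x)))"
        by (rule esssup_AE)
      ultimately have "AE x in M. ennreal (cmod (b j x)) \<le> ennreal B"
        by (auto elim!: eventually_mono intro: order_trans)
      then show ?thesis using B(2) by simp
    qed
    show "L2_inner M (b i) (b j) = (if i = j then 1 else 0)" if "i \<in> I" "j \<in> I" for i j
      using S' that by (simp add: continuous_orthonormal_system_def)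
  qed (rule B(2))
qed

text \<open>10^4 comes from the concentration bound, 104 = 4 * 26 from K^2 = 104 B^2 n, and 10^13
  from the comparison of logarithms.\<close>

definition sample_const :: real where "sample_const = 10 ^ 4 * 104 * 10 ^ 13"

context bounded_system
begin

text \<open>The near isometry is available for the truncated system. It passes to \<open>b\<close>
  on samples that avoid \<open>N\<close>, where both systems agree, and avoiding \<open>N\<close>
  costs no probability.\<close>

lemma sampling_event:
  fixes n m :: nat and \<gamma> :: real
  defines "P \<equiv> \<Pi>\<^sub>M l\<in>{..<m}. M"
  assumes n: "1 \<le> n" and \<gamma>: "0 < \<gamma>" "\<gamma> < 1" and J: "finite J" "J \<subseteq> I" "n < card J"
    and m: "sample_const * B\<^sup>2 * real n *
      ((log_factor B n)\<^sup>2 * ln (real (card J)) + ln (inverse \<gamma> * log_factor B n)) \<le> m"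
    and N: "N \<in> null_sets M" "\<And>x. x \<in> space M - N \<Longrightarrow> x \<in> good"
  shows "0 < m" and "\<exists>E\<in>sets P. 1 - \<gamma> \<le> measure P E \<and>
    (\<forall>X\<in>E. near_isometry J m (sample_matrix m b X) (26 * real n) \<and> (\<forall>l<m. X l \<in> space M - N))"
proof -
  have J0: "J \<noteq> {}" using J by auto
  interpret T: orthonormal_functions M J trunc B by (rule orthonormal_trunc[OF J(1,2) J0])
  interpret PS: product_prob_space "\<lambda>_::nat. M" "{..<m}" by unfold_locales
  interpret P: prob_space P unfolding P_def by (rule prob_space_PiM) (rule prob_space_axioms)
  have B1: "1 \<le> B" using J0 J bound_ge_one by auto
  define D where "D = B\<^sup>2 * real n"
  define L where "L = log_factor B n"
  have "1 * 1 \<le> D" unfolding D_def using B1 n by (intro mult_mono one_le_power) auto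
  then have D: "1 \<le> D" by simp
  have DL: "ln D \<le> L" by (simp add: D_def L_def log_factor_def)
  have Lc: "1 \<le> L \<and> 2 \<le> card J \<or> ln 2 \<le> L \<and> 3 \<le> card J"
  proof (cases "n = 1")
    case True
    then show ?thesis using J by (simp add: L_def log_factor_def)
  next
    case False
    then have n2: "2 \<le> n" using n by simp
    have "1 * 2 \<le> D" unfolding D_def using B1 n2 by (intro mult_mono one_le_power) auto
    then have "ln 2 \<le> L" using False by (simp add: L_def log_factor_def D_def)
    then show ?thesis using n2 J by auto
  qed
  obtain r :: nat and \<Lambda> where r: "0 < r" and \<Lambda>: "1 \<le> \<Lambda>" "8000 * (104 * D) \<le> exp \<Lambda>"
    and r2: "200 * (104 * D) \<le> 2 ^ r"
    and bound: "r * (9 * 1600\<^sup>2 * \<Lambda> * ln (4 * card J + 1)) + 2 * ln (2 * r / \<gamma>)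
      \<le> 10 ^ 13 * (L\<^sup>2 * ln (card J) + ln (inverse \<gamma> * L))"
    and pos: "0 < L\<^sup>2 * ln (card J) + ln (inverse \<gamma> * L)"
    using sample_size_suffices[OF D DL Lc \<gamma>] by blast
  have m': "10000 * (104 * D) * (10 ^ 13 * (L\<^sup>2 * ln (card J) + ln (inverse \<gamma> * L))) \<le> m"
    using m by (simp add: sample_const_def D_def L_def mult_ac)
  have "0 < 10000 * (104 * D) * (10 ^ 13 * (L\<^sup>2 * ln (card J) + ln (inverse \<gamma> * L)))"
    using D pos by (intro mult_pos_pos) auto
  then show m0: "0 < m" using m' by linarith
  have K: "(2 * sqrt (26 * real n) * B)\<^sup>2 = 104 * D" by (simp add: D_def power_mult_distrib)
  have "10000 * (104 * D) * (r * (9 * 1600\<^sup>2 * \<Lambda> * ln (4 * card J + 1)) + 2 * ln (2 * r / \<gamma>)) \<le>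
      10000 * (104 * D) * (10 ^ 13 * (L\<^sup>2 * ln (card J) + ln (inverse \<gamma> * L)))"
    using D by (intro mult_left_mono bound) auto
  then have "10000 * (104 * D) * (r * (9 * 1600\<^sup>2 * \<Lambda> * ln (4 * card J + 1)) + 2 * ln (2 * r / \<gamma>)) \<le> m"
    using m' by (rule order_trans)
  then have "\<exists>E\<in>sets P. 1 - \<gamma> \<le> measure P E \<and>
      (\<forall>X\<in>E. near_isometry J m (\<lambda>l j. trunc j (X l) / sqrt m) (26 * real n))"
    unfolding P_def using n m0 \<gamma> r \<Lambda> r2 by (intro T.near_isometry_event) (simp_all add: K)
  then obtain E where E: "E \<in> sets P" "1 - \<gamma> \<le> measure P E"
    "\<And>X. X \<in> E \<Longrightarrow> near_isometry J m (\<lambda>l j. trunc j (X l) / sqrt m) (26 * real n)" by blast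
  define E' where "E' = {X \<in> E. \<forall>l\<in>{..<m}. X l \<notin> N}"
  have Nm: "N \<in> sets M" using N by auto
  have E's: "E' \<in> sets P"
  proof -
    have "E' = E \<inter> {X \<in> space P. \<forall>l\<in>{..<m}. X l \<notin> N}"
      using sets.sets_into_space[OF E(1)] by (auto simp: E'_def)
    moreover have "{X \<in> space P. \<forall>l\<in>{..<m}. X l \<notin> N} \<in> sets P"
      unfolding P_def using Nm by measurable
    ultimately show ?thesis using E by simp
  qed
  have "AE X in P. X l \<notin> N" if "l \<in> {..<m}" for l
    unfolding P_def using that AE_not_in[OF N(1)] by (intro AE_PiM_component) (auto intro: prob_space_axioms)
  then have "AE X in P. \<forall>l\<in>{..<m}. X l \<notin> N" by (simp add: AE_ball_countable)
  then have "measure P E' = measure P E"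
    using E(1) E's by (intro P.finite_measure_eq_AE) (auto simp: E'_def elim!: eventually_mono)
  moreover have "near_isometry J m (sample_matrix m b X) (26 * real n) \<and> (\<forall>l<m. X l \<in> space M - N)" if X: "X \<in> E'" for X
  proof -
    have XE: "X \<in> E" and "X \<in> space P" using X sets.sets_into_space[OF E(1)] by (auto simp: E'_def)
    then have "X l \<in> space M - N" if "l < m" for l
      using that X by (auto simp: E'_def P_def space_PiM PiE_iff)
    moreover from this have "sample_matrix m b X l j = trunc j (X l) / sqrt m" if "l < m" "j \<in> J" for l j
      using that J by (simp add: sample_matrix_def trunc_eq[OF N(2)] subset_iff)
    then have "(\<Sum>l<m. (cmod (\<Sum>j\<in>J. trunc j (X l) / sqrt m * z j))\<^sup>2)
       = (\<Sum>l<m. (cmod (\<Sum>j\<in>J. sample_matrix m b X l j * z j))\<^sup>2)" for z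
      by simp
    then have "near_isometry J m (sample_matrix m b X) (26 * real n)"
      using E(3)[OF XE] by (simp add: near_isometry_def)
    ultimately show ?thesis by blast
  qed
  ultimately show "\<exists>E\<in>sets P. 1 - \<gamma> \<le> measure P E \<and>
    (\<forall>X\<in>E. near_isometry J m (sample_matrix m b X) (26 * real n) \<and> (\<forall>l<m. X l \<in> space M - N))"
    using E's E(2) by (intro bexI[of _ E']) auto
qed

text \<open>The data are exact measurements of the coefficients in \<open>J\<close>, perturbed by
  the samples of f - P_J f as noise.\<close>

lemma sample_vector_eq:
  "sample_vector m X f l = mat_vec J (sample_matrix m b X) (coeff f) l
     + (f (X l) - proj M b J f (X l)) / complex_of_real (sqrt m)"
  by (simp add: sample_vector_def mat_vec_def sample_matrix_def proj_def coeff_def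
      diff_divide_distrib sum_divide_distrib mult.commute)

lemma sample_noise_le:
  assumes "0 < m" "0 \<le> s" "\<And>l. l < m \<Longrightarrow> cmod (h (X l)) \<le> s"
  shows "vec_norm m (\<lambda>l. h (X l) / complex_of_real (sqrt m)) \<le> s"
proof (rule power2_le_imp_le)
  have "(vec_norm m (\<lambda>l. h (X l) / complex_of_real (sqrt m)))\<^sup>2 = (\<Sum>l<m. (cmod (h (X l)))\<^sup>2 / m)"
    using assms by (simp add: vec_norm_sq norm_divide power_divide)
  also have "\<dots> \<le> (\<Sum>l<m. s\<^sup>2 / m)"
    using assms by (intro sum_mono divide_right_mono power_mono) auto
  finally show "(vec_norm m (\<lambda>l. h (X l) / complex_of_real (sqrt m)))\<^sup>2 \<le> s\<^sup>2" using assms by simp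
qed (rule assms(2))

text \<open>The hypothesis \<open>stable\<close> isolates what the two decoders have in common;
  nothing else about \<open>p\<close> enters.\<close>

lemma Lq_recovery:
  fixes n :: nat
  assumes f: "f \<in> wiener_space M I b" and J: "finite J" "J \<subseteq> I" "J \<noteq> {}" and n: "1 \<le> n" and m: "0 < m"
    and X: "\<And>s. 0 \<le> s \<Longrightarrow> (AE y in M. cmod (f y - proj M b J f y) \<le> s) \<Longrightarrow>
      \<forall>l<m. cmod (f (X l) - proj M b J f (X l)) \<le> s"
    and stable: "\<And>K. K \<subseteq> J \<Longrightarrow> card K \<le> n \<Longrightarrow>
      (\<Sum>j\<in>J. cmod (p j - coeff f j)) \<le> 300 * ((\<Sum>j\<in>J - K. cmod (coeff f j))
        + sqrt n * vec_norm m (\<lambda>l. (f (X l) - proj M b J f (X l)) / complex_of_real (sqrt m))) \<and>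
      sqrt n * coeff_norm J (\<lambda>j. p j - coeff f j) \<le> 300 * ((\<Sum>j\<in>J - K. cmod (coeff f j))
        + sqrt n * vec_norm m (\<lambda>l. (f (X l) - proj M b J f (X l)) / complex_of_real (sqrt m)))"
    and q: "2 \<le> q"
  shows "Lq_norm M q (\<lambda>x. f x - (\<Sum>j\<in>J. p j * b j x))
    \<le> ennreal ((300 * (B + 2) + 2) * real n powr (1 / 2 - enn2real (1 / q))) *
       (ennreal (real n powr (- 1 / 2)) * best_approx M I b n f
        + Lq_norm M \<infinity> (\<lambda>x. f x - proj M b J f x))"
proof -
  let ?h = "\<lambda>x. f x - proj M b J f x"
  let ?tail = "\<lambda>K. \<Sum>j\<in>J - K. cmod (coeff f j)"
  note [measurable] = wiener_measurable[OF f]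
  have bm: "b j \<in> borel_measurable M" if "j \<in> J" for j using that J by auto
  have [measurable]: "proj M b J f \<in> borel_measurable M"
    unfolding proj_def using bm by (intro borel_measurable_sum borel_measurable_times) auto
  define bd where "bd = B * (\<Sum>\<^sub>\<infinity>j\<in>I. cmod (coeff f j)) + (\<Sum>j\<in>J. cmod (coeff f j) * B)"
  have hb: "cmod (?h x) \<le> bd" if x: "x \<in> good" for x
  proof -
    have "cmod (proj M b J f x) \<le> (\<Sum>j\<in>J. cmod (coeff f j) * B)"
      unfolding proj_def coeff_def[symmetric] using x J
      by (intro sum_norm_le) (auto simp: norm_mult good_def intro!: mult_left_mono)
    then show ?thesis using wiener_bounded[OF f x] norm_triangle_ineq4[of "f x" "proj M b J f x"]
      unfolding bd_def by linarith
  qed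
  have "esssup M (\<lambda>x. ennreal (cmod (?h x))) \<le> ennreal bd"
    using AE_good hb by (intro esssup_I) (auto elim!: eventually_mono intro: ennreal_leI)
  then have fin: "Lq_norm M \<infinity> ?h \<noteq> \<infinity>" by (auto simp: Lq_norm_def top_unique)
  define \<eta> where "\<eta> = enn2real (Lq_norm M \<infinity> ?h)"
  have \<eta>: "Lq_norm M \<infinity> ?h = ennreal \<eta>" "0 \<le> \<eta>" using fin by (simp_all add: \<eta>_def less_top)
  have "AE x in M. ennreal (cmod (?h x)) \<le> ennreal \<eta>"
    unfolding \<eta>(1)[symmetric] by (simp add: Lq_norm_def esssup_AE)
  then have AE\<eta>: "AE x in M. cmod (?h x) \<le> \<eta>" using \<eta>(2) by simp
  define Ks where "Ks = {K. K \<subseteq> J \<and> card K \<le> n}"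
  have Ks: "finite Ks" "Ks \<noteq> {}" unfolding Ks_def using J by (auto intro!: exI[of _ "{}"])
  \<comment> \<open>A minimum over finitely many sets replaces the infimum in
    \<open>best_approx\<close>, so that an optimal \<open>K\<close> can be inserted into
    \<open>stable\<close>.\<close>
  define \<sigma> where "\<sigma> = Min (?tail ` Ks)"
  have "\<sigma> \<in> ?tail ` Ks" unfolding \<sigma>_def using Ks by (intro Min_in) auto
  then obtain K where K: "K \<subseteq> J" "card K \<le> n" "\<sigma> = ?tail K" by (auto simp: Ks_def)
  have \<sigma>0: "0 \<le> \<sigma>" unfolding K(3) by (intro sum_nonneg) auto
  have "\<sigma> \<le> ?tail K" if "K \<subseteq> J" "card K \<le> n" for K
    unfolding \<sigma>_def using that Ks by (intro Min_le) (auto simp: Ks_def)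
  then have \<sigma>: "ennreal \<sigma> \<le> best_approx M I b n f" by (rule best_approx_ge[OF f J(1,2)])
  define R where "R = real n powr (- 1 / 2) * \<sigma> + \<eta>"
  have np: "real n powr (- 1 / 2) = 1 / sqrt n" using n by (simp add: powr_minus_divide powr_half_sqrt)
  have R: "\<eta> \<le> R" "sqrt n * R = \<sigma> + sqrt n * \<eta>"
    unfolding R_def np using \<sigma>0 n by (simp_all add: distrib_left)
  have "vec_norm m (\<lambda>l. (f (X l) - proj M b J f (X l)) / complex_of_real (sqrt m)) \<le> \<eta>"
    using X[OF \<eta>(2) AE\<eta>] by (intro sample_noise_le[of m \<eta> ?h X] m \<eta>(2)) auto
  then have "sqrt n * vec_norm m (\<lambda>l. (f (X l) - proj M b J f (X l)) / complex_of_real (sqrt m)) \<le> sqrt n * \<eta>"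
    by (intro mult_left_mono) auto
  then have l: "(\<Sum>j\<in>J. cmod (p j - coeff f j)) \<le> 300 * (sqrt n * R)"
    "sqrt n * coeff_norm J (\<lambda>j. p j - coeff f j) \<le> 300 * (sqrt n * R)"
    using stable[OF K(1,2), THEN conjunct1] stable[OF K(1,2), THEN conjunct2] unfolding R(2) K(3) by argo+
  have "sqrt n * coeff_norm J (\<lambda>j. p j - coeff f j) \<le> sqrt n * (300 * R)" using l(2) by simp
  then have l2: "coeff_norm J (\<lambda>j. p j - coeff f j) \<le> 300 * R" using n by simp
  have "Lq_norm M q (\<lambda>x. f x - (\<Sum>j\<in>J. p j * b j x))
    \<le> ennreal ((300 * (B + 2) + 2) * n powr (1 / 2 - enn2real (1 / q)) * R)"
    by (rule Lq_error[OF f J n AE\<eta> \<eta>(2) R(1) _ l(1) l2 q]) simp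
  also have "\<dots> = ennreal ((300 * (B + 2) + 2) * n powr (1 / 2 - enn2real (1 / q))) * ennreal R"
    using B_nonneg R \<eta>(2) by (intro ennreal_mult) auto
  also have "ennreal R = ennreal (real n powr (- 1 / 2)) * ennreal \<sigma> + ennreal \<eta>"
    unfolding R_def using \<sigma>0 \<eta>(2) by (simp add: ennreal_mult)
  also have "ennreal ((300 * (B + 2) + 2) * n powr (1 / 2 - enn2real (1 / q))) * (ennreal (real n powr (- 1 / 2)) * ennreal \<sigma> + ennreal \<eta>)
     \<le> ennreal ((300 * (B + 2) + 2) * n powr (1 / 2 - enn2real (1 / q))) *
        (ennreal (real n powr (- 1 / 2)) * best_approx M I b n f + Lq_norm M \<infinity> ?h)"
    unfolding \<eta>(1) using \<sigma> by (intro mult_left_mono add_mono) auto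
  finally show ?thesis .
qed

lemma recovery_event:
  fixes n m :: nat and \<gamma> :: real
  assumes n: "1 \<le> n" and \<gamma>: "0 < \<gamma>" "\<gamma> < 1" and J: "finite J" "J \<subseteq> I" "n < card J"
    and e: "bij_betw e {..<card J} J" and r: "rlasso_rule J m (3 * sqrt (real n)) r"
    and m: "sample_const * B\<^sup>2 * real n *
      ((log_factor B n)\<^sup>2 * ln (real (card J)) + ln (inverse \<gamma> * log_factor B n)) \<le> real m"
    and H: "H = rlasso_decoder r b J m \<or> H = omp_decoder e (24 * n) b J m"
  shows "\<exists>E \<in> sets (\<Pi>\<^sub>M l\<in>{..<m}. M).
    measure (\<Pi>\<^sub>M l\<in>{..<m}. M) E \<ge> 1 - \<gamma> \<and>
    (\<forall>X\<in>E. \<forall>q\<ge>2. \<forall>f \<in> wiener_space M I b.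
       Lq_norm M q (\<lambda>x. f x - H X f x)
         \<le> ennreal ((300 * (B + 2) + 2) * real n powr (1 / 2 - enn2real (1 / q))) *
            (ennreal (real n powr (- 1 / 2)) * best_approx M I b n f
             + Lq_norm M \<infinity> (\<lambda>x. f x - proj M b J f x)))"
proof -
  have J0: "J \<noteq> {}" using J by auto
  from sampling_null_set obtain N where N_null: "N \<in> null_sets M" and
    N_all: "\<forall>x\<in>space M - N. x \<in> good \<and>
      (\<forall>f\<in>wiener_space M I b. \<forall>J s. finite J \<longrightarrow> J \<subseteq> I \<longrightarrow> 0 \<le> s \<longrightarrow>
        (AE y in M. cmod (f y - proj M b J f y) \<le> s) \<longrightarrow> cmod (f x - proj M b J f x) \<le> s)"
    by (rule bexE)
  have N_good: "x \<in> good" if "x \<in> space M - N" for x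
    using bspec[OF N_all that] by (rule conjunct1)
  have N_le: "cmod (f x - proj M b J f x) \<le> s"
    if "x \<in> space M - N" "f \<in> wiener_space M I b" "0 \<le> s" "AE y in M. cmod (f y - proj M b J f y) \<le> s" for x f s
    using bspec[OF N_all that(1), THEN conjunct2, rule_format, OF that(2) J(1,2) that(3,4)] .
  have m0: "0 < m" by (rule sampling_event(1)[OF n \<gamma> J m N_null N_good])
  from sampling_event(2)[OF n \<gamma> J m N_null N_good] obtain E where Es: "E \<in> sets (\<Pi>\<^sub>M l\<in>{..<m}. M)" and
    E_all: "1 - \<gamma> \<le> measure (\<Pi>\<^sub>M l\<in>{..<m}. M) E \<and>
      (\<forall>X\<in>E. near_isometry J m (sample_matrix m b X) (26 * real n) \<and> (\<forall>l<m. X l \<in> space M - N))"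
    by (rule bexE)
  have ni: "near_isometry J m (sample_matrix m b X) (26 * real n)" if "X \<in> E" for X
    using bspec[OF conjunct2[OF E_all] that] by (rule conjunct1)
  have XN: "X l \<in> space M - N" if "X \<in> E" "l < m" for X l
    using bspec[OF conjunct2[OF E_all] that(1)] that(2) by (elim conjE allE impE)
  have "Lq_norm M q (\<lambda>x. f x - H X f x)
               \<le> ennreal ((300 * (B + 2) + 2) * real n powr (1 / 2 - enn2real (1 / q))) *
                  (ennreal (real n powr (- 1 / 2)) * best_approx M I b n f
                   + Lq_norm M \<infinity> (\<lambda>x. f x - proj M b J f x))"
    if X: "X \<in> E" and q: "2 \<le> q" and f: "f \<in> wiener_space M I b" for X q f
  proof -
    define A where "A = sample_matrix m b X"
    define y where "y = sample_vector m X f"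
    define \<epsilon> where "\<epsilon> l = (f (X l) - proj M b J f (X l)) / complex_of_real (sqrt m)" for l
    define p where "p = (if H = rlasso_decoder r b J m then r A y else snd (omp e J m A y (24 * n)))"
    have Hp: "H X f x = (\<Sum>j\<in>J. p j * b j x)" for x
      using H by (auto simp: p_def A_def y_def rlasso_decoder_def omp_decoder_def)
    have y: "y l = mat_vec J A (coeff f) l + \<epsilon> l" for l
      unfolding y_def A_def \<epsilon>_def by (rule sample_vector_eq)
    have niA: "near_isometry J m A (26 * real n)" using ni[OF X] by (simp add: A_def)
    have stable: "(\<Sum>j\<in>J. cmod (p j - coeff f j)) \<le> 300 * ((\<Sum>j\<in>J - K. cmod (coeff f j)) + sqrt n * vec_norm m \<epsilon>) \<and>
        sqrt n * coeff_norm J (\<lambda>j. p j - coeff f j) \<le> 300 * ((\<Sum>j\<in>J - K. cmod (coeff f j)) + sqrt n * vec_norm m \<epsilon>)"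
      if K: "K \<subseteq> J" "card K \<le> n" for K
    proof (cases "H = rlasso_decoder r b J m")
      case True
      then have "is_arg_min (rlasso_objective J m (3 * sqrt n) A y) (\<lambda>z. z \<in> coeff_vectors J) p"
        using r by (simp add: rlasso_rule_def p_def)
      note st = rlasso_stable[OF niA n J(1) y this K]
      \<comment> \<open>Nonnegativity lets the Lasso constant 12 be raised to the 300 of orthogonal
        matching pursuit.\<close>
      have "0 \<le> (\<Sum>j\<in>J - K. cmod (coeff f j)) + sqrt n * vec_norm m \<epsilon>"
        by (intro add_nonneg_nonneg sum_nonneg mult_nonneg_nonneg) auto
      then show ?thesis using st by argo
    next
      case False
      then have "p = snd (omp e J m A y (24 * n))" by (simp add: p_def)
      then show ?thesis using omp_stable[OF niA n J(1) J0 e y K] by simp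
    qed
    show ?thesis
      unfolding Hp
    proof (rule Lq_recovery[OF f J(1,2) J0 n m0 _ _ q])
      show "\<forall>l<m. cmod (f (X l) - proj M b J f (X l)) \<le> s"
        if "0 \<le> s" "AE y in M. cmod (f y - proj M b J f y) \<le> s" for s
        using N_le[OF XN[OF X] f that] by simp
    qed (rule stable[unfolded \<epsilon>_def[abs_def]])
  qed
  then show ?thesis using E_all by (intro bexI[OF _ Es] conjI ballI allI impI) simp_all
qed

end

theorem theorem2p8:
  shows "\<exists>\<alpha>>0. \<exists>\<tau>>0. \<forall>B\<ge>0. \<exists>C>0.
    \<forall>(T :: 'a topology) (M :: 'a measure) (I :: 'i set) (b :: 'i \<Rightarrow> 'a \<Rightarrow> complex).
      topological_prob_space T M \<longrightarrow>
      bounded_orthonormal_system T M I b \<longrightarrow>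
      system_bound M I b = ennreal B \<longrightarrow>
      (\<forall>(n :: nat) (\<gamma> :: real) (J :: 'i set) (m :: nat)
         (e :: nat \<Rightarrow> 'i) (r :: (nat \<Rightarrow> 'i \<Rightarrow> complex) \<Rightarrow> (nat \<Rightarrow> complex) \<Rightarrow> 'i \<Rightarrow> complex) H.
         n \<ge> 1 \<longrightarrow> 0 < \<gamma> \<longrightarrow> \<gamma> < 1 \<longrightarrow>
         finite J \<longrightarrow> J \<subseteq> I \<longrightarrow> n < card J \<longrightarrow>
         bij_betw e {..<card J} J \<longrightarrow>
         rlasso_rule J m (3 * \<tau> * sqrt (real n)) r \<longrightarrow>
         real m \<ge> \<alpha> * B\<^sup>2 * real n *
           ((log_factor B n)\<^sup>2 * ln (real (card J)) + ln (inverse \<gamma> * log_factor B n)) \<longrightarrow>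
         H = rlasso_decoder r b J m \<or> H = omp_decoder e (24 * n) b J m \<longrightarrow>
         (\<exists>E \<in> sets (\<Pi>\<^sub>M l\<in>{..<m}. M).
            measure (\<Pi>\<^sub>M l\<in>{..<m}. M) E \<ge> 1 - \<gamma> \<and>
            (\<forall>X\<in>E. \<forall>q\<ge>2. \<forall>f \<in> wiener_space M I b.
               Lq_norm M q (\<lambda>x. f x - H X f x)
                 \<le> ennreal (C * real n powr (1 / 2 - enn2real (1 / q))) *
                    (ennreal (real n powr (- 1 / 2)) * best_approx M I b n f
                     + Lq_norm M \<infinity> (\<lambda>x. f x - proj M b J f x)))))"
proof (rule exI[of _ sample_const], intro conjI, goal_cases)
  case 1
  show ?case by (simp add: sample_const_def)
next
  case 2
  show ?case
  \<comment> \<open>The witness for \<tau> is 1, since the Lasso was analysed with weight 3 sqrt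
    n.\<close>
  proof (rule exI[of _ 1], intro conjI allI impI, goal_cases)
    case (2 B)
    show ?case
    \<comment> \<open>The constant D * (B + 2) + 2 of the error bound at the stability constant D =
      300.\<close>
    proof (rule exI[of _ "300 * (B + 2) + 2"], intro conjI allI impI, goal_cases)
      case 1
      show ?case using 2 by simp
    next
      case prems: (2 T M I b n \<gamma> J m e r H)
      interpret bounded_system M I b B
        by (rule bounded_system_of_bos[OF prems(1-3) 2])
      show ?case by (rule recovery_event) (use prems in auto)
    qed
  qed simp
qed

end
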